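(* Let $G=G(\mathcal V,\mathcal E)$ and $G'=G(\mathcal V',\mathcal E')$ be finite strongly connected directed graphs, not cycles, such that $G(\mathcal V,\mathcal F_G)$ and $G(\mathcal V',\mathcal F_{G'})$ are trees of uniform depth two, and suppose that the Markov-Dyck shifts $MD(G)$ and $MD(G')$ are topologically conjugate. (a) If $G$ is spherically homogeneous, then $G'$ is spherically homogeneous. (b) If $G$ and $G'$ are spherically homogeneous, then $G$ and $G'$ are isomorphic.
   Context: Graphs are finite directed graphs $G=G(\mathcal V,\mathcal E)$ (loops and multiple edges allowed) with source map $s$ and target map $t$. Graph inverse semigroup $\mathcal S(G)$: the semigroup with zero generated by $\mathbf 1_V$ ($V\in\mathcal V$), $e^-,e^+$ ($e\in\mathcal E$), with relations $\mathbf 1_V^2=\mathbf 1_V$, $\mathbf 1_U\mathbf 1_W=0$ for $U\ne W$, $f^-f^+=\mathbf 1_{s(f)}$, $f^-g^+=0$ for $f\neq g$, $\mathbf 1_{s(f)}f^-=f^-=f^-\mathbf 1_{t(f)}$, $\mathbf 1_{t(f)}f^+=f^+=f^+\mathbf 1_{s(f)}$. Markov-Dyck shift $MD(G)$: the subshift with alphabet $\{e^-,e^+:e\in\mathcal E\}$ in which a word is admissible precisely if its product in $\mathcal S(G)$ is not $0$. A topological conjugacy is a shift-commuting homeomorphism. $\mathcal F_G$ is the set of edges that are the only incoming edge of their target vertex. Suppose $G(\mathcal V,\mathcal F_G)$ is a directed tree (the subtree of $G$), with root $V(0)$; then every $e\in\mathcal E\setminus\mathcal F_G$ has target $V(0)$.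 The level of a vertex is its distance from $V(0)$ in this tree. The tree is said to have uniform height (or depth) two if all of its leaves are at level two and the source vertices of all edges $e\in\mathcal E\setminus\mathcal F_G$ are at level two. $G$ is spherically homogeneous if all leaves of the subtree are at the same level, all vertices of the subtree at the same level have the same out-degree in the subtree, all source vertices of edges in $\mathcal E\setminus\mathcal F_G$ are leaves of the subtree, and all leaves have the same out-degree in $G$. *)

theory Defs
  imports "HOL-Analysis.Function_Topology" "Graph_Theory.Digraph_Isomorphism"
begin

text \<open>Graphs are \<open>pre_digraph\<close> records; \<open>tail\<close> is the source map \<open>s\<close> and \<open>head\<close> is the
  target map \<open>t\<close>. The locale \<open>fin_digraph\<close> allows loops and multiple arcs.\<close>


section \<open>Graph inverse semigroups\<close>

text \<open>\<open>Neg e\<close> and \<open>Pos e\<close> stand for \<open>e\<^sup>-\<close> and \<open>e\<^sup>+\<close>; \<open>Idem V\<close> stands for the idempotent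
  \<open>1\<close> at the vertex \<open>V\<close>.\<close>

datatype 'e dyck_symbol = Neg 'e | Pos 'e

datatype ('v, 'e) gis_generator = Zero | Idem 'v | Letter "'e dyck_symbol"

definition dyck_alphabet :: "('v, 'e) pre_digraph \<Rightarrow> 'e dyck_symbol set" where
  "dyck_alphabet G = Neg ` arcs G \<union> Pos ` arcs G"

definition gis_generators :: "('v, 'e) pre_digraph \<Rightarrow> ('v, 'e) gis_generator set" where
  "gis_generators G = insert Zero (Idem ` verts G \<union> Letter ` dyck_alphabet G)"

definition gis_words :: "('v, 'e) pre_digraph \<Rightarrow> ('v, 'e) gis_generator list set" where
  "gis_words G = {w. w \<noteq> [] \<and> set w \<subseteq> gis_generators G}"

text \<open>The defining relations; the first two make \<open>Zero\<close> a zero element.\<close>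

inductive gis_relation ::
  "('v, 'e) pre_digraph \<Rightarrow> ('v, 'e) gis_generator list \<Rightarrow> ('v, 'e) gis_generator list \<Rightarrow> bool"
  for G where
  zero_left: "x \<in> gis_generators G \<Longrightarrow> gis_relation G [Zero, x] [Zero]"
| zero_right: "x \<in> gis_generators G \<Longrightarrow> gis_relation G [x, Zero] [Zero]"
| idem: "V \<in> verts G \<Longrightarrow> gis_relation G [Idem V, Idem V] [Idem V]"
| idem_orth: "\<lbrakk>U \<in> verts G; W \<in> verts G; U \<noteq> W\<rbrakk> \<Longrightarrow> gis_relation G [Idem U, Idem W] [Zero]"
| neg_pos: "f \<in> arcs G \<Longrightarrow> gis_relation G [Letter (Neg f), Letter (Pos f)] [Idem (tail G f)]"
| neg_pos_orth: "\<lbrakk>f \<in> arcs G; g \<in> arcs G; f \<noteq> g\<rbrakk> \<Longrightarrow>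
    gis_relation G [Letter (Neg f), Letter (Pos g)] [Zero]"
| source_neg: "f \<in> arcs G \<Longrightarrow> gis_relation G [Idem (tail G f), Letter (Neg f)] [Letter (Neg f)]"
| neg_target: "f \<in> arcs G \<Longrightarrow> gis_relation G [Letter (Neg f), Idem (head G f)] [Letter (Neg f)]"
| target_pos: "f \<in> arcs G \<Longrightarrow> gis_relation G [Idem (head G f), Letter (Pos f)] [Letter (Pos f)]"
| pos_source: "f \<in> arcs G \<Longrightarrow> gis_relation G [Letter (Pos f), Idem (tail G f)] [Letter (Pos f)]"

inductive gis_cong ::
  "('v, 'e) pre_digraph \<Rightarrow> ('v, 'e) gis_generator list \<Rightarrow> ('v, 'e) gis_generator list \<Rightarrow> bool"
  for G where
  base: "gis_relation G u v \<Longrightarrow> gis_cong G u v"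
| refl: "u \<in> gis_words G \<Longrightarrow> gis_cong G u u"
| sym: "gis_cong G u v \<Longrightarrow> gis_cong G v u"
| trans: "\<lbrakk>gis_cong G u v; gis_cong G v w\<rbrakk> \<Longrightarrow> gis_cong G u w"
| mult: "\<lbrakk>gis_cong G u u'; gis_cong G v v'\<rbrakk> \<Longrightarrow> gis_cong G (u @ v) (u' @ v')"

text \<open>\<open>\<S>(G)\<close> is the quotient of the free semigroup of nonempty words by this congruence. Its
  multiplication is induced by concatenation, so the product in \<open>\<S>(G)\<close> of the letters of a
  nonempty word \<open>w\<close> is the congruence class \<open>gis_class G w\<close>.\<close>

definition gis_class ::
  "('v, 'e) pre_digraph \<Rightarrow> ('v, 'e) gis_generator list \<Rightarrow> ('v, 'e) gis_generator list set" where
  "gis_class G w = {w'. gis_cong G w w'}"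

definition graph_inverse_semigroup ::
  "('v, 'e) pre_digraph \<Rightarrow> ('v, 'e) gis_generator list set set" where
  "graph_inverse_semigroup G = gis_class G ` gis_words G"

definition gis_mult ::
  "('v, 'e) pre_digraph \<Rightarrow> ('v, 'e) gis_generator list set \<Rightarrow> ('v, 'e) gis_generator list set
    \<Rightarrow> ('v, 'e) gis_generator list set" where
  "gis_mult G A B = (\<Union>u\<in>A. \<Union>v\<in>B. gis_class G (u @ v))"

definition gis_zero :: "('v, 'e) pre_digraph \<Rightarrow> ('v, 'e) gis_generator list set" where
  "gis_zero G = gis_class G [Zero]"

lemma gis_class_eq_iff:
  assumes "u \<in> gis_words G"
  shows "gis_class G u = gis_class G v \<longleftrightarrow> gis_cong G u v"
proof
  assume "gis_class G u = gis_class G v"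
  then have "gis_cong G v u"
    using gis_cong.refl[OF assms] by (auto simp: gis_class_def)
  then show "gis_cong G u v" by (rule gis_cong.sym)
next
  assume "gis_cong G u v"
  then show "gis_class G u = gis_class G v"
    by (auto simp: gis_class_def intro: gis_cong.trans gis_cong.sym)
qed

lemma gis_mult_class:
  assumes "u \<in> gis_words G" "v \<in> gis_words G"
  shows "gis_mult G (gis_class G u) (gis_class G v) = gis_class G (u @ v)"
proof -
  have "gis_class G (u' @ v') = gis_class G (u @ v)"
    if "gis_cong G u u'" "gis_cong G v v'" for u' v'
  proof -
    have "u @ v \<in> gis_words G" using assms by (auto simp: gis_words_def)
    with gis_cong.mult[OF that] show ?thesis using gis_class_eq_iff by metis
  qed
  moreover have "gis_cong G u u" "gis_cong G v v"
    using assms by (auto intro: gis_cong.refl)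
  ultimately show ?thesis
    unfolding gis_mult_def gis_class_def[of G u] gis_class_def[of G v] by blast
qed


section \<open>Markov-Dyck shifts and topological conjugacy\<close>

definition dyck_admissible :: "('v, 'e) pre_digraph \<Rightarrow> 'e dyck_symbol list \<Rightarrow> bool" where
  "dyck_admissible G w \<longleftrightarrow> gis_class G (map Letter w) \<noteq> gis_zero G"

text \<open>The blocks of a bi-infinite sequence \<open>x\<close> are the words \<open>x\<^sub>i \<dots> x\<^sub>j\<close>; for \<open>j < i\<close> the
  list \<open>[i..j]\<close> is empty, hence the condition \<open>i \<le> j\<close>.\<close>

definition markov_dyck :: "('v, 'e) pre_digraph \<Rightarrow> (int \<Rightarrow> 'e dyck_symbol) set" where
  "markov_dyck G =
    {x. range x \<subseteq> dyck_alphabet G \<and> (\<forall>i j. i \<le> j \<longrightarrow> dyck_admissible G (map x [i..j]))}"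

definition shift_map :: "(int \<Rightarrow> 'a) \<Rightarrow> int \<Rightarrow> 'a" where
  "shift_map x = (\<lambda>i. x (i + 1))"

definition subshift_topology :: "'a set \<Rightarrow> (int \<Rightarrow> 'a) set \<Rightarrow> (int \<Rightarrow> 'a) topology" where
  "subshift_topology A X = subtopology (product_topology (\<lambda>i. discrete_topology A) UNIV) X"

definition markov_dyck_topology :: "('v, 'e) pre_digraph \<Rightarrow> (int \<Rightarrow> 'e dyck_symbol) topology" where
  "markov_dyck_topology G = subshift_topology (dyck_alphabet G) (markov_dyck G)"

definition markov_dyck_conjugate :: "('v, 'e) pre_digraph \<Rightarrow> ('w, 'f) pre_digraph \<Rightarrow> bool" where
  "markov_dyck_conjugate G H \<longleftrightarrow>
    (\<exists>h. homeomorphic_map (markov_dyck_topology G) (markov_dyck_topology H) h \<and>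
         (\<forall>x\<in>markov_dyck G. h (shift_map x) = shift_map (h x)))"

lemma topspace_markov_dyck_topology: "topspace (markov_dyck_topology G) = markov_dyck G"
  by (auto simp: markov_dyck_topology_def subshift_topology_def markov_dyck_def)


section \<open>The subtree of a graph\<close>

definition only_incoming_arcs :: "('v, 'e) pre_digraph \<Rightarrow> 'e set" where
  "only_incoming_arcs G = {e \<in> arcs G. in_arcs G (head G e) = {e}}"

definition incoming_subgraph :: "('v, 'e) pre_digraph \<Rightarrow> ('v, 'e) pre_digraph" where
  "incoming_subgraph G = G\<lparr>arcs := only_incoming_arcs G\<rparr>"

text \<open>The uniqueness of the walk from \<open>r\<close> to \<open>r\<close> rules out arcs with target \<open>r\<close>.\<close>

definition is_tree_root :: "('v, 'e) pre_digraph \<Rightarrow> 'v \<Rightarrow> bool" where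
  "is_tree_root T r \<longleftrightarrow> r \<in> verts T \<and> (\<forall>v\<in>verts T. \<exists>!p. pre_digraph.awalk T r p v)"

definition directed_tree :: "('v, 'e) pre_digraph \<Rightarrow> bool" where
  "directed_tree T \<longleftrightarrow> wf_digraph T \<and> (\<exists>r. is_tree_root T r)"

definition tree_root :: "('v, 'e) pre_digraph \<Rightarrow> 'v" where
  "tree_root T = (THE r. is_tree_root T r)"

definition tree_level :: "('v, 'e) pre_digraph \<Rightarrow> 'v \<Rightarrow> nat" where
  "tree_level T v = (LEAST n. \<exists>p. pre_digraph.awalk T (tree_root T) p v \<and> length p = n)"

definition tree_leaves :: "('v, 'e) pre_digraph \<Rightarrow> 'v set" where
  "tree_leaves T = {v \<in> verts T. out_degree T v = 0}"

definition uniform_depth_two :: "('v, 'e) pre_digraph \<Rightarrow> bool" where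
  "uniform_depth_two G \<longleftrightarrow>
    directed_tree (incoming_subgraph G) \<and>
    (\<forall>v\<in>tree_leaves (incoming_subgraph G). tree_level (incoming_subgraph G) v = 2) \<and>
    (\<forall>e\<in>arcs G - only_incoming_arcs G. tree_level (incoming_subgraph G) (tail G e) = 2)"

definition spherically_homogeneous :: "('v, 'e) pre_digraph \<Rightarrow> bool" where
  "spherically_homogeneous G \<longleftrightarrow>
    (let T = incoming_subgraph G in
      directed_tree T \<and>
      (\<forall>u\<in>tree_leaves T. \<forall>v\<in>tree_leaves T. tree_level T u = tree_level T v) \<and>
      (\<forall>u\<in>verts T. \<forall>v\<in>verts T. tree_level T u = tree_level T v \<longrightarrow> out_degree T u = out_degree T v) \<and>
      (\<forall>e\<in>arcs G - only_incoming_arcs G. tail G e \<in> tree_leaves T) \<and>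
      (\<forall>u\<in>tree_leaves T. \<forall>v\<in>tree_leaves T. out_degree G u = out_degree G v))"

text \<open>The whole graph is a directed cycle; a single vertex with one loop counts as one.\<close>

definition is_cycle_graph :: "('v, 'e) pre_digraph \<Rightarrow> bool" where
  "is_cycle_graph G \<longleftrightarrow> (\<exists>p. pre_digraph.cycle G p \<and> set p = arcs G \<and> tail G ` set p = verts G)"

end

(*
  S(G) acts by partial maps on pairs of a stack of edges and a vertex: e^- pushes e and e^+ pops it. A word
  is admissible iff its action is not empty. In depth two every cycle has length divisible by three, so
  the points of odd period n < 9 read, up to reversal of time, around one loop b of length three with
  neutral words inserted. Whether a point of period n and one of period three are joined by a point
  asymptotic to them is invariant under conjugacy, and such a connection fails to exist only from negative
  points of one loop to positive points of another one. Hence it is invariant whether the number of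
  points of period n belonging to a loop depends on the loop. For n = 5 and n = 7 this number is determined by
  the out-degrees along the loop, and its constancy is spherical homogeneity. Finally the numbers of points of
  period 2, 3, 4, 5 determine the three out-degrees of a spherically homogeneous graph.
*)

theory Submission
  imports Defs
begin

section \<open>The action of the graph inverse semigroup on stacks\<close>

text \<open>A conjugacy need not respect symbols, levels or signs, so out-degrees have to be read
  off from periodic points and asymptotic behaviour alone. The stack supplies the link: a negative
  point piles up copies of its loop \<open>b\<close> forever, a positive point keeps popping such
  copies, and a finite word in between can alter only finitely many edges. Points of period three
  serve as names of loops, since every loop has exactly three negative and three positive ones. The
  bound nine is the next odd multiple of three after three: for odd \<open>n < 9\<close> the height
  over a period can only be 3 or -3. Writing \<open>m\<close>, \<open>k\<close>, \<open>l\<close>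
  for the out-degrees along a loop, period five sees \<open>m + k + l\<close>, and period seven,
  once siblings at level two have equal out-degrees, sees in addition the product
  \<open>k * m\<close>. It is the number of distinct connection counts that is compared, which makes
  the argument independent of how a conjugacy acts on signs and loops.\<close>

type_synonym ('v, 'e) stack_state = "'e list \<times> 'v"

text \<open>The vertex is kept beside the stack because an empty stack does not determine it. Stacks
  need not be paths, so arbitrary entries can be put underneath a run.\<close>

fun dyck_step :: "('v, 'e) pre_digraph \<Rightarrow> 'e dyck_symbol \<Rightarrow> ('v, 'e) stack_state \<Rightarrow> ('v, 'e) stack_state option"
  where
  "dyck_step G (Neg e) (s, v) = (if v = tail G e then Some (e # s, head G e) else None)"
| "dyck_step G (Pos e) ([], v) = None"
| "dyck_step G (Pos e) (f # s, v) = (if f = e \<and> v = head G e then Some (s, tail G e) else None)"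

fun dyck_run :: "('v, 'e) pre_digraph \<Rightarrow> 'e dyck_symbol list \<Rightarrow> ('v, 'e) stack_state \<Rightarrow> ('v, 'e) stack_state option"
  where
  "dyck_run G [] st = Some st"
| "dyck_run G (a # w) st = Option.bind (dyck_step G a st) (dyck_run G w)"

fun gis_step :: "('v, 'e) pre_digraph \<Rightarrow> ('v, 'e) gis_generator \<Rightarrow> ('v, 'e) stack_state \<Rightarrow> ('v, 'e) stack_state option"
  where
  "gis_step G Zero st = None"
| "gis_step G (Idem V) st = (if snd st = V then Some st else None)"
| "gis_step G (Letter a) st = dyck_step G a st"

fun gis_run :: "('v, 'e) pre_digraph \<Rightarrow> ('v, 'e) gis_generator list \<Rightarrow> ('v, 'e) stack_state \<Rightarrow> ('v, 'e) stack_state option"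
  where
  "gis_run G [] st = Some st"
| "gis_run G (a # w) st = Option.bind (gis_step G a st) (gis_run G w)"

lemma gis_run_append: "gis_run G (u @ v) st = Option.bind (gis_run G u st) (gis_run G v)"
  by (induction u arbitrary: st) (auto simp: Option.bind_assoc intro!: bind_option_cong)

lemma gis_run_letters: "gis_run G (map Letter w) st = dyck_run G w st"
  by (induction w arbitrary: st) (auto intro!: bind_option_cong)

lemma dyck_run_append: "dyck_run G (u @ v) st = Option.bind (dyck_run G u st) (dyck_run G v)"
  by (induction u arbitrary: st) (auto simp: Option.bind_assoc intro!: bind_option_cong)

lemma gis_relation_run: "gis_relation G u v \<Longrightarrow> gis_run G u st = gis_run G v st"
proof (induction rule: gis_relation.induct)
  case (zero_right x)
  show ?case by (cases "gis_step G x st") auto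
next
  case (neg_pos f)
  show ?case by (cases st) auto
next
  case (neg_pos_orth f g)
  then show ?case by (cases st) auto
next
  case (source_neg f)
  show ?case by (cases st) auto
next
  case (neg_target f)
  show ?case by (cases st) auto
next
  case (target_pos f)
  show ?case by (cases st; cases "fst st") auto
next
  case (pos_source f)
  show ?case by (cases st; cases "fst st") auto
qed auto

text \<open>Acting by the same partial map is itself a congruence that contains the defining
  relations. This is the half of the semantics by which a word with nonempty action is
  nonzero.\<close>

lemma gis_cong_run: "gis_cong G u v \<Longrightarrow> gis_run G u st = gis_run G v st"
proof (induction arbitrary: st rule: gis_cong.induct)
  case (base u v)
  then show ?case by (rule gis_relation_run)
next
  case (mult u u' v v')
  then show ?case by (auto simp: gis_run_append intro!: bind_option_cong)
qed simp_all

definition runs :: "('v, 'e) pre_digraph \<Rightarrow> 'e dyck_symbol list \<Rightarrow> bool" where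
  "runs G w \<longleftrightarrow> (\<exists>st. dyck_run G w st \<noteq> None)"

lemma gis_words_iff [simp]: "w \<in> gis_words G \<longleftrightarrow> w \<noteq> [] \<and> set w \<subseteq> gis_generators G"
  by (simp add: gis_words_def)

text \<open>The rule \<open>mult\<close> needs nonempty words on both sides, as the free semigroup
  has no unit; empty contexts are split off here once and for all.\<close>

lemma gis_cong_ctx:
  assumes "gis_cong G u v" "set a \<subseteq> gis_generators G" "set b \<subseteq> gis_generators G"
  shows "gis_cong G (a @ u @ b) (a @ v @ b)"
proof -
  have *: "gis_cong G (u @ b) (v @ b)"
  proof (cases "b = []")
    case False
    then have "gis_cong G b b" using assms(3) by (intro gis_cong.refl) simp
    then show ?thesis by (rule gis_cong.mult[OF assms(1)])
  qed (use assms in simp)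
  show ?thesis
  proof (cases "a = []")
    case False
    then have "gis_cong G a a" using assms(2) by (intro gis_cong.refl) simp
    from gis_cong.mult[OF this *] show ?thesis .
  qed (use * in simp)
qed

lemma zero_absorbs_right:
  assumes "set b \<subseteq> gis_generators G"
  shows "gis_cong G (Zero # b) [Zero]"
  using assms
proof (induction b)
  case Nil
  show ?case by (intro gis_cong.refl) (simp add: gis_generators_def)
next
  case (Cons x b)
  have "gis_cong G ([] @ [Zero, x] @ b) ([] @ [Zero] @ b)"
    using Cons.prems by (intro gis_cong_ctx gis_cong.base gis_relation.zero_left) auto
  then show ?case using Cons by (auto intro: gis_cong.trans)
qed

lemma zero_absorbs_left:
  assumes "set a \<subseteq> gis_generators G"
  shows "gis_cong G (a @ [Zero]) [Zero]"
  using assms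
proof (induction a rule: rev_induct)
  case Nil
  have "gis_cong G [Zero] [Zero]" by (intro gis_cong.refl) (simp add: gis_generators_def)
  then show ?case by simp
next
  case (snoc x b)
  have "gis_cong G (b @ [x, Zero] @ []) (b @ [Zero] @ [])"
    using snoc.prems by (intro gis_cong_ctx gis_cong.base gis_relation.zero_right) auto
  then show ?case using snoc by (auto intro: gis_cong.trans)
qed

lemma zero_factor:
  assumes "gis_cong G u [Zero]" "set a \<subseteq> gis_generators G" "set b \<subseteq> gis_generators G"
  shows "gis_cong G (a @ u @ b) [Zero]"
proof -
  have "gis_cong G (a @ u @ b) (a @ [Zero] @ b)" by (rule gis_cong_ctx[OF assms])
  moreover have "gis_cong G (a @ (Zero # b) @ []) (a @ [Zero] @ [])"
    using assms by (intro gis_cong_ctx zero_absorbs_right) auto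
  moreover have "gis_cong G (a @ [Zero]) [Zero]" using zero_absorbs_left assms by blast
  ultimately show ?thesis by (auto intro: gis_cong.trans)
qed

section \<open>Normal forms of nonzero products\<close>

context wf_digraph
begin

abbreviation lneg where "lneg \<equiv> map (\<lambda>e. Letter (Neg e) :: ('a, 'b) gis_generator)"
abbreviation lpos where "lpos \<equiv> map (\<lambda>e. Letter (Pos e) :: ('a, 'b) gis_generator)"

lemma generators [simp]:
  "Zero \<in> gis_generators G"
  "Idem V \<in> gis_generators G \<longleftrightarrow> V \<in> verts G"
  "Letter (Neg e) \<in> gis_generators G \<longleftrightarrow> e \<in> arcs G"
  "Letter (Pos e) \<in> gis_generators G \<longleftrightarrow> e \<in> arcs G"
  by (auto simp: gis_generators_def dyck_alphabet_def)

lemma gis_cong_mid: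
  assumes "gis_relation G u v" "set a \<subseteq> gis_generators G" "set b \<subseteq> gis_generators G"
    "w = a @ u @ b" "w' = a @ v @ b"
  shows "gis_cong G w w'"
  using gis_cong_ctx[OF gis_cong.base[OF assms(1)] assms(2,3)] assms(4,5) by simp

lemma incompatible_letters:
  assumes "v \<in> verts G" "v' \<in> verts G" "v \<noteq> v'"
    "gis_cong G x (x @ [Idem v])" "gis_cong G (Idem v' # y) y"
    "set x \<subseteq> gis_generators G" "set y \<subseteq> gis_generators G"
  shows "gis_cong G (x @ y) [Zero]"
proof -
  have "gis_cong G (x @ y) ((x @ [Idem v]) @ (Idem v' # y))"
    using assms by (intro gis_cong.mult gis_cong.sym[OF assms(5)]) auto
  moreover have "gis_cong G (x @ [Idem v, Idem v'] @ y) [Zero]"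
    using assms by (intro zero_factor gis_cong.base gis_relation.idem_orth) auto
  ultimately show ?thesis by (auto intro: gis_cong.trans)
qed

text \<open>The usual shape of a nonzero element: positive letters followed by negative ones. The
  idempotent between them is always present, so that both parts may be empty, and the two runs say
  that \<open>ps\<close> and \<open>qs\<close> are composable and meet at \<open>v\<close>.\<close>

definition normal_form :: "('a, 'b) gis_generator list \<Rightarrow> bool" where
  "normal_form u \<longleftrightarrow> (\<exists>ps v qs v0 v1. u = lpos ps @ [Idem v] @ lneg qs \<and>
     set ps \<subseteq> arcs G \<and> set qs \<subseteq> arcs G \<and> v \<in> verts G \<and>
     dyck_run G (map Pos ps) (ps, v0) = Some ([], v) \<and>
     dyck_run G (map Neg qs) ([], v) = Some (rev qs, v1))"

text \<open>Only the end of \<open>u\<close> matters: a negative letter extends \<open>qs\<close>; a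
  positive letter cancels the last entry of \<open>qs\<close>, or joins \<open>ps\<close> if
  \<open>qs\<close> is empty; a mismatch of vertices or edges gives zero.\<close>

lemma normal_form_snoc:
  assumes "normal_form u" "a \<in> dyck_alphabet G"
  shows "gis_cong G (u @ [Letter a]) [Zero] \<or> (\<exists>u'. normal_form u' \<and> gis_cong G (u @ [Letter a]) u')"
proof -
  obtain ps v qs v0 v1 where u: "u = lpos ps @ [Idem v] @ lneg qs"
    and s: "set ps \<subseteq> arcs G" "set qs \<subseteq> arcs G" "v \<in> verts G"
    and p: "dyck_run G (map Pos ps) (ps, v0) = Some ([], v)"
    and q: "dyck_run G (map Neg qs) ([], v) = Some (rev qs, v1)"
    using assms(1) unfolding normal_form_def by blast
  have gu: "set u \<subseteq> gis_generators G" using u s by auto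
  \<comment> \<open>\<open>v1\<close> is where the run of \<open>qs\<close> ends, and
    \<open>u\<close> absorbs the idempotent there. Comparing \<open>v1\<close> with the source
    vertex of the letter settles all mismatches of vertices.\<close>
  have v1: "v1 \<in> verts G \<and> gis_cong G u (u @ [Idem v1])"
  proof (cases qs rule: rev_cases)
    case Nil
    then have "v1 = v" using q by simp
    moreover have "gis_cong G (u @ [Idem v]) u"
      using s u Nil
      by (intro gis_cong_mid[OF gis_relation.idem[of v], where a = "lpos ps" and b = "[]"]) auto
    then have "gis_cong G u (u @ [Idem v])" by (rule gis_cong.sym)
    ultimately show ?thesis using s by simp
  next
    case (snoc qs' f)
    then have "v1 = head G f"
      using q by (auto simp: dyck_run_append bind_eq_Some_conv split: if_splits)
    moreover have "gis_cong G (u @ [Idem (head G f)]) u"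
      using s u snoc
      by (intro gis_cong_mid[OF gis_relation.neg_target[of f],
              where a = "lpos ps @ [Idem v] @ lneg qs'" and b = "[]"]) auto
    then have "gis_cong G u (u @ [Idem (head G f)])" by (rule gis_cong.sym)
    ultimately show ?thesis using s snoc by simp
  qed
  show ?thesis
  proof (cases a)
    case (Neg e)
    then have e: "e \<in> arcs G" using assms(2) by (auto simp: dyck_alphabet_def)
    show ?thesis
    proof (cases "v1 = tail G e")
      case True
      have "normal_form (u @ [Letter a])"
        unfolding normal_form_def
        using u s p q True e Neg
        by (intro exI[of _ ps] exI[of _ v] exI[of _ "qs @ [e]"] exI[of _ v0] exI[of _ "head G e"])
          (auto simp: dyck_run_append)
      moreover have "gis_cong G (u @ [Letter a]) (u @ [Letter a])"
        using gu e Neg by (intro gis_cong.refl) auto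
      ultimately show ?thesis by blast
    next
      case False
      have "gis_cong G (u @ [Letter (Neg e)]) [Zero]"
        using False v1 e gu
        by (intro incompatible_letters[of v1 "tail G e"])
          (auto intro!: gis_cong.base gis_relation.source_neg)
      then show ?thesis using Neg by simp
    qed
  next
    case (Pos e)
    then have e: "e \<in> arcs G" using assms(2) by (auto simp: dyck_alphabet_def)
    show ?thesis
    proof (cases "v1 = head G e")
      case False
      have "gis_cong G (u @ [Letter (Pos e)]) [Zero]"
        using False v1 e gu
        by (intro incompatible_letters[of v1 "head G e"])
          (auto intro!: gis_cong.base gis_relation.target_pos)
      then show ?thesis using Pos by simp
    next
      case True
      show ?thesis
      proof (cases qs rule: rev_cases)
        case Nil
        then have v: "v = head G e" using True q by simp
        have nf: "normal_form (lpos (ps @ [e]) @ [Idem (tail G e)] @ lneg [])"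
        proof -
          \<comment> \<open>The pops of \<open>ps\<close> do not touch a further entry at the bottom
            of the stack; the new letter pops it.\<close>
          have "dyck_run G (map Pos ps) (ps @ [e], v0) = Some ([e], v)"
          proof -
            have "\<lbrakk>dyck_run G (map Pos ps) (s, v0) = Some (t, v)\<rbrakk> \<Longrightarrow>
              dyck_run G (map Pos ps) (s @ [e], v0) = Some (t @ [e], v)" for s t v0 ps
            proof (induction ps arbitrary: s v0)
              case (Cons x ps)
              then show ?case by (cases s) (auto split: if_splits)
            qed simp
            from this[OF p] show ?thesis by simp
          qed
          then show ?thesis
            unfolding normal_form_def using s e v
            by (intro exI[of _ "ps @ [e]"] exI[of _ "tail G e"] exI[of _ "[]"] exI[of _ v0] exI[of _ "tail G e"])
              (auto simp: dyck_run_append)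
        qed
        have c1: "gis_cong G (u @ [Letter a]) (lpos ps @ [Letter (Pos e)])"
          using u s e Nil Pos v
          by (intro gis_cong_mid[OF gis_relation.target_pos[of e], where a = "lpos ps" and b = "[]"]) auto
        have c2: "gis_cong G (lpos ps @ [Letter (Pos e), Idem (tail G e)]) (lpos ps @ [Letter (Pos e)])"
          using s e
          by (intro gis_cong_mid[OF gis_relation.pos_source[of e], where a = "lpos ps" and b = "[]"]) auto
        have "gis_cong G (u @ [Letter a]) (lpos (ps @ [e]) @ [Idem (tail G e)] @ lneg [])"
          using gis_cong.trans[OF c1 gis_cong.sym[OF c2]] by simp
        then show ?thesis using nf by blast
      next
        case (snoc qs' f)
        let ?u' = "lpos ps @ [Idem v] @ lneg qs'"
        show ?thesis
        proof (cases "f = e")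
          case False
          have "gis_cong G (?u' @ [Letter (Neg f), Letter (Pos e)] @ []) [Zero]"
            using s e False snoc
            by (intro zero_factor gis_cong.base gis_relation.neg_pos_orth) auto
          then show ?thesis using u snoc Pos by simp
        next
          case True
          have q': "dyck_run G (map Neg qs') ([], v) = Some (rev qs', tail G e)"
            using q snoc True by (auto simp: dyck_run_append bind_eq_Some_conv split: if_splits)
          have "normal_form ?u'"
            unfolding normal_form_def using s p q' snoc by auto
          moreover have "gis_cong G (u @ [Letter a]) (?u' @ [Idem (tail G e)])"
            using u s e snoc Pos True
            by (intro gis_cong_mid[OF gis_relation.neg_pos[of e], where a = ?u' and b = "[]"]) auto
          moreover have "gis_cong G (?u' @ [Idem (tail G e)]) ?u'"
          proof (cases qs' rule: rev_cases)
            case Nil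
            then have "v = tail G e" using q' by simp
            then show ?thesis using s e Nil
              by (intro gis_cong_mid[OF gis_relation.idem[of v], where a = "lpos ps" and b = "[]"]) auto
          next
            case (snoc qs2 g)
            then have "tail G e = head G g"
              using q' by (auto simp: dyck_run_append bind_eq_Some_conv split: if_splits)
            then show ?thesis using s \<open>qs = qs' @ [f]\<close> snoc
              by (intro gis_cong_mid[OF gis_relation.neg_target[of g],
                    where a = "lpos ps @ [Idem v] @ lneg qs2" and b = "[]"]) auto
          qed
          ultimately show ?thesis by (blast intro: gis_cong.trans)
        qed
      qed
    qed
  qed
qed

lemma normal_form_exists:
  assumes "w \<noteq> []" "set w \<subseteq> dyck_alphabet G"
  shows "gis_cong G (map Letter w) [Zero] \<or> (\<exists>u. normal_form u \<and> gis_cong G (map Letter w) u)"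
  using assms
proof (induction w rule: rev_nonempty_induct)
  case (single a)
  \<comment> \<open>The idempotent at the source of the letter is a normal form, so the one-letter
    word reduces to the multiplication step.\<close>
  define v where "v = (case a of Neg e \<Rightarrow> tail G e | Pos e \<Rightarrow> head G e)"
  have v: "v \<in> verts G" using single by (auto simp: v_def dyck_alphabet_def)
  have "normal_form [Idem v]"
    unfolding normal_form_def
    by (rule exI[of _ "[]"], rule exI[of _ v], rule exI[of _ "[]"]) (use v in simp)
  then have "gis_cong G ([Idem v] @ [Letter a]) [Zero] \<or>
      (\<exists>u'. normal_form u' \<and> gis_cong G ([Idem v] @ [Letter a]) u')"
    using single by (intro normal_form_snoc) auto
  moreover have "gis_cong G ([Idem v] @ [Letter a]) [Letter a]"
    using single by (cases a) (auto simp: v_def dyck_alphabet_def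
        intro!: gis_cong.base gis_relation.source_neg gis_relation.target_pos)
  ultimately show ?case by (auto dest: gis_cong.trans[OF gis_cong.sym])
next
  case (snoc a w)
  have a: "[Letter a] \<in> gis_words G" using snoc.prems by (auto simp: dyck_alphabet_def)
  consider "gis_cong G (map Letter w) [Zero]" | u where "normal_form u" "gis_cong G (map Letter w) u"
    using snoc by auto
  then show ?case
  proof cases
    case 1
    from zero_factor[OF 1, of "[]" "[Letter a]"] a show ?thesis by auto
  next
    case 2
    have "gis_cong G (map Letter (w @ [a])) (u @ [Letter a])"
      using gis_cong.mult[OF 2(2) gis_cong.refl[OF a]] by simp
    with normal_form_snoc[OF 2(1), of a] snoc.prems show ?thesis
      by (auto intro: gis_cong.trans)
  qed
qed

text \<open>Lets a run found on the least stack be used on any larger one;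
  \<open>dyck_run_unframe\<close> is the converse for words that stay above the added
  entries.\<close>

lemma dyck_run_frame:
  "dyck_run G w (s, v) = Some (s', v') \<Longrightarrow> dyck_run G w (s @ t, v) = Some (s' @ t, v')"
proof (induction w arbitrary: s v)
  case (Cons a w)
  show ?case
  proof (cases a)
    case (Neg e)
    then show ?thesis using Cons.prems Cons.IH[of "e # s"] by (auto split: if_splits)
  next
    case (Pos e)
    then show ?thesis using Cons.prems Cons.IH by (cases s) (auto split: if_splits)
  qed
qed simp

text \<open>A nonzero word equals a normal form, which acts on the stack \<open>ps\<close>; a zero
  word acts nowhere by soundness. This lets the sequel work with runs alone.\<close>

lemma dyck_admissible_iff_runs:
  assumes "w \<noteq> []" "set w \<subseteq> dyck_alphabet G"
  shows "dyck_admissible G w \<longleftrightarrow> runs G w"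
proof -
  have W: "map Letter w \<in> gis_words G" using assms by (auto simp: dyck_alphabet_def)
  have "dyck_admissible G w \<longleftrightarrow> \<not> gis_cong G (map Letter w) [Zero]"
    unfolding dyck_admissible_def gis_zero_def using gis_class_eq_iff[OF W] by simp
  also have "\<dots> \<longleftrightarrow> runs G w"
  proof
    assume "runs G w"
    then obtain st where "dyck_run G w st \<noteq> None" by (auto simp: runs_def)
    then show "\<not> gis_cong G (map Letter w) [Zero]"
      using gis_cong_run[of G "map Letter w" "[Zero]" st]
      by (auto simp: gis_run_letters)
  next
    assume "\<not> gis_cong G (map Letter w) [Zero]"
    then obtain u where u: "normal_form u" "gis_cong G (map Letter w) u"
      using normal_form_exists[OF assms] by blast
    then obtain ps v qs v0 v1 where nf: "u = lpos ps @ [Idem v] @ lneg qs"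
      "dyck_run G (map Pos ps) (ps, v0) = Some ([], v)"
      "dyck_run G (map Neg qs) ([], v) = Some (rev qs, v1)"
      unfolding normal_form_def by blast
    have "gis_run G (lpos ps) st = dyck_run G (map Pos ps) st"
      "gis_run G (lneg qs) st = dyck_run G (map Neg qs) st" for st
      using gis_run_letters[of G "map Pos ps" st] gis_run_letters[of G "map Neg qs" st]
      by (simp_all add: comp_def)
    then have "gis_run G u (ps, v0) = Some (rev qs, v1)"
      using nf(2,3) unfolding nf(1) by (simp add: gis_run_append)
    then show "runs G w"
      using gis_cong_run[OF u(2), of "(ps, v0)"] by (auto simp: runs_def gis_run_letters)
  qed
  finally show ?thesis .
qed

end

section \<open>Blocks, heights and time reversal\<close>

definition block :: "(int \<Rightarrow> 'a) \<Rightarrow> int \<Rightarrow> nat \<Rightarrow> 'a list" where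
  "block x i n = map (\<lambda>k. x (i + int k)) [0..<n]"

lemma length_block [simp]: "length (block x i n) = n"
  by (simp add: block_def)

lemma block_0 [simp]: "block x i 0 = []"
  by (simp add: block_def)

lemma nth_block [simp]: "k < n \<Longrightarrow> block x i n ! k = x (i + int k)"
  by (simp add: block_def)

lemma block_add: "block x i (m + n) = block x i m @ block x (i + int m) n"
  by (rule nth_equalityI) (auto simp: nth_append)

lemma block_Suc: "block x i (Suc n) = x i # block x (i + 1) n"
  using block_add[of x i 1 n] by (simp add: block_def)

lemma block_Suc_snoc: "block x i (Suc n) = block x i n @ [x (i + int n)]"
  using block_add[of x i n 1] by (simp add: block_def)

lemma set_block: "set (block x i n) \<subseteq> range x"
  by (auto simp: block_def)

lemma block_cong: "(\<And>k. k < n \<Longrightarrow> x (i + int k) = y (j + int k)) \<Longrightarrow> block x i n = block y j n"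
  by (simp add: block_def)

lemma map_upto_block:
  assumes "i \<le> j"
  shows "map x [i..j] = block x i (nat (j - i + 1))"
  using assms by (intro nth_equalityI) (auto simp: nth_upto)

section \<open>Heights and the involution exchanging pushes and pops\<close>

abbreviation flip :: "'e dyck_symbol \<Rightarrow> 'e dyck_symbol" where
  "flip a \<equiv> (case a of Neg e \<Rightarrow> Pos e | Pos e \<Rightarrow> Neg e)"

definition weight :: "'e dyck_symbol \<Rightarrow> int" where
  "weight a = (case a of Neg e \<Rightarrow> 1 | Pos e \<Rightarrow> -1)"

lemma weight_simps [simp]: "weight (Neg e) = 1" "weight (Pos e) = -1"
  by (simp_all add: weight_def)

definition height :: "'e dyck_symbol list \<Rightarrow> int" where
  "height w = sum_list (map weight w)"

lemma height_simps [simp]: "height [] = 0" "height (a # w) = weight a + height w"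
  "height (u @ w) = height u + height w"
  by (simp_all add: height_def)

definition dyck_source :: "('v, 'e) pre_digraph \<Rightarrow> 'e dyck_symbol \<Rightarrow> 'v" where
  "dyck_source G a = (case a of Neg e \<Rightarrow> tail G e | Pos e \<Rightarrow> head G e)"

definition dyck_target :: "('v, 'e) pre_digraph \<Rightarrow> 'e dyck_symbol \<Rightarrow> 'v" where
  "dyck_target G a = (case a of Neg e \<Rightarrow> head G e | Pos e \<Rightarrow> tail G e)"

lemma dyck_source_target_simps [simp]:
  "dyck_source G (Neg e) = tail G e" "dyck_source G (Pos e) = head G e"
  "dyck_target G (Neg e) = head G e" "dyck_target G (Pos e) = tail G e"
  by (simp_all add: dyck_source_def dyck_target_def)

lemma dyck_step_Some:
  "dyck_step G a (s, v) = Some (s', v') \<Longrightarrow>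
     v = dyck_source G a \<and> v' = dyck_target G a \<and> int (length s') = int (length s) + weight a"
  by (cases a; cases s) (auto split: if_splits)

lemma dyck_run_Cons_Some:
  "dyck_run G (a # w) (s, v) = Some st \<longleftrightarrow>
     (\<exists>s' v'. dyck_step G a (s, v) = Some (s', v') \<and> dyck_run G w (s', v') = Some st)"
  by (auto simp: bind_eq_Some_conv)

lemma dyck_run_append_Some:
  "dyck_run G (u @ w) (s, v) = Some st \<longleftrightarrow>
     (\<exists>s' v'. dyck_run G u (s, v) = Some (s', v') \<and> dyck_run G w (s', v') = Some st)"
  by (auto simp: dyck_run_append bind_eq_Some_conv)

lemma dyck_run_Cons_source: "dyck_run G (a # w) (s, v) = Some st \<Longrightarrow> v = dyck_source G a"
  unfolding dyck_run_Cons_Some by (elim exE conjE) (drule dyck_step_Some, simp)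

lemma dyck_run_height:
  "dyck_run G w (s, v) = Some (s', v') \<Longrightarrow> int (length s') = int (length s) + height w"
proof (induction w arbitrary: s v)
  case (Cons a w)
  then obtain s1 v1 where "dyck_step G a (s, v) = Some (s1, v1)" "dyck_run G w (s1, v1) = Some (s', v')"
    by (auto simp: bind_eq_Some_conv)
  then show ?case using Cons.IH dyck_step_Some by fastforce
qed simp

lemma runs_iff: "runs G w \<longleftrightarrow> (\<exists>s v s' v'. dyck_run G w (s, v) = Some (s', v'))"
  by (auto simp: runs_def)

lemma runs_append_left: "runs G (u @ w) \<Longrightarrow> runs G u"
  and runs_append_right: "runs G (u @ w) \<Longrightarrow> runs G w"
  by (auto simp: runs_iff dyck_run_append_Some)

lemma dyck_run_next:
  assumes "dyck_run G (u @ a # w) (s, v) = Some st"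
  shows "\<exists>s'. dyck_run G u (s, v) = Some (s', dyck_source G a)"
  using assms by (auto simp: dyck_run_append_Some dyck_run_Cons_Some simp del: dyck_run.simps dest: dyck_step_Some)

text \<open>The condition on prefixes says that the stack never sinks below \<open>t\<close>, so
  \<open>t\<close> is neither read nor popped.\<close>

lemma dyck_run_unframe:
  assumes "dyck_run G w (s @ t, v) = Some (s', v')"
    and "\<And>k. k \<le> length w \<Longrightarrow> 0 \<le> int (length s) + height (take k w)"
  shows "\<exists>s2. dyck_run G w (s, v) = Some (s2, v') \<and> s' = s2 @ t"
  using assms
proof (induction w arbitrary: s v)
  case (Cons a w)
  have h: "0 \<le> int (length s) + weight a + height (take k w)" if "k \<le> length w" for k
    using Cons.prems(2)[of "Suc k"] that by simp
  show ?case
  proof (cases a)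
    case (Neg e)
    have "0 \<le> 1 + int (length s) + height (take k w)" if "k \<le> length w" for k
      using h[OF that] Neg by simp
    then show ?thesis
      using Neg Cons.prems(1) Cons.IH[of "e # s" "head G e"] by (auto split: if_splits)
  next
    case (Pos e)
    then have "s \<noteq> []" using h[of 0] by auto
    then obtain f s0 where s: "s = f # s0" by (cases s) auto
    then show ?thesis
      using Pos Cons.prems(1) h Cons.IH[of s0 "tail G e"] by (auto split: if_splits)
  qed
qed simp

definition reverse_word :: "'e dyck_symbol list \<Rightarrow> 'e dyck_symbol list" where
  "reverse_word w = rev (map flip w)"

lemma flip_flip [simp]: "flip (flip a) = a"
  by (cases a) auto

lemma reverse_word_simps [simp]:
  "reverse_word [] = []" "reverse_word (a # w) = reverse_word w @ [flip a]"
  "reverse_word (u @ w) = reverse_word w @ reverse_word u"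
  "length (reverse_word w) = length w" "reverse_word (reverse_word w) = w"
  by (simp_all add: reverse_word_def rev_map comp_def)

lemma height_reverse_word [simp]: "height (reverse_word w) = - height w"
proof (induction w)
  case (Cons a w)
  then show ?case by (cases a) auto
qed simp

text \<open>Steps are partial injections and \<open>flip\<close> gives the inverse one; hence
  reversed words run backwards.\<close>

lemma dyck_step_flip: "dyck_step G a (s, v) = Some (s', v') \<Longrightarrow> dyck_step G (flip a) (s', v') = Some (s, v)"
  by (cases a; cases s) (auto split: if_splits)

lemma dyck_run_reverse:
  "dyck_run G w (s, v) = Some (s', v') \<Longrightarrow> dyck_run G (reverse_word w) (s', v') = Some (s, v)"
proof (induction w arbitrary: s v)
  case (Cons a w)
  then obtain s1 v1 where *: "dyck_step G a (s, v) = Some (s1, v1)" "dyck_run G w (s1, v1) = Some (s', v')"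
    by (auto simp: bind_eq_Some_conv)
  show ?case using Cons.IH[OF *(2)] dyck_step_flip[OF *(1)]
    by (simp add: dyck_run_append)
qed simp

lemma runs_reverse [simp]: "runs G (reverse_word w) \<longleftrightarrow> runs G w"
  unfolding runs_iff using dyck_run_reverse[of G] reverse_word_simps(5) by metis

section \<open>Reversal, shifts and periodicity of bi-infinite sequences\<close>

definition reverse_seq :: "(int \<Rightarrow> 'e dyck_symbol) \<Rightarrow> int \<Rightarrow> 'e dyck_symbol" where
  "reverse_seq x = (\<lambda>i. flip (x (- i)))"

lemma reverse_seq_reverse_seq [simp]: "reverse_seq (reverse_seq x) = x"
  by (simp add: reverse_seq_def)

text \<open>Position \<open>j\<close> of the reversed sequence is position \<open>- j\<close>, so
  the block from \<open>i\<close> to \<open>i + n - 1\<close> comes from the one that ends at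
  \<open>- i\<close> and thus starts at \<open>1 - i - n\<close>.\<close>

lemma block_reverse_seq: "block (reverse_seq x) i n = reverse_word (block x (1 - i - int n) n)"
  by (rule nth_equalityI)
    (auto simp: reverse_seq_def reverse_word_def rev_nth intro!: arg_cong[of _ _ x] arg_cong[of _ _ flip])

definition shift_by :: "int \<Rightarrow> (int \<Rightarrow> 'a) \<Rightarrow> int \<Rightarrow> 'a" where
  "shift_by k x = (\<lambda>i. x (i + k))"

lemma block_shift_by [simp]: "block (shift_by k x) i n = block x (i + k) n"
  by (auto simp: block_def shift_by_def algebra_simps)

text \<open>\<open>n\<close> is any period, not necessarily the least one; this is the notion that a
  conjugacy transports by commuting with the shift.\<close>

definition periodic :: "nat \<Rightarrow> (int \<Rightarrow> 'a) \<Rightarrow> bool" where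
  "periodic n x \<longleftrightarrow> (\<forall>i. x (i + int n) = x i)"

lemma periodicD:
  assumes "periodic n x"
  shows "x (i + k * int n) = x i"
proof -
  have *: "x (i + int m * int n) = x i" for m i
  proof (induction m)
    case (Suc m)
    have e: "i + int (Suc m) * int n = (i + int m * int n) + int n" by (simp add: algebra_simps)
    show ?case unfolding e using assms Suc by (simp add: periodic_def)
  qed simp
  show ?thesis
    using *[of i "nat k"] *[of "i + k * int n" "nat (- k)"] by (cases "k \<ge> 0") auto
qed

lemma block_periodic: "periodic n x \<Longrightarrow> block x (i + k * int n) m = block x i m"
  by (rule block_cong) (metis add.assoc add.commute periodicD)

lemma periodic_eq_mod:
  assumes "periodic n x" "n > 0"
  shows "x i = x (i mod int n)"
  using periodicD[OF assms(1), of "i mod int n" "i div int n"] by (simp add: mult.commute)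

text \<open>Moves a position \<open>j\<close> into the window of length \<open>n\<close> that begins
  at \<open>i\<close>, keeping its residue modulo \<open>n\<close>.\<close>

lemma offset_mod:
  fixes i j :: int
  assumes "n > 0"
  shows "nat ((j - i) mod int n) < n" "i + int (nat ((j - i) mod int n)) = j - (j - i) div int n * int n"
  using assms minus_div_mult_eq_mod[of "j - i" "int n"] by (simp_all add: nat_less_iff)

lemma periodic_eqI:
  assumes "periodic n x" "periodic n y" "n > 0" "block x i n = block y i n"
  shows "x = y"
proof
  fix j
  define k where "k = nat ((j - i) mod int n)"
  have k: "k < n" "i + int k = j - (j - i) div int n * int n"
    unfolding k_def using offset_mod[OF assms(3)] by blast+
  have "x (i + int k) = y (i + int k)"
    using arg_cong[OF assms(4), of "\<lambda>w. w ! k"] k by simp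
  then show "x j = y j"
    using periodicD[OF assms(1), of j "- ((j - i) div int n)"]
      periodicD[OF assms(2), of j "- ((j - i) div int n)"] k by simp
qed

definition word_seq :: "'a list \<Rightarrow> int \<Rightarrow> 'a" where
  "word_seq w = (\<lambda>i. w ! nat (i mod int (length w)))"

lemma periodic_word_seq: "periodic (length w) (word_seq w)"
  by (simp add: periodic_def word_seq_def)

lemma block_word_seq: "block (word_seq w) 0 (length w) = w"
  by (rule nth_equalityI) (auto simp: word_seq_def mod_pos_pos_trivial)

lemma word_seq_block:
  assumes "periodic n x" "n > 0"
  shows "word_seq (block x 0 n) = x"
proof
  fix i
  have "nat (i mod int n) < n" using assms(2) by (simp add: nat_less_iff)
  then show "word_seq (block x 0 n) i = x i"
    using assms(2) by (simp add: word_seq_def periodic_eq_mod[OF assms, of i])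
qed

lemma block_mult_periodic:
  assumes "periodic n x"
  shows "block x i (n * m) = concat (replicate m (block x i n))"
proof (induction m)
  case (Suc m)
  then show ?case using block_periodic[OF assms, of i 1] by (simp add: block_add)
qed simp

text \<open>Moving the window by one drops a letter and appends an equal one, so the height over a
  period is an invariant of the orbit.\<close>

lemma height_block_periodic:
  assumes "periodic n x"
  shows "height (block x i n) = height (block x 0 n)"
proof -
  have *: "height (block x (j + 1) n) = height (block x j n)" for j
    using block_Suc[of x j n] block_Suc_snoc[of x j n] assms by (auto simp: periodic_def dest: arg_cong[of _ _ height])
  have 1: "height (block x (int k) n) = height (block x 0 n)" for k
    by (induction k) (use *[of "int _"] in \<open>auto simp: add.commute\<close>)
  have 2: "height (block x (- int k) n) = height (block x 0 n)" for k
  proof (induction k)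
    case (Suc k)
    have "- int k = (- int (Suc k)) + 1" by simp
    then show ?case using *[of "- int (Suc k)"] Suc by metis
  qed simp
  show ?thesis by (cases i rule: int_cases2) (auto simp: 1 2)
qed

section \<open>Points of the shift as sequences all of whose blocks run\<close>

context wf_digraph
begin

lemma dyck_alphabet_iff [simp]:
  "Neg e \<in> dyck_alphabet G \<longleftrightarrow> e \<in> arcs G" "Pos e \<in> dyck_alphabet G \<longleftrightarrow> e \<in> arcs G"
  by (auto simp: dyck_alphabet_def)

lemma flip_alphabet [simp]: "flip a \<in> dyck_alphabet G \<longleftrightarrow> a \<in> dyck_alphabet G"
  by (cases a) auto

lemma markov_dyck_iff:
  "x \<in> markov_dyck G \<longleftrightarrow> range x \<subseteq> dyck_alphabet G \<and> (\<forall>i n. runs G (block x i n))"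
proof (cases "range x \<subseteq> dyck_alphabet G")
  case True
  have adm: "dyck_admissible G (block x i (Suc n)) \<longleftrightarrow> runs G (block x i (Suc n))" for i n
    using set_block[of x i "Suc n"] True by (intro dyck_admissible_iff_runs) (auto simp: block_Suc)
  have "(\<forall>i j. i \<le> j \<longrightarrow> dyck_admissible G (map x [i..j])) \<longleftrightarrow> (\<forall>i n. runs G (block x i (Suc n)))"
  proof (safe)
    fix i n assume "\<forall>i j. i \<le> j \<longrightarrow> dyck_admissible G (map x [i..j])"
    then have "dyck_admissible G (map x [i..i + int n])" by simp
    then show "runs G (block x i (Suc n))"
      by (simp add: map_upto_block nat_add_distrib adm)
  next
    fix i j :: int assume *: "\<forall>i n. runs G (block x i (Suc n))" "i \<le> j"
    then have "nat (j - i + 1) = Suc (nat (j - i))" by simp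
    then show "dyck_admissible G (map x [i..j])"
      using * by (simp add: map_upto_block adm del: nat_add_distrib)
  qed
  also have "\<dots> \<longleftrightarrow> (\<forall>i n. runs G (block x i n))"
    using runs_append_left by (metis block_Suc_snoc)
  finally show ?thesis using True by (simp add: markov_dyck_def)
qed (simp add: markov_dyck_def)

text \<open>Factors of a word that runs also run, so arbitrarily wide windows around one position
  \<open>a\<close> suffice. The windows need not be symmetric, which lets them consist of whole
  periods.\<close>

lemma markov_dyckI:
  assumes "range x \<subseteq> dyck_alphabet G"
    and "\<And>M. \<exists>A B. M \<le> A \<and> M \<le> B \<and> runs G (block x (a - int A) (A + B))"
  shows "x \<in> markov_dyck G"
  unfolding markov_dyck_iff
proof (intro conjI allI)
  fix i n
  define M where "M = nat \<bar>i - a\<bar> + n"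
  obtain A B where AB: "M \<le> A" "M \<le> B" "runs G (block x (a - int A) (A + B))" using assms(2) by blast
  define p where "p = nat (i - a + int A)"
  define q where "q = A + B - p - n"
  have "A + B = p + n + q" "i = a - int A + int p"
    using AB(1,2) by (auto simp: M_def p_def q_def)
  then show "runs G (block x i n)"
    using AB(3) by (simp add: block_add) (metis runs_append_left runs_append_right)
qed (fact assms(1))

lemma markov_dyckD: "x \<in> markov_dyck G \<Longrightarrow> runs G (block x i n)"
  and markov_dyck_alphabet: "x \<in> markov_dyck G \<Longrightarrow> x i \<in> dyck_alphabet G"
  by (auto simp: markov_dyck_iff)

lemma set_block_alphabet: "x \<in> markov_dyck G \<Longrightarrow> set (block x i n) \<subseteq> dyck_alphabet G"
  using set_block[of x i n] by (auto simp: markov_dyck_iff)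

lemma shift_by_markov_dyck [simp]: "shift_by k x \<in> markov_dyck G \<longleftrightarrow> x \<in> markov_dyck G"
proof -
  have "shift_by k x \<in> markov_dyck G" if "x \<in> markov_dyck G" for x k
  proof -
    have "range (shift_by k x) \<subseteq> range x" by (auto simp: shift_by_def)
    then have "range (shift_by k x) \<subseteq> dyck_alphabet G"
      using that unfolding markov_dyck_iff by (meson order_trans)
    then show ?thesis using that by (simp add: markov_dyck_iff)
  qed
  from this[of x k] this[of "shift_by k x" "- k"] show ?thesis by (auto simp: shift_by_def)
qed

lemma reverse_seq_markov_dyck [simp]: "reverse_seq x \<in> markov_dyck G \<longleftrightarrow> x \<in> markov_dyck G"
proof -
  have "reverse_seq x \<in> markov_dyck G" if "x \<in> markov_dyck G" for x
    using that by (auto simp: markov_dyck_iff block_reverse_seq image_subset_iff)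
      (auto simp: reverse_seq_def)
  from this[of x] this[of "reverse_seq x"] show ?thesis by auto
qed

definition periodic_points :: "nat \<Rightarrow> (int \<Rightarrow> 'b dyck_symbol) set" where
  "periodic_points n = {x \<in> markov_dyck G. periodic n x}"

lemma shift_by_periodic [simp]: "periodic n (shift_by k x) \<longleftrightarrow> periodic n x"
proof -
  have "periodic n (shift_by k x)" if "periodic n x" for k and x :: "int \<Rightarrow> 'z"
    unfolding periodic_def shift_by_def
  proof
    fix i
    have "i + int n + k = i + k + int n" by simp
    then show "x (i + int n + k) = x (i + k)" using that unfolding periodic_def by presburger
  qed
  from this[of x k] this[of "shift_by k x" "- k"] show ?thesis by (auto simp: shift_by_def)
qed

lemma reverse_seq_periodic [simp]: "periodic n (reverse_seq x) \<longleftrightarrow> periodic n x"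
proof -
  have "periodic n (reverse_seq x)" if "periodic n x" for x :: "int \<Rightarrow> 'z dyck_symbol"
    using periodicD[OF that, of _ "-1"] by (auto simp: periodic_def reverse_seq_def)
  from this[of x] this[of "reverse_seq x"] show ?thesis by auto
qed

lemma reverse_seq_periodic_points [simp]: "reverse_seq x \<in> periodic_points n \<longleftrightarrow> x \<in> periodic_points n"
  by (simp add: periodic_points_def)

lemma periodic_pointsI:
  assumes "periodic n x" "n > 0" "set (block x i n) \<subseteq> dyck_alphabet G"
    and "\<And>m. runs G (concat (replicate m (block x i n)))"
  shows "x \<in> periodic_points n"
proof -
  have "x j \<in> set (block x i n)" for j
  proof -
    define k where "k = nat ((j - i) mod int n)"
    have k: "k < n" "i + int k = j - (j - i) div int n * int n"
      unfolding k_def using offset_mod[OF assms(2)] by blast+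
    then have "x j = block x i n ! k" using periodicD[OF assms(1), of j "- ((j - i) div int n)"] by simp
    then show ?thesis using k by (metis length_block nth_mem)
  qed
  then have "range x \<subseteq> dyck_alphabet G" using assms(3) by blast
  moreover have "\<exists>A B. M \<le> A \<and> M \<le> B \<and> runs G (block x (i - int A) (A + B))" for M
  proof (intro exI conjI)
    show "M \<le> n * M" using assms(2) by simp
    then show "M \<le> n * M" .
    have e: "n * M + n * M = n * (2 * M)" by simp
    have "block x (i - int (n * M)) (n * M + n * M) = block x i (n * (2 * M))"
      unfolding e using block_periodic[OF assms(1), of i "- int M"] by (simp add: mult.commute)
    then show "runs G (block x (i - int (n * M)) (n * M + n * M))"
      using assms(4) by (simp add: block_mult_periodic[OF assms(1)])
  qed
  ultimately show ?thesis using assms(1) markov_dyckI unfolding periodic_points_def by blast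
qed

text \<open>Periodic points are counted through finite words. Powers of all orders must run, since a
  word may act somewhere while its square does not.\<close>

definition periodic_words :: "nat \<Rightarrow> 'b dyck_symbol list set" where
  "periodic_words n = {w. length w = n \<and> set w \<subseteq> dyck_alphabet G \<and> (\<forall>m. runs G (concat (replicate m w)))}"

lemma bij_periodic_points_words:
  assumes "n > 0"
  shows "bij_betw (\<lambda>x. block x 0 n) (periodic_points n) (periodic_words n)"
proof (rule bij_betw_byWitness[where f' = word_seq])
  show "\<forall>x\<in>periodic_points n. word_seq (block x 0 n) = x"
    using word_seq_block assms by (auto simp: periodic_points_def)
  show "\<forall>w\<in>periodic_words n. block (word_seq w) 0 n = w"
    using block_word_seq by (auto simp: periodic_words_def)
  show "(\<lambda>x. block x 0 n) ` periodic_points n \<subseteq> periodic_words n"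
    by (auto simp: periodic_points_def periodic_words_def block_mult_periodic[symmetric]
        markov_dyckD dest: set_block_alphabet[THEN subsetD])
  show "word_seq ` periodic_words n \<subseteq> periodic_points n"
  proof clarify
    fix w assume w: "w \<in> periodic_words n"
    have "block (word_seq w) 0 n = w" using w block_word_seq[of w] by (simp add: periodic_words_def)
    then show "word_seq w \<in> periodic_points n"
      using w assms periodic_word_seq[of w]
      by (intro periodic_pointsI[where i = 0]) (auto simp: periodic_words_def)
  qed
qed

end

lemma (in fin_digraph) finite_dyck_alphabet [simp]: "finite (dyck_alphabet G)"
  by (simp add: dyck_alphabet_def)

section \<open>Graphs of depth two\<close>

text \<open>What the counting needs of the tree: levels grow by one modulo three along arcs, and the
  root is the only vertex with several incoming arcs. Strong connectivity survives as
  \<open>out_ne\<close>, and \<open>two_in\<close> provides a second loop.\<close>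

locale depth_two = fin_digraph G for G :: "('a, 'b) pre_digraph" +
  fixes r :: 'a and lv :: "'a \<Rightarrow> nat"
  assumes root_in: "r \<in> verts G"
    and lv_zero: "v \<in> verts G \<Longrightarrow> lv v = 0 \<longleftrightarrow> v = r"
    and lv_head: "e \<in> arcs G \<Longrightarrow> lv (head G e) = (lv (tail G e) + 1) mod 3"
    and unique_in: "\<lbrakk>e \<in> arcs G; f \<in> arcs G; head G e = head G f; head G e \<noteq> r\<rbrakk> \<Longrightarrow> e = f"
    and in_ex: "\<lbrakk>v \<in> verts G; v \<noteq> r\<rbrakk> \<Longrightarrow> \<exists>e\<in>arcs G. head G e = v"
    and out_ne: "v \<in> verts G \<Longrightarrow> out_arcs G v \<noteq> {}"
    and two_in: "2 \<le> card (in_arcs G r)"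
begin

abbreviation od :: "'a \<Rightarrow> nat" where "od v \<equiv> card (out_arcs G v)"

definition parc :: "'a \<Rightarrow> 'b" where
  "parc v = (THE e. e \<in> arcs G \<and> head G e = v)"

lemma lv_le: "v \<in> verts G \<Longrightarrow> lv v \<le> 2"
proof (cases "v = r")
  case False
  assume "v \<in> verts G"
  then obtain e where "e \<in> arcs G" "head G e = v" using in_ex False by blast
  then show ?thesis using lv_head[of e] by auto
qed (use lv_zero[of r] root_in in auto)

lemma lv_root [simp]: "lv r = 0"
  using lv_zero root_in by blast

lemma parc:
  assumes "v \<in> verts G" "v \<noteq> r"
  shows "parc v \<in> arcs G" "head G (parc v) = v"
proof -
  obtain e where e: "e \<in> arcs G" "head G e = v" using in_ex[OF assms] by blast
  have "f = e" if "f \<in> arcs G" "head G f = v" for f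
    using unique_in[OF that(1) e(1)] that(2) e(2) assms(2) by simp
  then have "\<exists>!e. e \<in> arcs G \<and> head G e = v" using e by blast
  from theI'[OF this] show "parc v \<in> arcs G" "head G (parc v) = v"
    unfolding parc_def by blast+
qed

lemma parc_eq: "e \<in> arcs G \<Longrightarrow> head G e = v \<Longrightarrow> v \<noteq> r \<Longrightarrow> parc v = e"
  using parc[of v] unique_in[of "parc v" e] head_in_verts[of e] by auto

definition back_arcs :: "'b set" where "back_arcs = in_arcs G r"

text \<open>A loop from the root through levels one and two is determined by its last arc, since
  each of the two earlier arcs is the only one into its target; loops are therefore indexed by
  \<open>back_arcs\<close>.\<close>

definition arc2 :: "'b \<Rightarrow> 'b" where "arc2 b = parc (tail G b)"
definition arc1 :: "'b \<Rightarrow> 'b" where "arc1 b = parc (tail G (arc2 b))"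

lemma back_arc:
  assumes "b \<in> back_arcs"
  shows "b \<in> arcs G" "head G b = r" "arc2 b \<in> arcs G" "head G (arc2 b) = tail G b"
    "arc1 b \<in> arcs G" "head G (arc1 b) = tail G (arc2 b)" "tail G (arc1 b) = r"
    "lv (tail G b) = 2" "lv (tail G (arc2 b)) = 1"
proof -
  show b: "b \<in> arcs G" "head G b = r" using assms by (auto simp: back_arcs_def)
  have "(lv (tail G b) + 1) mod 3 = 0" using lv_head[OF b(1)] b(2) by simp
  then show l2: "lv (tail G b) = 2" using lv_le[OF tail_in_verts[OF b(1)]] by presburger
  then have "tail G b \<noteq> r" using lv_root by (metis zero_neq_numeral)
  then show a2: "arc2 b \<in> arcs G" "head G (arc2 b) = tail G b"
    using parc[of "tail G b"] b by (simp_all add: arc2_def)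
  have "(lv (tail G (arc2 b)) + 1) mod 3 = 2" using lv_head[OF a2(1)] a2(2) l2 by simp
  then show l1: "lv (tail G (arc2 b)) = 1" using lv_le[OF tail_in_verts[OF a2(1)]] by presburger
  then have "tail G (arc2 b) \<noteq> r" using lv_root by (metis zero_neq_one)
  then show a1: "arc1 b \<in> arcs G" "head G (arc1 b) = tail G (arc2 b)"
    using parc[of "tail G (arc2 b)"] a2 by (simp_all add: arc1_def)
  have "(lv (tail G (arc1 b)) + 1) mod 3 = 1" using lv_head[OF a1(1)] a1(2) l1 by metis
  then have "lv (tail G (arc1 b)) = 0" using lv_le[OF tail_in_verts[OF a1(1)]] by presburger
  then show "tail G (arc1 b) = r" using lv_zero tail_in_verts[OF a1(1)] by blast
qed

lemma loop_eq:
  assumes "b \<in> back_arcs" "e \<in> arcs G" "f \<in> arcs G" "head G e = tail G b" "head G f = tail G e"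
  shows "e = arc2 b" "f = arc1 b"
proof -
  have "tail G b \<noteq> r" "tail G (arc2 b) \<noteq> r"
    using back_arc(8,9)[OF assms(1)] lv_root by (metis zero_neq_numeral, metis zero_neq_one)
  then show "e = arc2 b" using parc_eq[of e] assms by (simp add: arc2_def)
  then show "f = arc1 b" using parc_eq[of f] assms \<open>tail G (arc2 b) \<noteq> r\<close> by (simp add: arc1_def)
qed

lemma finite_back_arcs [simp]: "finite back_arcs" unfolding back_arcs_def
  by (rule finite_subset[OF _ finite_arcs]) auto

lemma finite_out [simp]: "finite (out_arcs G v)"
  by (rule finite_subset[OF _ finite_arcs]) auto

subsection \<open>Counting runs\<close>

text \<open>Starting on the empty stack forces a word to stay above its starting height, so these
  are the words that push the path \<open>st\<close> with neutral words inserted.\<close>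

definition run_words :: "'a \<Rightarrow> nat \<Rightarrow> 'b list \<Rightarrow> 'a \<Rightarrow> 'b dyck_symbol list set" where
  "run_words u l st v = {w. length w = l \<and> set w \<subseteq> dyck_alphabet G \<and> dyck_run G w ([], u) = Some (st, v)}"

lemma finite_run_words [simp]: "finite (run_words u l st v)"
  using finite_lists_length_eq[OF finite_dyck_alphabet, of l]
  by (rule finite_subset[rotated]) (auto simp: run_words_def)

lemma run_words_0: "run_words u 0 st v = (if st = [] \<and> v = u then {[]} else {})"
  by (auto simp: run_words_def)

lemma height_le: "height w \<le> int (length w)"
proof (induction w)
  case (Cons a w)
  then show ?case by (cases a) auto
qed simp

lemma run_words_short:
  assumes "l < length st"
  shows "run_words u l st v = {}"
proof -
  have "int (length st) \<le> int (length w)" if "dyck_run G w ([], u) = Some (st, v)" for w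
    using dyck_run_height[OF that] height_le[of w] by simp
  then show ?thesis using assms by (fastforce simp: run_words_def)
qed

lemma dyck_run_snoc_Some:
  "dyck_run G (w @ [a]) st0 = Some (st, v) \<longleftrightarrow>
    (case a of Neg e \<Rightarrow> \<exists>s. st = e # s \<and> v = head G e \<and> dyck_run G w st0 = Some (s, tail G e)
      | Pos f \<Rightarrow> v = tail G f \<and> dyck_run G w st0 = Some (f # st, head G f))"
proof -
  have "dyck_step G a (s, x) = Some (st, v) \<longleftrightarrow>
      (case a of Neg e \<Rightarrow> st = e # s \<and> x = tail G e \<and> v = head G e
        | Pos f \<Rightarrow> s = f # st \<and> x = head G f \<and> v = tail G f)" for s x
    by (cases a; cases s) auto
  then show ?thesis
    by (auto simp: dyck_run_append bind_eq_Some_conv split: dyck_symbol.splits)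
qed

text \<open>Split off the last letter: either it pushes the top of \<open>st\<close>, or it pops
  some \<open>f\<close> that leaves \<open>v\<close>. The recursion may lengthen the stack while it
  shortens the word, so it stops at stacks too long for the word.\<close>

lemma run_words_Suc:
  "run_words u (Suc l) st v =
    (case st of [] \<Rightarrow> {} | e # st' \<Rightarrow>
       if e \<in> arcs G \<and> v = head G e then (\<lambda>w. w @ [Neg e]) ` run_words u l st' (tail G e) else {}) \<union>
    (\<Union>f\<in>out_arcs G v. (\<lambda>w. w @ [Pos f]) ` run_words u l (f # st) (head G f))"
  (is "?L = ?R")
proof (rule set_eqI)
  fix w
  show "w \<in> ?L \<longleftrightarrow> w \<in> ?R"
  proof (cases w rule: rev_cases)
    case Nil
    then show ?thesis by (auto simp: run_words_def split: list.splits)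
  next
    case (snoc w' a)
    show ?thesis unfolding snoc
      by (cases a; cases st) (auto simp: run_words_def dyck_run_snoc_Some image_iff)
  qed
qed

lemma card_run_words_pos:
  "card (\<Union>f\<in>out_arcs G v. (\<lambda>w. w @ [Pos f]) ` run_words u l (f # st) (head G f)) =
    (\<Sum>f\<in>out_arcs G v. card (run_words u l (f # st) (head G f)))"
  by (subst card_UN_disjoint) (auto simp: card_image inj_on_def)

lemma card_run_words_Nil:
  "card (run_words u (Suc l) [] v) = (\<Sum>f\<in>out_arcs G v. card (run_words u l [f] (head G f)))"
  by (simp add: run_words_Suc card_run_words_pos)

lemma card_run_words_Cons:
  assumes "e \<in> arcs G"
  shows "card (run_words u (Suc l) (e # st) (head G e)) =
    card (run_words u l st (tail G e)) +
    (\<Sum>f\<in>out_arcs G (head G e). card (run_words u l (f # e # st) (head G f)))"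
  unfolding run_words_Suc using assms
  by (subst card_Un_disjoint) (auto simp: card_run_words_pos card_image inj_on_def)

text \<open>The stack lists the latest edge first, so the path from \<open>u\<close> to
  \<open>v\<close> is read from the end of the list.\<close>

fun chain :: "'a \<Rightarrow> 'b list \<Rightarrow> 'a \<Rightarrow> bool" where
  "chain u [] v \<longleftrightarrow> v = u"
| "chain u (e # st) v \<longleftrightarrow> e \<in> arcs G \<and> v = head G e \<and> chain u st (tail G e)"

text \<open>Each vertex of the path, \<open>u\<close> included, is a place where one neutral pair
  \<open>Neg f\<close>, \<open>Pos f\<close> can be inserted.\<close>

fun outsum :: "'a \<Rightarrow> 'b list \<Rightarrow> nat" where
  "outsum u [] = od u"
| "outsum u (e # st) = outsum u st + od (head G e)"

text \<open>For two neutral pairs, the new summand belongs to the words whose last letter pops an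
  \<open>f\<close> leaving the end of the path; the other pair is then inserted along the path
  prolonged by \<open>f\<close>.\<close>

fun outsum2 :: "'a \<Rightarrow> 'b list \<Rightarrow> nat" where
  "outsum2 u [] = (\<Sum>f\<in>out_arcs G u. outsum u [f])"
| "outsum2 u (e # st) = outsum2 u st + (\<Sum>f\<in>out_arcs G (head G e). outsum u (f # e # st))"

lemma card_run_words_0: "chain u st v \<Longrightarrow> card (run_words u (length st) st v) = 1"
  by (induction st arbitrary: v) (auto simp: run_words_0 card_run_words_Cons run_words_short)

lemma card_run_words_2: "chain u st v \<Longrightarrow> card (run_words u (length st + 2) st v) = outsum u st"
proof (induction st arbitrary: v)
  case Nil
  have "card (run_words u 1 [f] (head G f)) = 1" if "f \<in> out_arcs G u" for f
    using card_run_words_0[of u "[f]" "head G f"] that by simp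
  then show ?case using Nil by (simp add: card_run_words_Nil numeral_2_eq_2)
next
  case (Cons e st)
  have "card (run_words u (Suc (Suc (length st))) (f # e # st) (head G f)) = 1"
    if "f \<in> out_arcs G (head G e)" for f
    using card_run_words_0[of u "f # e # st" "head G f"] that Cons.prems by simp
  then show ?case using Cons by (simp add: card_run_words_Cons)
qed

lemma card_run_words_4: "chain u st v \<Longrightarrow> card (run_words u (length st + 4) st v) = outsum2 u st"
proof (induction st arbitrary: v)
  case Nil
  have "card (run_words u 3 [f] (head G f)) = outsum u [f]" if "f \<in> out_arcs G u" for f
    using card_run_words_2[of u "[f]" "head G f"] that by (simp add: numeral_3_eq_3)
  then show ?case using Nil card_run_words_Nil[of u 3] by simp
next
  case (Cons e st)
  have "card (run_words u (length st + 4) (f # e # st) (head G f)) = outsum u (f # e # st)"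
    if "f \<in> out_arcs G (head G e)" for f
    using card_run_words_2[of u "f # e # st" "head G f"] that Cons.prems by (simp add: eval_nat_numeral)
  then show ?case using Cons card_run_words_Cons[of e u "length st + 4" st] by simp
qed

text \<open>A period is begun at the root by a push of \<open>arc1 b\<close> that is not popped
  within the period. Counted here are the remaining \<open>n - 1\<close> letters, with
  \<open>arc1 b\<close> left out of the stack, so that insertions happen at the level-one vertex, at
  the level-two vertex and finally at the root.\<close>

definition loop_count :: "nat \<Rightarrow> 'b \<Rightarrow> nat" where
  "loop_count n b = card (run_words (head G (arc1 b)) (n - 1) [b, arc2 b] r)"

lemma loop_chain:
  assumes "b \<in> back_arcs"
  shows "chain (head G (arc1 b)) [b, arc2 b] r"
  using back_arc[OF assms] by simp

lemma loop_count_3: "b \<in> back_arcs \<Longrightarrow> loop_count 3 b = 1"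
  using card_run_words_0[OF loop_chain, of b] by (simp add: loop_count_def numeral_2_eq_2)

lemma loop_count_5:
  assumes "b \<in> back_arcs"
  shows "loop_count 5 b = od r + od (tail G (arc2 b)) + od (tail G b)"
  using card_run_words_2[OF loop_chain[OF assms]] back_arc[OF assms]
  by (simp add: loop_count_def eval_nat_numeral)

text \<open>The quadratic terms count two pairs inserted one after the other, the three sums count
  one pair nested in another.\<close>

lemma loop_count_7:
  assumes "b \<in> back_arcs"
  defines "k \<equiv> od (tail G (arc2 b))" and "l \<equiv> od (tail G b)" and "m \<equiv> od r"
  shows "loop_count 7 b = k * k + l * l + m * m + k * l + k * m + l * m +
    (\<Sum>f\<in>out_arcs G (tail G (arc2 b)). od (head G f)) + (\<Sum>f\<in>out_arcs G (tail G b). od (head G f))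
    + (\<Sum>f\<in>out_arcs G r. od (head G f))"
  using card_run_words_4[OF loop_chain[OF assms(1)]] back_arc[OF assms(1)]
  by (simp add: loop_count_def sum.distrib k_def l_def m_def distrib_left algebra_simps)

subsection \<open>Points of odd period\<close>

text \<open>Each push raises the level by one modulo three and each pop lowers it. In particular a
  run that returns to its vertex has a height divisible by three.\<close>

lemma run_level:
  assumes "dyck_run G w (s, v) = Some (s', v')" "set w \<subseteq> dyck_alphabet G"
  shows "int (lv v') mod 3 = (int (lv v) + height w) mod 3"
  using assms
proof (induction w arbitrary: s v)
  case (Cons a w)
  then obtain s1 v1 where *: "dyck_step G a (s, v) = Some (s1, v1)" "dyck_run G w (s1, v1) = Some (s', v')"
    by (auto simp: bind_eq_Some_conv)
  have "int (lv v1) mod 3 = (int (lv v) + weight a) mod 3"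
    using * Cons.prems(2) lv_head by (cases a; cases s) (auto split: if_splits simp: zmod_int mod_simps add.commute)
  then have "(int (lv v1) + height w) mod 3 = (int (lv v) + weight a + height w) mod 3"
    by (metis mod_add_left_eq)
  then show ?case using Cons.IH[OF *(2)] Cons.prems(2) by (simp add: add.assoc)
qed simp

lemma source_in_verts: "a \<in> dyck_alphabet G \<Longrightarrow> dyck_source G a \<in> verts G"
  by (cases a) auto

lemma block_run:
  assumes "x \<in> markov_dyck G"
  shows "\<exists>s s'. dyck_run G (block x i k) (s, dyck_source G (x i)) = Some (s', dyck_source G (x (i + int k)))"
proof -
  obtain s v st where st: "dyck_run G (block x i (Suc k)) (s, v) = Some st"
    using markov_dyckD[OF assms, of i "Suc k"] by (auto simp: runs_iff)
  obtain s1 v1 where "dyck_step G (x i) (s, v) = Some (s1, v1)"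
    using st unfolding block_Suc dyck_run_Cons_Some by blast
  then have "v = dyck_source G (x i)" by (rule dyck_step_Some[THEN conjunct1])
  then show ?thesis
    using dyck_run_next[of G "block x i k" "x (i + int k)" "[]" s v st] st
    unfolding block_Suc_snoc by auto
qed

lemma source_level:
  assumes "x \<in> markov_dyck G"
  shows "int (lv (dyck_source G (x (i + int k)))) mod 3 = (int (lv (dyck_source G (x i))) + height (block x i k)) mod 3"
  using block_run[OF assms, of i k] run_level set_block_alphabet[OF assms] by blast

lemma source_root_iff:
  assumes "x \<in> markov_dyck G"
  shows "dyck_source G (x i) = r \<longleftrightarrow> int (lv (dyck_source G (x i))) mod 3 = 0"
  using lv_zero[OF source_in_verts[OF markov_dyck_alphabet[OF assms]]]
    lv_le[OF source_in_verts[OF markov_dyck_alphabet[OF assms]], of i] by auto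

section \<open>Points that wind around one loop\<close>

definition loop_words :: "nat \<Rightarrow> 'b \<Rightarrow> 'b dyck_symbol list set" where
  "loop_words n b = (\<lambda>w. Neg (arc1 b) # w) ` run_words (head G (arc1 b)) (n - 1) [b, arc2 b] r"

lemma card_loop_words: "card (loop_words n b) = loop_count n b"
  by (simp add: loop_words_def loop_count_def card_image)

lemma finite_loop_words [simp]: "finite (loop_words n b)"
  by (simp add: loop_words_def)

lemma loop_words_prefix:
  assumes "w \<in> loop_words n b" "0 < k" "k \<le> n"
  shows "0 < height (take k w)"
proof -
  obtain w' where w: "w = Neg (arc1 b) # w'" "w' \<in> run_words (head G (arc1 b)) (n - 1) [b, arc2 b] r"
    using assms(1) by (auto simp: loop_words_def)
  have "dyck_run G (take (k - 1) w' @ drop (k - 1) w') ([], head G (arc1 b)) = Some ([b, arc2 b], r)"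
    using w(2) by (simp add: run_words_def)
  then obtain s' v' where "dyck_run G (take (k - 1) w') ([], head G (arc1 b)) = Some (s', v')"
    unfolding dyck_run_append_Some by blast
  from dyck_run_height[OF this] have "0 \<le> height (take (k - 1) w')" by simp
  then show ?thesis using assms(2) by (cases k) (auto simp: w(1))
qed

lemma loop_words:
  assumes "b \<in> back_arcs" "w \<in> loop_words n b" "0 < n"
  shows "length w = n" "set w \<subseteq> dyck_alphabet G" "dyck_run G w ([], r) = Some ([b, arc2 b, arc1 b], r)"
    "height w = 3"
proof -
  show "length w = n" "set w \<subseteq> dyck_alphabet G"
    using assms(2,3) back_arc[OF assms(1)] by (auto simp: loop_words_def run_words_def)
  obtain w' where w: "w = Neg (arc1 b) # w'" "w' \<in> run_words (head G (arc1 b)) (n - 1) [b, arc2 b] r"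
    using assms(2) by (auto simp: loop_words_def)
  have "dyck_run G w' ([], head G (arc1 b)) = Some ([b, arc2 b], r)" using w(2) by (simp add: run_words_def)
  from dyck_run_frame[OF this, of "[arc1 b]"]
  show *: "dyck_run G w ([], r) = Some ([b, arc2 b, arc1 b], r)"
    using back_arc[OF assms(1)] by (simp add: w(1))
  show "height w = 3" using dyck_run_height[OF *] by simp
qed

text \<open>A normalised place to begin a period: the vertex is the root and the stack stays above
  its present height ever after. \<open>loop_start_unique\<close> shows that there is at most one
  such place modulo the period.\<close>

definition loop_start :: "nat \<Rightarrow> 'b \<Rightarrow> (int \<Rightarrow> 'b dyck_symbol) \<Rightarrow> int \<Rightarrow> bool" where
  "loop_start n b x i \<longleftrightarrow> b \<in> back_arcs \<and> 0 < n \<and> periodic n x \<and> block x i n \<in> loop_words n b"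

lemma loop_start_run:
  assumes "loop_start n b x i"
  shows "dyck_run G (block x i (n * m)) ([], r) = Some (concat (replicate m [b, arc2 b, arc1 b]), r)"
proof (induction m)
  case (Suc m)
  have per: "periodic n x" using assms by (simp add: loop_start_def)
  have "dyck_run G (block x i n) ([], r) = Some ([b, arc2 b, arc1 b], r)"
    using assms loop_words by (auto simp: loop_start_def)
  from dyck_run_frame[OF this, of "concat (replicate m [b, arc2 b, arc1 b])"]
  have "dyck_run G (block x i (n * m) @ block x i n) ([], r) =
      Some ([b, arc2 b, arc1 b] @ concat (replicate m [b, arc2 b, arc1 b]), r)"
    using Suc by (simp add: dyck_run_append)
  moreover have "block x i (n * Suc m) = block x i (n * m) @ block x i n"
    using block_add[of x i "n * m" n] block_periodic[OF per, of i "int m" n] by (simp add: mult.commute add.commute)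
  ultimately show ?case by simp
qed simp

text \<open>From a loop start the future of \<open>x\<close> needs nothing on the stack below it;
  this later allows any past that ends at the root.\<close>

lemma loop_start_free:
  assumes "loop_start n b x i"
  shows "\<exists>s v. dyck_run G (block x i m) ([], r) = Some (s, v)"
proof -
  have "n * m = m + (n * m - m)" using assms by (cases n) (auto simp: loop_start_def)
  then have "dyck_run G (block x i m @ block x (i + int m) (n * m - m)) ([], r) =
      Some (concat (replicate m [b, arc2 b, arc1 b]), r)"
    using loop_start_run[OF assms, of m] by (metis block_add)
  then show ?thesis unfolding dyck_run_append_Some by blast
qed

lemma loop_start_periodic_points:
  assumes "loop_start n b x i"
  shows "x \<in> periodic_points n"
proof (rule periodic_pointsI)
  show per: "periodic n x" and "0 < n" using assms by (simp_all add: loop_start_def)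
  show "set (block x i n) \<subseteq> dyck_alphabet G"
    using assms loop_words(2) unfolding loop_start_def by blast
  show "runs G (concat (replicate m (block x i n)))" for m
    using loop_start_run[OF assms, of m] unfolding block_mult_periodic[OF per] runs_iff by blast
qed

lemma loop_start_height:
  assumes "loop_start n b x i" "0 < k"
  shows "0 < height (block x i k)"
proof -
  have *: "height (block x i (n * m)) = 3 * int m" for m
    using dyck_run_height[OF loop_start_run[OF assms(1), of m]] by (simp add: length_concat sum_list_replicate)
  have "block x i k = block x i (n * (k div n)) @ block x (i + int (k div n) * int n) (k mod n)"
    using block_add[of x i "n * (k div n)" "k mod n"] by (simp add: mult.commute)
  also have "block x (i + int (k div n) * int n) (k mod n) = take (k mod n) (block x i n)"
    using assms(1) by (subst block_periodic) (auto simp: loop_start_def block_def take_map)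
  finally have e: "height (block x i k) = 3 * int (k div n) + height (take (k mod n) (block x i n))"
    by (simp add: *)
  show ?thesis
  proof (cases "k mod n = 0")
    case True
    then have "0 < k div n" using assms by (auto simp: loop_start_def div_greater_zero_iff mod_eq_0_iff_dvd intro: dvd_imp_le)
    then show ?thesis using e True by simp
  next
    case False
    moreover have "k mod n \<le> n" using assms(1) by (simp add: loop_start_def less_imp_le)
    ultimately have "0 < height (take (k mod n) (block x i n))"
      using assms(1) loop_words_prefix unfolding loop_start_def by blast
    then show ?thesis using e by simp
  qed
qed

lemma loop_start_source:
  assumes "loop_start n b x i"
  shows "dyck_source G (x i) = r"
proof -
  have "x i = hd (block x i n)" using assms by (cases n) (auto simp: loop_start_def block_Suc)
  also have "\<dots> = Neg (arc1 b)" using assms by (auto simp: loop_start_def loop_words_def)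
  finally show ?thesis using assms back_arc by (simp add: loop_start_def)
qed

text \<open>Between two different starts in one period the height rises by 1 or 2, since it rises by
  3 over the period and stays positive from either start. But both starts are at the root, so the
  rise is a multiple of three.\<close>

lemma loop_start_unique:
  assumes "loop_start n b x i" "loop_start n b' x i'"
  shows "\<exists>k. i' = i + k * int n"
proof -
  have n: "0 < n" and per: "periodic n x" using assms(1) by (auto simp: loop_start_def)
  define t where "t = nat ((i' - i) mod int n)"
  have t: "t < n" "i + int t = i' + (- ((i' - i) div int n)) * int n"
    unfolding t_def using offset_mod[OF n, where i = i and j = i'] by simp_all
  have start: "loop_start n b' x (i + int t)"
    using assms(2) block_periodic[OF per, of i' "- ((i' - i) div int n)"] unfolding t(2) loop_start_def by simp
  have x: "x \<in> markov_dyck G" using loop_start_periodic_points[OF assms(1)] by (simp add: periodic_points_def)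
  have "t = 0"
  proof (rule ccontr)
    assume "t \<noteq> 0"
    then have 1: "0 < height (block x i t)" using loop_start_height[OF assms(1)] by simp
    have 2: "0 < height (block x (i + int t) (n - t))" using loop_start_height[OF start] t by simp
    have 3: "height (block x i t) + height (block x (i + int t) (n - t)) = 3"
      using block_add[of x i t "n - t"] t assms(1) loop_words[of b "block x i n" n]
      by (auto simp: loop_start_def simp flip: height_simps(3))
    have "height (block x i t) mod 3 = 0"
      using source_level[OF x, of i t] loop_start_source[OF assms(1)] loop_start_source[OF start] by simp
    moreover have "height (block x i t) = 1 \<or> height (block x i t) = 2" using 1 2 3 by linarith
    ultimately show False by auto
  qed
  then have "i' = i + ((i' - i) div int n) * int n" using t(2) by simp
  then show ?thesis by blast
qed

definition neg_points :: "nat \<Rightarrow> 'b \<Rightarrow> (int \<Rightarrow> 'b dyck_symbol) set" where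
  "neg_points n b = {x. \<exists>i. loop_start n b x i}"

lemma neg_points_disjoint:
  assumes "x \<in> neg_points n b" "x \<in> neg_points n b'"
  shows "b = b'"
proof -
  obtain i i' where i: "loop_start n b x i" "loop_start n b' x i'"
    using assms by (auto simp: neg_points_def)
  obtain k where "i' = i + k * int n" using loop_start_unique[OF i] by blast
  then have "block x i' n = block x i n" using block_periodic i by (auto simp: loop_start_def)
  then have "Some ([b, arc2 b, arc1 b], r) = Some ([b', arc2 b', arc1 b'], r)"
    using loop_words(3)[of b "block x i n" n] loop_words(3)[of b' "block x i n" n] i
    by (auto simp: loop_start_def)
  then show ?thesis by simp
qed

text \<open>By uniqueness of the start, the \<open>n\<close> shifts of a loop word are distinct
  points, and different loop words give different orbits.\<close>

lemma card_neg_points: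
  assumes "b \<in> back_arcs" "0 < n"
  shows "card (neg_points n b) = n * loop_count n b" "finite (neg_points n b)"
proof -
  define F where "F = (\<lambda>(k, w). shift_by (int k) (word_seq w) :: int \<Rightarrow> 'b dyck_symbol)"
  have start: "loop_start n b (F (k, w)) (- int k)" "block (F (k, w)) (- int k) n = w" if "w \<in> loop_words n b" for k w
    using that assms loop_words(1)[OF assms(1) that assms(2)] block_word_seq[of w] periodic_word_seq[of w]
    by (auto simp: loop_start_def F_def)
  have "bij_betw F ({..<n} \<times> loop_words n b) (neg_points n b)"
    unfolding bij_betw_def
  proof (intro conjI subset_antisym subsetI)
    show "inj_on F ({..<n} \<times> loop_words n b)"
    proof (rule inj_onI, clarify)
      fix k w k' w' assume k: "k < n" "k' < n" and w: "w \<in> loop_words n b" "w' \<in> loop_words n b"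
        and e: "F (k, w) = F (k', w')"
      obtain j where j: "- int k' = - int k + j * int n"
        using loop_start_unique start w e by metis
      have "int k - int k' = j * int n" using j by simp
      moreover have "\<bar>int k - int k'\<bar> < int n" using k by auto
      ultimately have "j = 0" using k
        by (metis abs_mult abs_of_nat mult_less_cancel_right2 not_less_iff_gr_or_eq of_nat_less_0_iff zero_less_abs_iff abs_ge_zero zless_imp_add1_zle add_0 mult.commute linorder_not_less)
      then have "k = k'" using j by simp
      then show "k = k' \<and> w = w'" using start(2) w e by metis
    qed
    show "x \<in> neg_points n b" if "x \<in> F ` ({..<n} \<times> loop_words n b)" for x
      using that start by (auto simp: neg_points_def)
    show "x \<in> F ` ({..<n} \<times> loop_words n b)" if x: "x \<in> neg_points n b" for x
    proof -
      obtain i where i: "loop_start n b x i" using x by (auto simp: neg_points_def)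
      then have per: "periodic n x" and w: "block x i n \<in> loop_words n b" by (auto simp: loop_start_def)
      define k where "k = nat ((0 - i) mod int n)"
      have k: "k < n" "- int k = i + ((0 - i) div int n) * int n"
        unfolding k_def using offset_mod[OF assms(2), where i = i and j = 0] by auto
      have "F (k, block x i n) = x"
      proof (rule periodic_eqI[OF _ per assms(2)])
        show "periodic n (F (k, block x i n))" using start(1)[OF w, of k] by (simp add: loop_start_def)
        show "block (F (k, block x i n)) (- int k) n = block x (- int k) n"
          using start(2)[OF w, of k] block_periodic[OF per, of i "(0 - i) div int n" n] unfolding k(2) by simp
      qed
      then show ?thesis using k w by (intro image_eqI[of _ _ "(k, block x i n)"]) auto
    qed
  qed
  from bij_betw_same_card[OF this] bij_betw_finite[OF this]
  show "card (neg_points n b) = n * loop_count n b" "finite (neg_points n b)"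
    by (auto simp: card_loop_words)
qed

text \<open>Heights tend to infinity, so there is a last position at which a given height is
  attained. The height is chosen so that the vertex there is the root.\<close>

lemma exists_loop_start:
  assumes x: "x \<in> periodic_points n" and n: "0 < n" and h: "height (block x 0 n) = 3"
  shows "\<exists>i. (\<forall>k>0. 0 < height (block x i k)) \<and> dyck_source G (x i) = r"
proof -
  have md: "x \<in> markov_dyck G" and per: "periodic n x" using x by (auto simp: periodic_points_def)
  define S where "S j = height (block x 0 j)" for j
  have S_add: "S (j + k) = S j + height (block x (int j) k)" for j k
    by (simp add: S_def block_add)
  have S_n: "S (n + j) = 3 + S j" for j
    using block_periodic[OF per, of 0 1 j] h S_add[of n j] by (simp add: S_def)
  have S_mult: "S (n * q + j) = 3 * int q + S j" for q j
    by (induction q) (use S_n in \<open>auto simp: add.assoc\<close>)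
  have S_ge: "- int j \<le> S j" for j
  proof (induction j)
    case (Suc j)
    then show ?case using block_Suc_snoc[of x 0 j] by (cases "x (int j)") (auto simp: S_def)
  qed (simp add: S_def)
  have S_lower: "3 * int (j div n) - int n \<le> S j" for j
  proof -
    have "int (j mod n) < int n" using n by simp
    then show ?thesis using S_mult[of "j div n" "j mod n"] S_ge[of "j mod n"]
      by (simp del: of_nat_mod)
  qed
  have S_Suc: "S (Suc j) = S j + 1 \<or> S (Suc j) = S j - 1" for j
    by (cases "x (int j)") (auto simp: S_def block_Suc_snoc)
  \<comment> \<open>The least nonnegative height at which the level is zero modulo three; position 0
    has height 0 and hence lies in \<open>A\<close>.\<close>
  define c where "c = (- int (lv (dyck_source G (x 0)))) mod 3"
  define A where "A = {j. S j \<le> c}"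
  have c: "0 \<le> c" "c < 3" by (auto simp: c_def)
  \<comment> \<open>Each period adds 3, while within a period the height falls by at most
    \<open>n\<close>; this bounds the positions in \<open>A\<close>.\<close>
  have "A \<subseteq> {..< n * (n + 4)}"
  proof
    fix j assume "j \<in> A"
    then have "3 * int (j div n) - int n < 3" using S_lower[of j] c by (simp add: A_def)
    then have "j div n < n + 4" by linarith
    then show "j \<in> {..< n * (n + 4)}" using n by (simp add: div_less_iff_less_mult mult.commute)
  qed
  then have fin: "finite A" by (rule finite_subset) simp
  have "0 \<in> A" using c by (simp add: A_def S_def)
  define j where "j = Max A"
  have j: "j \<in> A" "\<And>k. k \<in> A \<Longrightarrow> k \<le> j"
    using Max_in[OF fin] Max_ge[OF fin] \<open>0 \<in> A\<close> by (auto simp: j_def)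
  have after: "c < S (j + k)" if "0 < k" for k
    using j(2)[of "j + k"] that by (force simp: A_def)
  have Sj: "S j = c" using j(1) after[of 1] S_Suc[of j] by (auto simp: A_def)
  have "0 < height (block x (int j) k)" if "0 < k" for k
    using after[OF that] S_add[of j k] Sj by simp
  moreover have "dyck_source G (x (int j)) = r"
    unfolding source_root_iff[OF md] using source_level[OF md, of 0 j] Sj
    by (simp add: S_def c_def mod_simps)
  ultimately show ?thesis by blast
qed

text \<open>Pushes and pops keep the stack a path that ends at the current vertex; this turns a
  final stack into a path of the graph.\<close>

lemma run_chain:
  assumes "dyck_run G w (s, v) = Some (s', v')" "set w \<subseteq> dyck_alphabet G" "chain u s v"
  shows "chain u s' v'"
  using assms
proof (induction w arbitrary: s v)
  case (Cons a w)
  then obtain s1 v1 where *: "dyck_step G a (s, v) = Some (s1, v1)" "dyck_run G w (s1, v1) = Some (s', v')"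
    by (auto simp: bind_eq_Some_conv)
  have "chain u s1 v1" using * Cons.prems by (cases a; cases s) (auto split: if_splits)
  then show ?case using Cons.IH[OF *(2)] Cons.prems(2) by simp
qed simp

text \<open>From a loop start the first letter pushes an arc \<open>a\<close> that stays, and at the
  end of the period two further entries lie above it. The three form a path from the root to the
  root, and \<open>loop_eq\<close> identifies it.\<close>

lemma neg_points_complete:
  assumes x: "x \<in> periodic_points n" and n: "0 < n" and h: "height (block x 0 n) = 3"
  shows "\<exists>b\<in>back_arcs. x \<in> neg_points n b"
proof -
  have md: "x \<in> markov_dyck G" and per: "periodic n x" using x by (auto simp: periodic_points_def)
  obtain i where i: "\<And>k. 0 < k \<Longrightarrow> 0 < height (block x i k)" "dyck_source G (x i) = r"
    using exists_loop_start[OF assms] by blast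
  obtain s s' where run: "dyck_run G (block x i n) (s, r) = Some (s', r)"
    using block_run[OF md, of i n] i(2) per by (auto simp: periodic_def)
  obtain n' where n': "n = Suc n'" using n by (cases n) auto
  have "0 < weight (x i)" using i(1)[of 1] by (simp add: block_Suc)
  then obtain a where a: "x i = Neg a" by (cases "x i") auto
  have aG: "a \<in> arcs G" using markov_dyck_alphabet[OF md, of i] a by simp
  have ta: "tail G a = r" using i(2) a by simp
  let ?w = "block x (i + 1) n'"
  have bl: "block x i n = Neg a # ?w" by (simp add: n' block_Suc a)
  have "dyck_run G ?w ([] @ (a # s), head G a) = Some (s', r)"
    using run unfolding bl by (simp split: if_splits)
  \<comment> \<open>All heights from \<open>i\<close> are positive and the first push accounts for
    one, so the remaining letters never go below their own start.\<close>
  moreover have "0 \<le> height (take k ?w)" if "k \<le> length ?w" for k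
  proof -
    have "take k ?w = block x (i + 1) k" using that by (auto simp: block_def take_map)
    then show ?thesis using i(1)[of "Suc k"] a by (simp add: block_Suc)
  qed
  ultimately obtain st where st: "dyck_run G ?w ([], head G a) = Some (st, r)"
    using dyck_run_unframe[of G ?w "[]" "a # s" "head G a" s' r] by auto
  have "int (length st) = 2"
    using dyck_run_height[OF st] h height_block_periodic[OF per, of i] bl by simp
  then have "length st = Suc (Suc 0)" by linarith
  then obtain b e where st2: "st = [b, e]" by (auto simp: length_Suc_conv)
  have "chain (head G a) st r"
    using run_chain[OF st set_block_alphabet[OF md]] by simp
  then have ch: "b \<in> arcs G" "head G b = r" "e \<in> arcs G" "head G e = tail G b" "head G a = tail G e"
    unfolding st2 by simp_all
  then have b: "b \<in> back_arcs" by (simp add: back_arcs_def)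
  have "e = arc2 b" "a = arc1 b" using loop_eq[OF b ch(3) aG ch(4) ch(5)] by auto
  then have "block x i n \<in> loop_words n b"
    using st set_block_alphabet[OF md] unfolding bl loop_words_def run_words_def st2 by (auto simp: n')
  then show ?thesis using b n per by (auto simp: neg_points_def loop_start_def)
qed

section \<open>Positive points, and all points of small odd period\<close>

definition pos_points :: "nat \<Rightarrow> 'b \<Rightarrow> (int \<Rightarrow> 'b dyck_symbol) set" where
  "pos_points n b = {x. reverse_seq x \<in> neg_points n b}"

lemma pos_points_eq: "pos_points n b = reverse_seq ` neg_points n b"
  unfolding pos_points_def by (auto intro: image_eqI[of _ _ "reverse_seq _"])

lemma card_pos_points:
  assumes "b \<in> back_arcs" "0 < n"
  shows "card (pos_points n b) = n * loop_count n b" "finite (pos_points n b)"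
proof -
  have "inj_on reverse_seq A" for A :: "(int \<Rightarrow> 'b dyck_symbol) set"
    by (metis inj_on_inverseI reverse_seq_reverse_seq)
  then show "card (pos_points n b) = n * loop_count n b" "finite (pos_points n b)"
    using card_neg_points[OF assms] by (simp_all add: pos_points_eq card_image)
qed

lemma neg_points_height:
  assumes "x \<in> neg_points n b"
  shows "height (block x 0 n) = 3"
proof -
  obtain i where "loop_start n b x i" using assms by (auto simp: neg_points_def)
  then show ?thesis
    using height_block_periodic[of n x i] loop_words(4)[of b "block x i n" n] by (simp add: loop_start_def)
qed

lemma height_reverse_seq:
  assumes "periodic n x"
  shows "height (block (reverse_seq x) 0 n) = - height (block x 0 n)"
  using height_block_periodic[OF assms] by (simp add: block_reverse_seq)

lemma neg_pos_disjoint: "x \<in> neg_points n b \<Longrightarrow> x \<notin> pos_points n b'"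
proof
  assume *: "x \<in> neg_points n b" "x \<in> pos_points n b'"
  then have "periodic n x" by (auto simp: neg_points_def loop_start_def)
  from height_reverse_seq[OF this] * neg_points_height[of x n b] neg_points_height[of "reverse_seq x" n b']
  show False by (simp add: pos_points_def)
qed

lemma neg_points_periodic_points: "neg_points n b \<subseteq> periodic_points n"
  using loop_start_periodic_points by (auto simp: neg_points_def)

lemma pos_points_periodic_points: "pos_points n b \<subseteq> periodic_points n"
  using neg_points_periodic_points[of n b] by (auto simp: pos_points_def)

lemma height_parity: "height w mod 2 = int (length w) mod 2" "\<bar>height w\<bar> \<le> int (length w)"
proof -
  have "height w mod 2 = int (length w) mod 2 \<and> \<bar>height w\<bar> \<le> int (length w)"
  proof (induction w)
    case (Cons a w)
    then show ?case by (cases a) (auto, presburger+)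
  qed simp
  then show "height w mod 2 = int (length w) mod 2" "\<bar>height w\<bar> \<le> int (length w)" by auto
qed

lemma odd_multiple_of_three: "(h::int) mod 3 = 0 \<Longrightarrow> h mod 2 = 1 \<Longrightarrow> \<bar>h\<bar> < 9 \<Longrightarrow> h = 3 \<or> h = - 3"
  by presburger

text \<open>Levels make the height over a period a multiple of three and parity makes it odd; below
  nine this leaves 3 and -3, which reversal exchanges.\<close>

lemma periodic_points_decomp:
  assumes "odd n" "n < 9"
  shows "periodic_points n = (\<Union>b\<in>back_arcs. neg_points n b) \<union> (\<Union>b\<in>back_arcs. pos_points n b)"
proof (intro subset_antisym subsetI)
  fix x assume x: "x \<in> periodic_points n"
  then have md: "x \<in> markov_dyck G" and per: "periodic n x" by (auto simp: periodic_points_def)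
  have n: "0 < n" using assms(1) by (cases n) auto
  let ?h = "height (block x 0 n)"
  have "x (int n) = x 0" using per[unfolded periodic_def, rule_format, of 0] by simp
  then have "3 dvd (int (lv (dyck_source G (x 0))) + ?h) - int (lv (dyck_source G (x 0)))"
    using source_level[OF md, of 0 n] by (intro mod_eq_dvd_iff[THEN iffD1]) simp
  then have "?h mod 3 = 0" by simp
  moreover have "?h mod 2 = 1" "\<bar>?h\<bar> \<le> int n"
    using height_parity[of "block x 0 n"] assms(1) by simp_all presburger
  ultimately have "?h = 3 \<or> ?h = - 3" using assms(2) by (intro odd_multiple_of_three) simp_all
  then show "x \<in> (\<Union>b\<in>back_arcs. neg_points n b) \<union> (\<Union>b\<in>back_arcs. pos_points n b)"
  proof
    assume "?h = - 3"
    then have "height (block (reverse_seq x) 0 n) = 3" using height_reverse_seq[OF per] by simp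
    then show ?thesis using neg_points_complete[of "reverse_seq x" n] x n by (auto simp: pos_points_def)
  qed (use neg_points_complete[OF x n] in auto)
next
  fix x assume "x \<in> (\<Union>b\<in>back_arcs. neg_points n b) \<union> (\<Union>b\<in>back_arcs. pos_points n b)"
  then show "x \<in> periodic_points n"
    using neg_points_periodic_points pos_points_periodic_points by blast
qed

lemma card_UN_neg_points:
  assumes "0 < n"
  shows "card (\<Union>b\<in>back_arcs. neg_points n b) = n * (\<Sum>b\<in>back_arcs. loop_count n b)"
    "card (\<Union>b\<in>back_arcs. pos_points n b) = n * (\<Sum>b\<in>back_arcs. loop_count n b)"
proof -
  have "card (\<Union>b\<in>back_arcs. neg_points n b) = (\<Sum>b\<in>back_arcs. card (neg_points n b))"
    using neg_points_disjoint card_neg_points assms by (intro card_UN_disjoint) auto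
  then show "card (\<Union>b\<in>back_arcs. neg_points n b) = n * (\<Sum>b\<in>back_arcs. loop_count n b)"
    using card_neg_points assms by (simp add: sum_distrib_left)
  have "card (\<Union>b\<in>back_arcs. pos_points n b) = (\<Sum>b\<in>back_arcs. card (pos_points n b))"
    using neg_points_disjoint card_pos_points assms
    by (intro card_UN_disjoint) (auto simp: pos_points_def)
  then show "card (\<Union>b\<in>back_arcs. pos_points n b) = n * (\<Sum>b\<in>back_arcs. loop_count n b)"
    using card_pos_points assms by (simp add: sum_distrib_left)
qed

lemma card_periodic_points_odd:
  assumes "odd n" "n < 9"
  shows "card (periodic_points n) = 2 * n * (\<Sum>b\<in>back_arcs. loop_count n b)"
proof -
  have n: "0 < n" using assms(1) by (cases n) auto
  have "card (periodic_points n) =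
      card (\<Union>b\<in>back_arcs. neg_points n b) + card (\<Union>b\<in>back_arcs. pos_points n b)"
    unfolding periodic_points_decomp[OF assms]
    using neg_pos_disjoint card_neg_points card_pos_points n by (intro card_Un_disjoint) auto
  then show ?thesis using card_UN_neg_points[OF n] by simp
qed

end

section \<open>Points of period two and four\<close>

context wf_digraph
begin

lemma periodic_words_rotate1: "w \<in> periodic_words n \<Longrightarrow> rotate1 w \<in> periodic_words n"
proof (cases w)
  case (Cons a u)
  assume w: "w \<in> periodic_words n"
  have "runs G (concat (replicate m (u @ [a])))" for m
  proof -
    have e: "a # concat (replicate m (u @ [a])) = concat (replicate m (a # u)) @ [a]" by (induction m) auto
    have "replicate (Suc m) (a # u) = replicate m (a # u) @ [a # u]"
      by (simp add: replicate_append_same)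
    then have "concat (replicate (Suc m) (a # u)) = ([a] @ concat (replicate m (u @ [a]))) @ u"
      using e by (simp del: replicate_Suc)
    moreover have "runs G (concat (replicate (Suc m) (a # u)))"
      using w Cons unfolding periodic_words_def by blast
    ultimately show ?thesis using runs_append_left runs_append_right by metis
  qed
  then show ?thesis using w Cons by (auto simp: periodic_words_def)
qed simp

lemma periodic_words_runs: "w \<in> periodic_words n \<Longrightarrow> runs G w"
  unfolding periodic_words_def by (auto dest: spec[of _ 1])

lemma neutral_periodic_words:
  assumes "dyck_run G w ([], v) = Some ([], v)" "set w \<subseteq> dyck_alphabet G" "length w = n"
  shows "w \<in> periodic_words n"
proof -
  have "dyck_run G (concat (replicate m w)) ([], v) = Some ([], v)" for m
    by (induction m) (use assms(1) in \<open>auto simp: dyck_run_append\<close>)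
  then show ?thesis using assms by (force simp: periodic_words_def runs_iff)
qed

lemma runs_neg_pos: "runs G [Neg e, Pos f] \<Longrightarrow> f = e"
  by (auto simp: runs_iff split: if_splits)

lemma runs_nested:
  "runs G [Neg e, Neg f, Pos g, Pos h] \<Longrightarrow> g = f \<and> h = e \<and> tail G f = head G e"
  by (auto simp: runs_iff split: if_splits)

lemma runs_successive:
  "runs G [Neg e, Pos f, Neg g, Pos h] \<Longrightarrow> f = e \<and> h = g \<and> tail G g = tail G e"
  by (auto simp: runs_iff split: if_splits)

end

context depth_two
begin

text \<open>In the square of the word the second copy begins at the source of the first letter, so
  the levels at both ends of the first copy agree.\<close>

lemma periodic_words_height:
  assumes "w \<in> periodic_words n" "0 < n"
  shows "height w mod 3 = 0"
proof -
  obtain a u where w: "w = a # u" using assms by (cases w) (auto simp: periodic_words_def)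
  have "concat (replicate 2 w) = w @ w" by (simp add: numeral_2_eq_2)
  then have "runs G (w @ w)" using assms(1) unfolding periodic_words_def by (metis (mono_tags) mem_Collect_eq)
  then obtain s v st where st: "dyck_run G (w @ a # u) (s, v) = Some st" unfolding runs_iff w by blast
  then obtain s1 where s1: "dyck_run G w (s, v) = Some (s1, dyck_source G a)" using dyck_run_next by metis
  then obtain s2 v2 where "dyck_step G a (s, v) = Some (s2, v2)" unfolding w dyck_run_Cons_Some by blast
  then have v: "v = dyck_source G a" by (rule dyck_step_Some[THEN conjunct1])
  have "int (lv v) mod 3 = (int (lv v) + height w) mod 3"
    using run_level[OF s1] assms(1) v by (simp add: periodic_words_def)
  then have "3 dvd (int (lv v) + height w) - int (lv v)" by (intro mod_eq_dvd_iff[THEN iffD1]) simp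
  then show ?thesis by simp
qed

text \<open>Among -2, 0, 2 only 0 is a multiple of three, so one push and its pop remain.\<close>

lemma periodic_words_2:
  "periodic_words 2 = (\<lambda>e. [Neg e, Pos e]) ` arcs G \<union> (\<lambda>e. [Pos e, Neg e]) ` arcs G"
proof (intro subset_antisym subsetI)
  fix w assume w: "w \<in> periodic_words 2"
  obtain a b where ab: "w = [a, b]"
    using w by (auto simp: periodic_words_def length_Suc_conv numeral_2_eq_2)
  have h: "height w mod 3 = 0" using periodic_words_height[OF w] by simp
  have r1: "runs G [a, b]" "runs G [b, a]"
    using periodic_words_runs[OF w] periodic_words_runs[OF periodic_words_rotate1[OF w]] ab by simp_all
  have al: "a \<in> dyck_alphabet G" "b \<in> dyck_alphabet G" using w ab by (auto simp: periodic_words_def)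
  show "w \<in> (\<lambda>e. [Neg e, Pos e]) ` arcs G \<union> (\<lambda>e. [Pos e, Neg e]) ` arcs G"
    using h r1 al unfolding ab by (cases a; cases b) (auto dest: runs_neg_pos)
next
  fix w assume "w \<in> (\<lambda>e. [Neg e, Pos e]) ` arcs G \<union> (\<lambda>e. [Pos e, Neg e]) ` arcs G"
  then obtain e where e: "e \<in> arcs G" and w: "w = [Neg e, Pos e] \<or> w = [Pos e, Neg e]" by auto
  have "[Neg e, Pos e] \<in> periodic_words 2"
    using e by (intro neutral_periodic_words[where v = "tail G e"]) auto
  from this periodic_words_rotate1[OF this] w show "w \<in> periodic_words 2" by auto
qed

lemma card_periodic_points_2: "card (periodic_points 2) = 2 * card (arcs G)"
proof -
  have "card (periodic_words 2) = card (arcs G) + card (arcs G)"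
    unfolding periodic_words_2
    by (subst card_Un_disjoint) (auto simp: card_image inj_on_def)
  then show ?thesis using bij_betw_same_card[OF bij_periodic_points_words[of 2]] by simp
qed

definition paths2 :: "('b \<times> 'b) set" where
  "paths2 = (SIGMA e:arcs G. out_arcs G (head G e))"

text \<open>Equal arcs are allowed: they account for points of period two, which also have period
  four.\<close>

definition forks :: "('b \<times> 'b) set" where
  "forks = (SIGMA e:arcs G. out_arcs G (tail G e))"

text \<open>The height is zero, so the six arrangements of two pushes and two pops remain. Four are
  the rotations of a nested pair; for successive pairs two rotations suffice, because rotating by
  two letters exchanges \<open>e\<close> and \<open>f\<close>.\<close>

lemma periodic_words_4:
  "periodic_words 4 =
    (\<lambda>(e, f). [Neg e, Neg f, Pos f, Pos e]) ` paths2 \<union> (\<lambda>(e, f). [Neg f, Pos f, Pos e, Neg e]) ` paths2 \<union>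
    (\<lambda>(e, f). [Pos f, Pos e, Neg e, Neg f]) ` paths2 \<union> (\<lambda>(e, f). [Pos e, Neg e, Neg f, Pos f]) ` paths2 \<union>
    (\<lambda>(e, f). [Neg e, Pos e, Neg f, Pos f]) ` forks \<union> (\<lambda>(e, f). [Pos e, Neg f, Pos f, Neg e]) ` forks"
  (is "_ = ?R")
proof (intro subset_antisym subsetI)
  fix w assume w: "w \<in> periodic_words 4"
  then obtain a b c d where abcd: "w = [a, b, c, d]"
    by (auto simp: periodic_words_def length_Suc_conv eval_nat_numeral)
  have w1: "[b, c, d, a] \<in> periodic_words 4" using periodic_words_rotate1[OF w] abcd by simp
  have w2: "[c, d, a, b] \<in> periodic_words 4" using periodic_words_rotate1[OF w1] by simp
  have w3: "[d, a, b, c] \<in> periodic_words 4" using periodic_words_rotate1[OF w2] by simp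
  have h: "height [a, b, c, d] mod 3 = 0" using periodic_words_height[OF w] abcd by simp
  have rn: "runs G [a, b, c, d]" "runs G [b, c, d, a]" "runs G [c, d, a, b]" "runs G [d, a, b, c]"
    using w w1 w2 w3 abcd periodic_words_runs by auto
  have al: "a \<in> dyck_alphabet G" "b \<in> dyck_alphabet G" "c \<in> dyck_alphabet G" "d \<in> dyck_alphabet G"
    using w abcd by (auto simp: periodic_words_def)
  consider e f g h where "a = Neg e" "b = Neg f" "c = Pos g" "d = Pos h"
    | e f g h where "d = Neg e" "a = Neg f" "b = Pos g" "c = Pos h"
    | e f g h where "c = Neg e" "d = Neg f" "a = Pos g" "b = Pos h"
    | e f g h where "b = Neg e" "c = Neg f" "d = Pos g" "a = Pos h"
    | e f g h where "a = Neg e" "b = Pos f" "c = Neg g" "d = Pos h"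
    | e f g h where "d = Neg e" "a = Pos f" "b = Neg g" "c = Pos h"
    using h by (cases a; cases b; cases c; cases d) auto
  then show "w \<in> ?R"
  proof cases
    case 1
    with runs_nested[of e f g h] rn(1) al show ?thesis
      by (intro UnI1 image_eqI[of _ _ "(e, f)"]) (auto simp: abcd paths2_def)
  next
    case 2
    with runs_nested[of e f g h] rn(4) al show ?thesis
      by (intro UnI1[of _ "_ \<union> _"] UnI1 UnI2 image_eqI[of _ _ "(e, f)"]) (auto simp: abcd paths2_def)
  next
    case 3
    with runs_nested[of e f g h] rn(3) al have "w \<in> (\<lambda>(e, f). [Pos f, Pos e, Neg e, Neg f]) ` paths2"
      by (intro image_eqI[of _ _ "(e, f)"]) (auto simp: abcd paths2_def)
    then show ?thesis by blast
  next
    case 4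
    with runs_nested[of e f g h] rn(2) al have "w \<in> (\<lambda>(e, f). [Pos e, Neg e, Neg f, Pos f]) ` paths2"
      by (intro image_eqI[of _ _ "(e, f)"]) (auto simp: abcd paths2_def)
    then show ?thesis by blast
  next
    case 5
    with runs_successive[of e f g h] rn(1) al have "w \<in> (\<lambda>(e, f). [Neg e, Pos e, Neg f, Pos f]) ` forks"
      by (intro image_eqI[of _ _ "(e, g)"]) (auto simp: abcd forks_def)
    then show ?thesis by blast
  next
    case 6
    with runs_successive[of e f g h] rn(4) al have "w \<in> (\<lambda>(e, f). [Pos e, Neg f, Pos f, Neg e]) ` forks"
      by (intro image_eqI[of _ _ "(e, g)"]) (auto simp: abcd forks_def)
    then show ?thesis by blast
  qed
next
  have P: "[Neg e, Neg f, Pos f, Pos e] \<in> periodic_words 4 \<and> [Neg f, Pos f, Pos e, Neg e] \<in> periodic_words 4 \<and>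
      [Pos f, Pos e, Neg e, Neg f] \<in> periodic_words 4 \<and> [Pos e, Neg e, Neg f, Pos f] \<in> periodic_words 4"
    if "(e, f) \<in> paths2" for e f
  proof -
    have 0: "[Neg e, Neg f, Pos f, Pos e] \<in> periodic_words 4"
      using that by (intro neutral_periodic_words[where v = "tail G e"]) (auto simp: paths2_def)
    from periodic_words_rotate1[OF 0] have 1: "[Neg f, Pos f, Pos e, Neg e] \<in> periodic_words 4" by simp
    from periodic_words_rotate1[OF 1] have 2: "[Pos f, Pos e, Neg e, Neg f] \<in> periodic_words 4" by simp
    from periodic_words_rotate1[OF 2] have 3: "[Pos e, Neg e, Neg f, Pos f] \<in> periodic_words 4" by simp
    show ?thesis using 0 1 2 3 by blast
  qed
  have F: "[Neg e, Pos e, Neg f, Pos f] \<in> periodic_words 4 \<and> [Pos e, Neg f, Pos f, Neg e] \<in> periodic_words 4"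
    if "(e, f) \<in> forks" for e f
  proof -
    have 0: "[Neg e, Pos e, Neg f, Pos f] \<in> periodic_words 4"
      using that by (intro neutral_periodic_words[where v = "tail G e"]) (auto simp: forks_def)
    from periodic_words_rotate1[OF 0] have "[Pos e, Neg f, Pos f, Neg e] \<in> periodic_words 4" by simp
    with 0 show ?thesis by blast
  qed
  fix w assume "w \<in> ?R"
  then show "w \<in> periodic_words 4"
    using P F by (elim UnE imageE) auto
qed

lemma card_periodic_points_4:
  "card (periodic_points 4) =
    4 * (\<Sum>e\<in>arcs G. od (head G e)) + 2 * (\<Sum>e\<in>arcs G. od (tail G e))"
proof -
  have fin: "finite paths2" "finite forks" by (auto simp: paths2_def forks_def)
  have c: "card paths2 = (\<Sum>e\<in>arcs G. od (head G e))" "card forks = (\<Sum>e\<in>arcs G. od (tail G e))"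
    by (simp_all add: paths2_def forks_def card_SigmaI)
  have im: "card ((\<lambda>(e, f). [Neg e, Neg f, Pos f, Pos e]) ` paths2) = card paths2"
    "card ((\<lambda>(e, f). [Neg f, Pos f, Pos e, Neg e]) ` paths2) = card paths2"
    "card ((\<lambda>(e, f). [Pos f, Pos e, Neg e, Neg f]) ` paths2) = card paths2"
    "card ((\<lambda>(e, f). [Pos e, Neg e, Neg f, Pos f]) ` paths2) = card paths2"
    "card ((\<lambda>(e, f). [Neg e, Pos e, Neg f, Pos f]) ` forks) = card forks"
    "card ((\<lambda>(e, f). [Pos e, Neg f, Pos f, Neg e]) ` forks) = card forks"
    by (auto intro!: card_image simp: inj_on_def)
  have "card (periodic_words 4) = card paths2 + card paths2 + card paths2 + card paths2 + card forks + card forks"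
    unfolding periodic_words_4
    by (subst card_Un_disjoint, use fin in simp, use fin in simp, fastforce)+ (simp only: im)
  then show ?thesis using bij_betw_same_card[OF bij_periodic_points_words[of 4]] c by simp
qed

end

section \<open>Asymptotic connections\<close>

text \<open>Basic open sets restrict only finitely many coordinates, so convergence is eventual
  agreement at each position.\<close>

lemma limitin_discrete_product:
  assumes "\<And>k. f k \<in> UNIV \<rightarrow> A" "l \<in> UNIV \<rightarrow> A"
  shows "limitin (product_topology (\<lambda>i. discrete_topology A) UNIV) f l F \<longleftrightarrow>
    (\<forall>i. \<forall>\<^sub>F k in F. f k i = l i)"
proof (intro iffI allI)
  fix i assume "limitin (product_topology (\<lambda>i. discrete_topology A) UNIV) f l F"
  then have "limitin (discrete_topology A) ((\<lambda>x. x i) \<circ> f) (l i) F"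
    using continuous_map_product_projection[of i UNIV "\<lambda>i. discrete_topology A"]
    by (intro continuous_map_limit[where X = "product_topology (\<lambda>i. discrete_topology A) UNIV"]) simp_all
  then show "\<forall>\<^sub>F k in F. f k i = l i"
    using assms(2) unfolding limitin_def by (auto dest: spec[of _ "{l i}"])
next
  assume *: "\<forall>i. \<forall>\<^sub>F k in F. f k i = l i"
  show "limitin (product_topology (\<lambda>i. discrete_topology A) UNIV) f l F"
    unfolding limitin_def
  proof (intro conjI allI impI)
    show "l \<in> topspace (product_topology (\<lambda>i. discrete_topology A) UNIV)"
      using assms(2) by auto
    fix U assume U: "openin (product_topology (\<lambda>i. discrete_topology A) UNIV) U \<and> l \<in> U"
    then obtain V where V: "finite {i. V i \<noteq> A}" "l \<in> Pi\<^sub>E UNIV V" "Pi\<^sub>E UNIV V \<subseteq> U"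
      unfolding openin_product_topology_alt by auto
    have "\<forall>\<^sub>F k in F. \<forall>i\<in>{i. V i \<noteq> A}. f k i = l i"
      using V(1) * by (intro eventually_ball_finite) auto
    then show "\<forall>\<^sub>F k in F. f k \<in> U"
    proof eventually_elim
      case (elim k)
      have "f k i \<in> V i" for i
        using elim V(2) assms(1)[of k] by (cases "V i = A") auto
      then show ?case using V(3) by auto
    qed
  qed
qed

text \<open>It is enough to control the \<open>n\<close> positions of one period: shifts by
  multiples of \<open>n\<close> sweep them over a whole left half-line.\<close>

lemma eventually_left_tail:
  fixes x p :: "int \<Rightarrow> 'a"
  assumes "periodic n p" "0 < n"
  shows "(\<forall>i. \<forall>\<^sub>F k in sequentially. x (i - int (k * n)) = p i) \<longleftrightarrow> (\<exists>N. \<forall>i<N. x i = p i)"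
proof (intro iffI)
  assume "\<forall>i. \<forall>\<^sub>F k in sequentially. x (i - int (k * n)) = p i"
  then have "\<forall>\<^sub>F k in sequentially. \<forall>i\<in>{0..<int n}. x (i - int (k * n)) = p i"
    by (intro eventually_ball_finite) auto
  then obtain K where K: "\<And>k i. K \<le> k \<Longrightarrow> 0 \<le> i \<Longrightarrow> i < int n \<Longrightarrow> x (i - int (k * n)) = p i"
    unfolding eventually_sequentially by (metis atLeastLessThan_iff)
  have "x i = p i" if "i < - int (K * n)" for i
  proof -
    define k where "k = nat (- (i div int n))"
    have "i div int n \<le> - int K"
    proof -
      have "i div int n \<le> (- int K * int n) div int n" using that assms(2) by (intro zdiv_mono1) auto
      also have "(- int K * int n) div int n = - int K"
        using assms(2) by (intro nonzero_mult_div_cancel_right) simp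
      finally show ?thesis .
    qed
    then have k: "K \<le> k" "int k = - (i div int n)" by (auto simp: k_def)
    have i: "i = i mod int n - int (k * n)"
      using k(2) by (simp add: minus_div_mult_eq_mod[symmetric])
    have "x (i mod int n - int (k * n)) = p (i mod int n)" using K[OF k(1)] assms(2) by simp
    then show ?thesis using i periodic_eq_mod[OF assms] by metis
  qed
  then show "\<exists>N. \<forall>i<N. x i = p i" by blast
next
  assume "\<exists>N. \<forall>i<N. x i = p i"
  then obtain N where N: "\<And>i. i < N \<Longrightarrow> x i = p i" by blast
  have "x (i - int (k * n)) = p i" if "nat (i - N) + 1 \<le> k" for i k
  proof -
    have "k \<le> k * n" using assms(2) by simp
    then have "int k \<le> int (k * n)" by (simp only: of_nat_le_iff)
    then have "i - int (k * n) < N" using that by linarith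
    then show ?thesis using N periodicD[OF assms(1), of i "- int k"] by simp
  qed
  then show "\<forall>i. \<forall>\<^sub>F k in sequentially. x (i - int (k * n)) = p i"
    unfolding eventually_sequentially by blast
qed

lemma eventually_right_tail:
  fixes x p :: "int \<Rightarrow> 'a"
  assumes "periodic n p" "0 < n"
  shows "(\<forall>i. \<forall>\<^sub>F k in sequentially. x (i + int (k * n)) = p i) \<longleftrightarrow> (\<exists>N. \<forall>i>N. x i = p i)"
proof -
  have per: "periodic n (\<lambda>i. p (- i))"
    using periodicD[OF assms(1), of _ "-1"] by (auto simp: periodic_def)
  have "(\<forall>i. A i) \<longleftrightarrow> (\<forall>i. A (- i))" for A :: "int \<Rightarrow> bool"
    by (metis minus_minus)
  from this[of "\<lambda>i. \<forall>\<^sub>F k in sequentially. x (i + int (k * n)) = p i"]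
  have "(\<forall>i. \<forall>\<^sub>F k in sequentially. x (i + int (k * n)) = p i) \<longleftrightarrow>
      (\<forall>i. \<forall>\<^sub>F k in sequentially. x (- (i - int (k * n))) = p (- i))" by simp
  also have "\<dots> \<longleftrightarrow> (\<exists>N. \<forall>i<N. x (- i) = p (- i))"
    using eventually_left_tail[OF per assms(2), of "\<lambda>i. x (- i)"] by simp
  also have "\<dots> \<longleftrightarrow> (\<exists>N. \<forall>i>N. x i = p i)"
  proof
    assume "\<exists>N. \<forall>i<N. x (- i) = p (- i)"
    then obtain N where N: "\<And>i. i < N \<Longrightarrow> x (- i) = p (- i)" by blast
    have "x i = p i" if "i > - N" for i using N[of "- i"] that by simp
    then show "\<exists>N. \<forall>i>N. x i = p i" by blast
  next
    assume "\<exists>N. \<forall>i>N. x i = p i"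
    then obtain N where N: "\<And>i. i > N \<Longrightarrow> x i = p i" by blast
    have "x (- i) = p (- i)" if "i < - N" for i using N[of "- i"] that by simp
    then show "\<exists>N. \<forall>i<N. x (- i) = p (- i)" by blast
  qed
  finally show ?thesis .
qed

context wf_digraph
begin

text \<open>Some point is left asymptotic to \<open>p\<close> and right asymptotic to the orbit of \<open>q\<close>. Writing the
  asymptotics along multiples of the periods makes the notion visibly invariant under conjugacy.\<close>

definition connects :: "nat \<Rightarrow> (int \<Rightarrow> 'b dyck_symbol) \<Rightarrow> (int \<Rightarrow> 'b dyck_symbol) \<Rightarrow> bool" where
  "connects n p q \<longleftrightarrow> (\<exists>x\<in>markov_dyck G. \<exists>j.
     limitin (markov_dyck_topology G) (\<lambda>k. shift_by (- int (k * n)) x) p sequentially \<and>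
     limitin (markov_dyck_topology G) (\<lambda>k. shift_by (int (k * 3)) x) (shift_by j q) sequentially)"

lemma limitin_markov_dyck:
  assumes "\<And>k. f k \<in> markov_dyck G" "l \<in> markov_dyck G"
  shows "limitin (markov_dyck_topology G) f l sequentially \<longleftrightarrow> (\<forall>i. \<forall>\<^sub>F k in sequentially. f k i = l i)"
  unfolding markov_dyck_topology_def subshift_topology_def limitin_subtopology
  using assms by (subst limitin_discrete_product) (auto simp: markov_dyck_def image_subset_iff)

lemma connects_iff:
  assumes "p \<in> periodic_points n" "0 < n" "q \<in> periodic_points 3"
  shows "connects n p q \<longleftrightarrow> (\<exists>x\<in>markov_dyck G. \<exists>j. (\<exists>N. \<forall>i<N. x i = p i) \<and> (\<exists>N. \<forall>i>N. x i = q (i + j)))"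
proof -
  have pq: "p \<in> markov_dyck G" "periodic n p" "q \<in> markov_dyck G" "periodic 3 q"
    using assms by (auto simp: periodic_points_def)
  have "limitin (markov_dyck_topology G) (\<lambda>k. shift_by (- int (k * n)) x) p sequentially \<longleftrightarrow> (\<exists>N. \<forall>i<N. x i = p i)"
    if "x \<in> markov_dyck G" for x
  proof -
    have "limitin (markov_dyck_topology G) (\<lambda>k. shift_by (- int (k * n)) x) p sequentially \<longleftrightarrow>
        (\<forall>i. \<forall>\<^sub>F k in sequentially. shift_by (- int (k * n)) x i = p i)"
      using that pq by (intro limitin_markov_dyck) simp_all
    then show ?thesis using eventually_left_tail[OF pq(2) assms(2), of x] by (simp add: shift_by_def)
  qed
  moreover have "limitin (markov_dyck_topology G) (\<lambda>k. shift_by (int (k * 3)) x) (shift_by j q) sequentially \<longleftrightarrow>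
      (\<exists>N. \<forall>i>N. x i = q (i + j))" if "x \<in> markov_dyck G" for x j
  proof -
    have "limitin (markov_dyck_topology G) (\<lambda>k. shift_by (int (k * 3)) x) (shift_by j q) sequentially \<longleftrightarrow>
        (\<forall>i. \<forall>\<^sub>F k in sequentially. shift_by (int (k * 3)) x i = shift_by j q i)"
      using that pq by (intro limitin_markov_dyck) simp_all
    moreover have "periodic 3 (shift_by j q)" using pq by simp
    ultimately show ?thesis using eventually_right_tail[of 3 "shift_by j q" x] by (simp add: shift_by_def)
  qed
  ultimately show ?thesis unfolding connects_def by blast
qed

text \<open>Glue the left half of \<open>p\<close>, ending before \<open>a\<close>, to the right
  half of \<open>q\<close>, starting at \<open>b\<close>; wide windows across the seam are all that
  has to be run.\<close>

lemma connectsI: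
  assumes "p \<in> periodic_points n" "0 < n" "q \<in> periodic_points 3"
    and run: "\<And>M. \<exists>A B. M \<le> A \<and> M \<le> B \<and> runs G (block p (a - int A) A @ block q b B)"
  shows "connects n p q"
proof -
  define x where "x = (\<lambda>i. if i < a then p i else q (i - a + b))"
  have "x \<in> markov_dyck G"
  proof (rule markov_dyckI)
    show "range x \<subseteq> dyck_alphabet G"
      using assms(1,3) markov_dyck_alphabet by (auto simp: x_def periodic_points_def)
    fix M
    obtain A B where AB: "M \<le> A" "M \<le> B" "runs G (block p (a - int A) A @ block q b B)"
      using run by blast
    have "block x (a - int A) A = block p (a - int A) A"
      by (rule block_cong) (simp add: x_def)
    moreover have "block x a B = block q b B"
      by (rule block_cong) (simp add: x_def add.commute)
    ultimately show "\<exists>A B. M \<le> A \<and> M \<le> B \<and> runs G (block x (a - int A) (A + B))"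
      using AB by (intro exI[of _ A] exI[of _ B]) (simp add: block_add)
  qed
  moreover have "\<exists>N. \<forall>i<N. x i = p i" by (rule exI[of _ a]) (simp add: x_def)
  moreover have "\<exists>N. \<forall>i>N. x i = q (i + (b - a))"
    by (rule exI[of _ a]) (auto simp: x_def algebra_simps)
  ultimately show ?thesis using connects_iff[OF assms(1-3)] by blast
qed

end

section \<open>Which transitions between periodic points exist\<close>

context depth_two
begin

lemma loop_words_3:
  assumes "b \<in> back_arcs"
  shows "loop_words 3 b = {[Neg (arc1 b), Neg (arc2 b), Neg b]}"
proof -
  let ?R = "run_words (head G (arc1 b)) 2 [b, arc2 b] r"
  have "card ?R = 1" using loop_count_3[OF assms] by (simp add: loop_count_def)
  then obtain z where z: "?R = {z}" by (rule card_1_singletonE)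
  moreover have "[Neg (arc2 b), Neg b] \<in> ?R"
    using back_arc[OF assms] by (simp add: run_words_def)
  ultimately show ?thesis by (simp add: loop_words_def)
qed

text \<open>Supplies a seam at the root. In a positive point the root is reached by popping
  \<open>arc1 b\<close>, hence one position after that letter.\<close>

lemma neg_points_root:
  assumes "p \<in> neg_points n b \<or> p \<in> pos_points n b"
  shows "\<exists>a. dyck_source G (p a) = r"
proof -
  have 1: "\<exists>i. x i = Neg (arc1 b) \<and> tail G (arc1 b) = r" if x: "x \<in> neg_points n b" for x
  proof -
    obtain i where i: "loop_start n b x i" using x by (auto simp: neg_points_def)
    have "x i = hd (block x i n)" using i by (cases n) (auto simp: loop_start_def block_Suc)
    then have "x i = Neg (arc1 b)" using i by (auto simp: loop_start_def loop_words_def)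
    moreover have "tail G (arc1 b) = r" using i back_arc(7) by (simp add: loop_start_def)
    ultimately show ?thesis by blast
  qed
  show ?thesis
  proof (cases "p \<in> neg_points n b")
    case True
    then show ?thesis using 1[of p] by (metis dyck_source_target_simps(1))
  next
    case False
    then have "reverse_seq p \<in> neg_points n b" using assms by (simp add: pos_points_def)
    then obtain i where i: "flip (p (- i)) = Neg (arc1 b)" "tail G (arc1 b) = r"
      using 1[of "reverse_seq p"] by (auto simp: reverse_seq_def)
    then have "p (- i) = Pos (arc1 b)" by (cases "p (- i)") auto
    moreover have "p \<in> markov_dyck G"
      using assms False pos_points_periodic_points by (auto simp: periodic_points_def)
    then obtain s s' where "dyck_run G (block p (- i) 1) (s, dyck_source G (p (- i))) = Some (s', dyck_source G (p (- i + 1)))"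
      using block_run[of p "- i" 1] by auto
    ultimately have "dyck_source G (p (- i + 1)) = r"
      using i(2) by (cases s) (auto simp: block_Suc split: if_splits)
    then show ?thesis by blast
  qed
qed

lemma block_run_to:
  assumes "x \<in> markov_dyck G" "dyck_source G (x a) = r"
  shows "\<exists>s v s'. dyck_run G (block x (a - int A) A) (s, v) = Some (s', r)"
    "\<exists>s s' v'. dyck_run G (block x a A) (s, r) = Some (s', v')"
  using block_run[OF assms(1), of "a - int A" A] block_run[OF assms(1), of a A] assms(2) by auto

text \<open>From a loop start \<open>q\<close> never reads below its start, so it runs on whatever
  stack \<open>p\<close> leaves behind.\<close>

lemma connects_neg:
  assumes p: "p \<in> periodic_points n" "0 < n" "dyck_source G (p a) = r" and q: "q \<in> neg_points 3 b"
  shows "connects n p q"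
proof -
  obtain i where i: "loop_start 3 b q i" using q by (auto simp: neg_points_def)
  show ?thesis
  proof (rule connectsI[where a = a and b = i])
    show "p \<in> periodic_points n" "0 < n" "q \<in> periodic_points 3"
      using assms neg_points_periodic_points by auto
    have "runs G (block p (a - int M) M @ block q i M)" for M
    proof -
      obtain s v s' where "dyck_run G (block p (a - int M) M) (s, v) = Some (s', r)"
        using block_run_to(1)[of p a M] p by (auto simp: periodic_points_def)
      moreover obtain t v' where "dyck_run G (block q i M) ([], r) = Some (t, v')"
        using loop_start_free[OF i, of M] by blast
      then have "dyck_run G (block q i M) (s', r) = Some (t @ s', v')"
        by (auto dest: dyck_run_frame[where t = s'])
      ultimately show ?thesis unfolding runs_iff dyck_run_append_Some by blast
    qed
    then show "\<exists>A B. M \<le> A \<and> M \<le> B \<and> runs G (block p (a - int A) A @ block q i B)" for M by blast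
  qed
qed

text \<open>Dual to \<open>connects_neg\<close>: reversed, the left half of \<open>p\<close> needs
  no stack of its own, so \<open>p\<close> can end with any stack that the right half of
  \<open>q\<close> asks for.\<close>

lemma connects_from_pos:
  assumes p: "p \<in> pos_points n b" "0 < n" and q: "q \<in> periodic_points 3" "dyck_source G (q a) = r"
  shows "connects n p q"
proof -
  obtain i where i: "loop_start n b (reverse_seq p) i" using p by (auto simp: neg_points_def pos_points_def)
  show ?thesis
  proof (rule connectsI[where a = "1 - i" and b = a])
    show "p \<in> periodic_points n" "0 < n" "q \<in> periodic_points 3"
      using assms pos_points_periodic_points by auto
    have "runs G (block p (1 - i - int M) M @ block q a M)" for M
    proof -
      obtain s s' v' where 1: "dyck_run G (block q a M) (s, r) = Some (s', v')"
        using block_run_to(2)[of q a M] q by (auto simp: periodic_points_def)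
      obtain t v where "dyck_run G (block (reverse_seq p) i M) ([], r) = Some (t, v)"
        using loop_start_free[OF i, of M] by blast
      from dyck_run_reverse[OF this]
      have "dyck_run G (block p (1 - i - int M) M) (t, v) = Some ([], r)"
        by (simp add: block_reverse_seq)
      from dyck_run_frame[OF this, of s]
      have "dyck_run G (block p (1 - i - int M) M) (t @ s, v) = Some (s, r)" by simp
      with 1 show ?thesis unfolding runs_iff dyck_run_append_Some by blast
    qed
    then show "\<exists>A B. M \<le> A \<and> M \<le> B \<and> runs G (block p (1 - i - int A) A @ block q a B)" for M by blast
  qed
qed

text \<open>With the same loop, \<open>M\<close> periods of \<open>p\<close> push exactly what
  \<open>M\<close> periods of \<open>q\<close> pop. The periods \<open>n\<close> and 3 differ in
  length, hence the windows of unequal length around the seam.\<close>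

lemma connects_neg_pos:
  assumes p: "p \<in> neg_points n b" "0 < n" and q: "q \<in> pos_points 3 b"
  shows "connects n p q"
proof -
  obtain i where i: "loop_start n b p i" using p by (auto simp: neg_points_def)
  obtain j where j: "loop_start 3 b (reverse_seq q) j" using q by (auto simp: neg_points_def pos_points_def)
  have perp: "periodic n p" using i by (simp add: loop_start_def)
  have "periodic 3 (reverse_seq q)" using j by (simp add: loop_start_def)
  then have perq: "periodic 3 q" by simp
  show ?thesis
  proof (rule connectsI[where a = i and b = "1 - j"])
    show "p \<in> periodic_points n" "0 < n" "q \<in> periodic_points 3"
      using assms neg_points_periodic_points pos_points_periodic_points by blast+
    have "runs G (block p (i - int (n * M)) (n * M) @ block q (1 - j) (3 * M))" for M
    proof -
      have "block p (i - int (n * M)) (n * M) = block p i (n * M)"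
        using block_periodic[OF perp, of i "- int M"] by (simp add: mult.commute)
      then have 1: "dyck_run G (block p (i - int (n * M)) (n * M)) ([], r) =
          Some (concat (replicate M [b, arc2 b, arc1 b]), r)"
        using loop_start_run[OF i] by simp
      have "block (reverse_seq q) j (3 * M) = reverse_word (block q (1 - j) (3 * M))"
        using block_periodic[OF perq, of "1 - j" "- int M"] by (simp add: block_reverse_seq mult.commute)
      with dyck_run_reverse[OF loop_start_run[OF j, of M]]
      have "dyck_run G (block q (1 - j) (3 * M)) (concat (replicate M [b, arc2 b, arc1 b]), r) = Some ([], r)"
        by simp
      with 1 show ?thesis unfolding runs_iff dyck_run_append_Some by blast
    qed
    moreover have "M \<le> n * M" "M \<le> 3 * M" for M using \<open>0 < n\<close> by auto
    ultimately show "\<exists>A B. M \<le> A \<and> M \<le> B \<and> runs G (block p (i - int A) A @ block q (1 - j) B)" for M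
      by blast
  qed
qed

lemma concat_replicate_snoc: "concat (replicate (Suc m) w) = concat (replicate m w) @ w"
  by (induction m) auto

text \<open>A word disturbs no more entries at the top than it has letters; this limits what a
  transition can do to the edges piled up before it.\<close>

lemma dyck_run_keeps:
  assumes "dyck_run G w (s, v) = Some (s', v')"
  shows "\<exists>y k. k \<le> length w \<and> length y \<le> length w \<and> s' = y @ drop k s"
  using assms
proof (induction w arbitrary: s v)
  case Nil
  then show ?case by (auto intro: exI[of _ "[]"])
next
  case (Cons a w)
  show ?case
  proof (cases a)
    case (Neg e)
    then have "dyck_run G w (e # s, head G e) = Some (s', v')" using Cons.prems by (auto split: if_splits)
    from Cons.IH[OF this] obtain y k where yk: "k \<le> length w" "length y \<le> length w" "s' = y @ drop k (e # s)"
      by blast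
    show ?thesis
    proof (cases k)
      case 0
      then show ?thesis using yk by (intro exI[of _ "y @ [e]"] exI[of _ 0]) auto
    next
      case (Suc k')
      then show ?thesis using yk by (intro exI[of _ y] exI[of _ k']) auto
    qed
  next
    case (Pos e)
    then obtain s0 where s0: "s = e # s0" "dyck_run G w (s0, tail G e) = Some (s', v')"
      using Cons.prems by (cases s) (auto split: if_splits)
    from Cons.IH[OF this(2)] obtain y k where yk: "k \<le> length w" "length y \<le> length w" "s' = y @ drop k s0"
      by blast
    then show ?thesis using s0(1) by (intro exI[of _ y] exI[of _ "Suc k"]) auto
  qed
qed

lemma dyck_run_map_Pos:
  "dyck_run G (map Pos es) (s, v) = Some (s', v') \<Longrightarrow> es = take (length es) s"
proof (induction es arbitrary: s v)
  case (Cons e es)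
  then show ?case by (cases s) (auto split: if_splits)
qed simp

lemma pos_points_3_letter:
  assumes "q \<in> pos_points 3 b"
  shows "\<exists>e\<in>{arc1 b, arc2 b, b}. q j = Pos e"
proof -
  obtain i where i: "loop_start 3 b (reverse_seq q) i" using assms by (auto simp: neg_points_def pos_points_def)
  then have w: "block (reverse_seq q) i 3 = [Neg (arc1 b), Neg (arc2 b), Neg b]" and per: "periodic 3 (reverse_seq q)"
    using loop_words_3 by (auto simp: loop_start_def)
  define k where "k = nat ((- j - i) mod int 3)"
  have k: "k < 3" "i + int k = - j + (- ((- j - i) div int 3)) * int 3"
    unfolding k_def using offset_mod[of 3 i "- j"] by simp_all
  have "reverse_seq q (i + int k) = block (reverse_seq q) i 3 ! k" using k(1) by simp
  then have "reverse_seq q (- j) \<in> {Neg (arc1 b), Neg (arc2 b), Neg b}"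
    using k(1) unfolding w k(2) periodicD[OF per] by (auto simp: less_Suc_eq numeral_3_eq_3)
  then have "flip (q j) \<in> {Neg (arc1 b), Neg (arc2 b), Neg b}" by (simp add: reverse_seq_def)
  then show ?thesis by (cases "q j") auto
qed

text \<open>Far to the left \<open>p\<close> stacks up more copies of loop \<open>c\<close> than the
  transition can remove. \<open>q\<close> must pop one of them, so \<open>c\<close> is among the
  arcs of loop \<open>b\<close>, and of these only \<open>b\<close> leaves a vertex of level
  two.\<close>

lemma connects_neg_pos_eq:
  assumes p: "p \<in> neg_points n c" "0 < n" and q: "q \<in> pos_points 3 b" and b: "b \<in> back_arcs"
    and con: "connects n p q"
  shows "c = b"
proof -
  have per: "p \<in> periodic_points n" "q \<in> periodic_points 3"
    using p q neg_points_periodic_points pos_points_periodic_points by blast+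
  obtain x j N1 N2 where x: "x \<in> markov_dyck G" and N1: "\<And>i. i < N1 \<Longrightarrow> x i = p i"
    and N2: "\<And>i. i > N2 \<Longrightarrow> x i = q (i + j)"
    using con unfolding connects_iff[OF per(1) p(2) per(2)] by blast
  obtain i0 where i0: "loop_start n c p i0" using p by (auto simp: neg_points_def)
  have perp: "periodic n p" using i0 by (simp add: loop_start_def)
  have c: "c \<in> back_arcs" using i0 by (simp add: loop_start_def)
  define K where "K = nat (\<bar>i0\<bar> + \<bar>N1\<bar> + \<bar>N2\<bar>)"
  \<comment> \<open>A position congruent to the loop start \<open>i0\<close> modulo
    \<open>n\<close>, so far left that \<open>x\<close> agrees with \<open>p\<close> before it and
    that \<open>x\<close> need not follow \<open>q\<close> before it.\<close>
  define a where "a = i0 + (- int K) * int n"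
  have "int K \<le> int K * int n" using p(2) by (simp add: mult_le_cancel_left1)
  then have "a \<le> i0 - int K" by (simp add: a_def)
  moreover have "int K = \<bar>i0\<bar> + \<bar>N1\<bar> + \<bar>N2\<bar>" by (simp add: K_def)
  ultimately have a: "a \<le> N1" "a \<le> N2 + 1" by linarith+
  \<comment> \<open>\<open>D\<close> is the length of the transition. One copy more than
    \<open>D\<close> leaves a whole copy at the bottom after \<open>D\<close> removals, and
    \<open>E\<close> pops are enough for up to \<open>D\<close> new entries and all
    \<open>3 * M\<close> old ones.\<close>
  define D where "D = nat (N2 + 1 - a)"
  define M where "M = Suc D"
  define g where "g = concat (replicate M [c, arc2 c, arc1 c])"
  define E where "E = D + 3 * M"
  let ?P = "block x (a - int (n * M)) (n * M)" and ?U = "block x a D" and ?Q = "block x (a + int D) E"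
  have P: "?P = block p i0 (n * M)"
  proof -
    have 1: "?P = block p (a - int (n * M)) (n * M)"
      using a by (intro block_cong N1) linarith
    have e: "a - int (n * M) = i0 + (- int K - int M) * int n" by (simp add: a_def algebra_simps)
    show ?thesis unfolding 1 unfolding e by (rule block_periodic[OF perp])
  qed
  obtain es where es: "?Q = map Pos es" "set es \<subseteq> {arc1 b, arc2 b, b}" "length es = E"
  proof -
    have "\<exists>e\<in>{arc1 b, arc2 b, b}. x (a + int D + int k) = Pos e" for k
      using N2[of "a + int D + int k"] pos_points_3_letter[OF q] a by (simp add: D_def)
    then obtain f where f: "\<And>k. f k \<in> {arc1 b, arc2 b, b} \<and> x (a + int D + int k) = Pos (f k)" by metis
    show ?thesis
      by (rule that[of "map f [0..<E]"]) (use f in \<open>auto simp: block_def\<close>)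
  qed
  have "runs G (block x (a - int (n * M)) (n * M + (D + E)))" by (rule markov_dyckD[OF x])
  then have "runs G (?P @ ?U @ ?Q)" by (simp add: block_add)
  then obtain s v s1 v1 s2 v2 s3 v3 where run: "dyck_run G ?P (s, v) = Some (s1, v1)"
    "dyck_run G ?U (s1, v1) = Some (s2, v2)" "dyck_run G ?Q (s2, v2) = Some (s3, v3)"
    unfolding runs_iff dyck_run_append_Some by blast
  have start: "dyck_run G ?P ([], r) = Some (g, r)"
    unfolding P g_def by (rule loop_start_run[OF i0])
  \<comment> \<open>The run may begin on an unknown stack \<open>s\<close>, but its vertex is forced
    by the first letter.\<close>
  have "v = r"
  proof -
    have "n * M = Suc (n * M - 1)" using p(2) by (simp add: M_def)
    then obtain d w where dw: "?P = d # w" by (metis block_Suc)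
    have "v = dyck_source G d" "r = dyck_source G d"
      using run(1) start unfolding dw by (simp_all only: dyck_run_Cons_source)
    then show ?thesis by simp
  qed
  then have s1: "s1 = g @ s" "v1 = r" using run(1) dyck_run_frame[OF start, of s] by simp_all
  obtain y k where yk: "k \<le> D" "length y \<le> D" "s2 = y @ drop k (g @ s)"
    using dyck_run_keeps[OF run(2)] s1 by auto
  have len: "length (concat (replicate m [c, arc2 c, arc1 c])) = 3 * m" for m by (induction m) auto
  have lg: "length g = 3 * M" unfolding g_def by (rule len)
  \<comment> \<open>The last copy in the list lies deepest in the stack, out of reach of the
    transition.\<close>
  have "g = concat (replicate D [c, arc2 c, arc1 c]) @ [c, arc2 c, arc1 c]"
    unfolding g_def M_def by (rule concat_replicate_snoc)
  then have "drop k g = drop k (concat (replicate D [c, arc2 c, arc1 c])) @ [c, arc2 c, arc1 c]"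
    using yk(1) len[of D] by simp
  then have "c \<in> set (drop k g)" by simp
  moreover have "s2 = (y @ drop k g) @ s"
    using yk(1,3) lg by (simp add: M_def)
  moreover have "length (y @ drop k g) \<le> E" using yk(2) lg by (simp add: E_def)
  moreover have "es = take E s2" using dyck_run_map_Pos run(3) es by metis
  ultimately have "c \<in> set es" by (simp add: set_append take_append)
  then have "c \<in> {arc1 b, arc2 b, b}" using es(2) by blast
  moreover have "c \<noteq> arc1 b" "c \<noteq> arc2 b"
    using back_arc[OF c] back_arc[OF b] lv_root by (metis zero_neq_one, metis zero_neq_numeral)
  ultimately show ?thesis by blast
qed

section \<open>Counting connections into a point of period three\<close>

definition connection_count :: "nat \<Rightarrow> (int \<Rightarrow> 'b dyck_symbol) \<Rightarrow> nat" where
  "connection_count n q = card {p \<in> periodic_points n. connects n p q}"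

lemma periodic_points_cases:
  assumes "p \<in> periodic_points n" "odd n" "n < 9"
  obtains c where "c \<in> back_arcs" "p \<in> neg_points n c" | c where "c \<in> back_arcs" "p \<in> pos_points n c"
  using assms periodic_points_decomp[OF assms(2,3)] by blast

lemma connection_count_neg:
  assumes "odd n" "n < 9" "q \<in> neg_points 3 b"
  shows "connection_count n q = 2 * n * (\<Sum>c\<in>back_arcs. loop_count n c)"
proof -
  have n: "0 < n" using assms(1) by (cases n) auto
  have "connects n p q" if p: "p \<in> periodic_points n" for p
  proof -
    have "\<exists>a. dyck_source G (p a) = r"
      using p assms(1,2) by (rule periodic_points_cases) (use neg_points_root in blast)+
    then show ?thesis using connects_neg[OF p n _ assms(3)] by blast
  qed
  then have "{p \<in> periodic_points n. connects n p q} = periodic_points n" by blast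
  then show ?thesis using card_periodic_points_odd[OF assms(1,2)] by (simp add: connection_count_def)
qed

text \<open>Every positive point connects to \<open>q\<close>, and of the negative ones exactly
  those of loop \<open>b\<close>; the second summand isolates the count of a single loop.\<close>

lemma connection_count_pos:
  assumes "odd n" "n < 9" "q \<in> pos_points 3 b" "b \<in> back_arcs"
  shows "connection_count n q = n * (\<Sum>c\<in>back_arcs. loop_count n c) + n * loop_count n b"
proof -
  have n: "0 < n" using assms(1) by (cases n) auto
  obtain a where a: "dyck_source G (q a) = r" using neg_points_root assms(3) by blast
  have q: "q \<in> periodic_points 3" using assms(3) pos_points_periodic_points by blast
  have "{p \<in> periodic_points n. connects n p q} = (\<Union>c\<in>back_arcs. pos_points n c) \<union> neg_points n b"
  proof (intro subset_antisym subsetI)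
    fix p assume "p \<in> {p \<in> periodic_points n. connects n p q}"
    then have p: "p \<in> periodic_points n" "connects n p q" by auto
    from p(1) assms(1,2) show "p \<in> (\<Union>c\<in>back_arcs. pos_points n c) \<union> neg_points n b"
    proof (rule periodic_points_cases)
      fix c assume "p \<in> neg_points n c"
      then show ?thesis using connects_neg_pos_eq[OF _ n assms(3,4) p(2)] by blast
    qed blast
  next
    fix p assume "p \<in> (\<Union>c\<in>back_arcs. pos_points n c) \<union> neg_points n b"
    then show "p \<in> {p \<in> periodic_points n. connects n p q}"
      using connects_from_pos[OF _ n q a] connects_neg_pos[OF _ n assms(3)]
        neg_points_periodic_points pos_points_periodic_points by blast
  qed
  moreover have "(\<Union>c\<in>back_arcs. pos_points n c) \<inter> neg_points n b = {}"
    using neg_pos_disjoint by blast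
  ultimately show ?thesis
    using card_UN_neg_points(2)[OF n] card_neg_points[OF assms(4) n] card_pos_points(2) n
    by (simp add: connection_count_def card_Un_disjoint)
qed

end

section \<open>Invariance under conjugacy\<close>

definition conjugacy :: "('v, 'e) pre_digraph \<Rightarrow> ('w, 'f) pre_digraph \<Rightarrow>
    ((int \<Rightarrow> 'e dyck_symbol) \<Rightarrow> (int \<Rightarrow> 'f dyck_symbol)) \<Rightarrow> bool" where
  "conjugacy G H h \<longleftrightarrow> homeomorphic_map (markov_dyck_topology G) (markov_dyck_topology H) h \<and>
     (\<forall>x\<in>markov_dyck G. h (shift_map x) = shift_map (h x))"

lemma conjugacy_bij: "conjugacy G H h \<Longrightarrow> bij_betw h (markov_dyck G) (markov_dyck H)"
  using homeomorphic_imp_injective_map homeomorphic_imp_surjective_map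
  unfolding conjugacy_def bij_betw_def topspace_markov_dyck_topology[symmetric] by blast

lemma shift_by_add: "shift_by i (shift_by j x) = shift_by (i + j) x"
  by (simp add: shift_by_def algebra_simps)

lemma shift_by_0 [simp]: "shift_by 0 x = x"
  by (simp add: shift_by_def)

lemma shift_map_eq: "shift_map x = shift_by 1 x"
  by (simp add: shift_map_def shift_by_def)

lemma conjugacy_shift_by:
  assumes "conjugacy G H h" "wf_digraph G" "x \<in> markov_dyck G"
  shows "h (shift_by k x) = shift_by k (h x)"
proof -
  interpret wf_digraph G by fact
  have nat: "h (shift_by (int n) y) = shift_by (int n) (h y)" if "y \<in> markov_dyck G" for n y
  proof (induction n)
    case (Suc n)
    have "h (shift_map (shift_by (int n) y)) = shift_map (h (shift_by (int n) y))"
      using assms(1) that by (simp add: conjugacy_def)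
    then show ?case using Suc by (simp add: shift_by_add shift_map_eq)
  qed simp
  show ?thesis
  proof (cases k rule: int_cases2)
    case (nonpos n)
    have "h x = shift_by (int n) (h (shift_by (- int n) x))"
      using nat[of "shift_by (- int n) x" n] assms(3) by (simp add: shift_by_add)
    then have "shift_by (- int n) (h x) = h (shift_by (- int n) x)" by (simp add: shift_by_add)
    then show ?thesis using nonpos by simp
  qed (use nat assms(3) in simp)
qed

lemma conjugacy_inverse:
  assumes "conjugacy G H h" "wf_digraph G"
  shows "\<exists>g. conjugacy H G g \<and> (\<forall>x\<in>markov_dyck G. g (h x) = x)"
proof -
  interpret wf_digraph G by fact
  obtain g where g: "homeomorphic_maps (markov_dyck_topology G) (markov_dyck_topology H) h g"
    using assms(1) unfolding conjugacy_def homeomorphic_map_maps by blast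
  then have gh: "\<forall>x\<in>markov_dyck G. g (h x) = x"
    by (simp add: homeomorphic_maps_def topspace_markov_dyck_topology)
  have "homeomorphic_map (markov_dyck_topology H) (markov_dyck_topology G) g"
    using g homeomorphic_maps_map by blast
  moreover have "g (shift_map y) = shift_map (g y)" if y: "y \<in> markov_dyck H" for y
  proof -
    obtain x where x: "x \<in> markov_dyck G" "y = h x"
      using y conjugacy_bij[OF assms(1)] by (auto simp: bij_betw_def)
    have "shift_map x \<in> markov_dyck G" using x(1) by (simp add: shift_map_eq)
    moreover have "shift_map y = h (shift_map x)" using assms(1) x by (simp add: conjugacy_def)
    ultimately show ?thesis using gh x by simp
  qed
  ultimately show ?thesis using gh by (auto simp: conjugacy_def)
qed

lemma periodic_iff_shift_by: "periodic n x \<longleftrightarrow> shift_by (int n) x = x"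
  by (auto simp: periodic_def shift_by_def fun_eq_iff)

lemma conjugacy_periodic_points:
  assumes "conjugacy G H h" "wf_digraph G" "wf_digraph H"
  shows "bij_betw h (wf_digraph.periodic_points G n) (wf_digraph.periodic_points H n)"
proof -
  interpret G: wf_digraph G by fact
  interpret H: wf_digraph H by fact
  note bij = conjugacy_bij[OF assms(1)]
  have iff: "periodic n (h x) \<longleftrightarrow> periodic n x" if "x \<in> markov_dyck G" for x
    using inj_onD[OF bij_betw_imp_inj_on[OF bij], of "shift_by (int n) x" x]
      conjugacy_shift_by[OF assms(1,2) that, of "int n"] that
    unfolding periodic_iff_shift_by by auto
  show ?thesis
    unfolding bij_betw_def
  proof
    show "inj_on h (G.periodic_points n)"
      using bij by (auto simp: G.periodic_points_def bij_betw_def intro: inj_on_subset)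
    show "h ` G.periodic_points n = H.periodic_points n"
      using bij iff by (fastforce simp: G.periodic_points_def H.periodic_points_def bij_betw_def)
  qed
qed

text \<open>Connections are phrased by limits of shifts, which a continuous shift-commuting map
  preserves; the inverse conjugacy gives the converse.\<close>

lemma conjugacy_connects:
  assumes "conjugacy G H h" "wf_digraph G" "wf_digraph H" "wf_digraph.connects G n p q"
    and "q \<in> markov_dyck G"
  shows "wf_digraph.connects H n (h p) (h q)"
proof -
  interpret G: wf_digraph G by fact
  interpret H: wf_digraph H by fact
  obtain x j where x: "x \<in> markov_dyck G"
    "limitin (markov_dyck_topology G) (\<lambda>k. shift_by (- int (k * n)) x) p sequentially"
    "limitin (markov_dyck_topology G) (\<lambda>k. shift_by (int (k * 3)) x) (shift_by j q) sequentially"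
    using assms(4) unfolding G.connects_def by blast
  have cont: "continuous_map (markov_dyck_topology G) (markov_dyck_topology H) h"
    using assms(1) homeomorphic_imp_continuous_map by (auto simp: conjugacy_def)
  have "h x \<in> markov_dyck H" using x(1) conjugacy_bij[OF assms(1)] by (auto simp: bij_betw_def)
  moreover have "limitin (markov_dyck_topology H) (\<lambda>k. shift_by (- int (k * n)) (h x)) (h p) sequentially"
    using continuous_map_limit[OF cont x(2)] conjugacy_shift_by[OF assms(1,2) x(1)] by (simp add: o_def)
  moreover have "limitin (markov_dyck_topology H) (\<lambda>k. shift_by (int (k * 3)) (h x)) (shift_by j (h q)) sequentially"
    using continuous_map_limit[OF cont x(3)] conjugacy_shift_by[OF assms(1,2)] x(1) assms(5) by (simp add: o_def)
  ultimately show ?thesis unfolding H.connects_def by blast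
qed

lemma conjugacy_connection_count:
  assumes h: "conjugacy G H h" and G: "depth_two G r lv" and H: "depth_two H r' lv'"
    and q: "q \<in> wf_digraph.periodic_points G 3"
  shows "depth_two.connection_count H n (h q) = depth_two.connection_count G n q"
proof -
  interpret G: depth_two G r lv by fact
  interpret H: depth_two H r' lv' by fact
  have wf: "wf_digraph G" "wf_digraph H" by unfold_locales
  note bij = conjugacy_periodic_points[OF h wf]
  obtain g where g: "conjugacy H G g" "\<forall>x\<in>markov_dyck G. g (h x) = x"
    using conjugacy_inverse[OF h wf(1)] by blast
  have qm: "q \<in> markov_dyck G" using q by (simp add: G.periodic_points_def)
  have hq: "h q \<in> markov_dyck H" using qm conjugacy_bij[OF h] by (auto simp: bij_betw_def)
  have "H.connects n (h p) (h q) \<longleftrightarrow> G.connects n p q" if "p \<in> G.periodic_points n" for p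
    using conjugacy_connects[OF h wf, of n p q] conjugacy_connects[OF g(1) wf(2,1), of n "h p" "h q"]
      g(2) qm hq that by (auto simp: G.periodic_points_def)
  then have "h ` {p \<in> G.periodic_points n. G.connects n p q} = {p \<in> H.periodic_points n. H.connects n p (h q)}"
    using bij by (fastforce simp: bij_betw_def)
  moreover have "inj_on h {p \<in> G.periodic_points n. G.connects n p q}"
    using bij by (auto simp: bij_betw_def intro: inj_on_subset)
  then have "card (h ` {p \<in> G.periodic_points n. G.connects n p q}) = card {p \<in> G.periodic_points n. G.connects n p q}"
    by (rule card_image)
  ultimately show ?thesis
    unfolding G.connection_count_def H.connection_count_def by simp
qed

text \<open>Comparing sets of values avoids having to match the loops of \<open>G\<close> with those
  of \<open>H\<close>.\<close>

lemma conjugacy_connection_counts: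
  assumes h: "conjugacy G H h" and G: "depth_two G r lv" and H: "depth_two H r' lv'"
  shows "depth_two.connection_count H n ` wf_digraph.periodic_points H 3 =
    depth_two.connection_count G n ` wf_digraph.periodic_points G 3"
proof -
  interpret G: depth_two G r lv by fact
  interpret H: depth_two H r' lv' by fact
  have wf: "wf_digraph G" "wf_digraph H" by unfold_locales
  have "H.periodic_points 3 = h ` G.periodic_points 3"
    using conjugacy_periodic_points[OF h wf] by (simp add: bij_betw_def)
  then show ?thesis
    using conjugacy_connection_count[OF h G H] by (simp add: image_image cong: image_cong)
qed

section \<open>Out-degrees recovered from connection counts\<close>

context depth_two
begin

lemma od_pos: "v \<in> verts G \<Longrightarrow> 0 < od v"
  using out_ne by (simp add: card_gt_0_iff)

lemma loop_count_pos:
  assumes "b \<in> back_arcs"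
  shows "0 < loop_count 5 b" "0 < loop_count 7 b"
  using loop_count_5[OF assms] loop_count_7[OF assms] od_pos[OF root_in] by auto

lemma points_3_nonempty:
  assumes "b \<in> back_arcs"
  shows "neg_points 3 b \<noteq> {}" "pos_points 3 b \<noteq> {}"
proof -
  have "card (neg_points 3 b) = 3" "card (pos_points 3 b) = 3"
    using card_neg_points(1)[OF assms, of 3] card_pos_points(1)[OF assms, of 3] loop_count_3[OF assms] by simp_all
  then show "neg_points 3 b \<noteq> {}" "pos_points 3 b \<noteq> {}" by auto
qed

text \<open>Negative points contribute one value of \<open>connection_count n\<close>, strictly larger than the values
  from positive points, of which there is only one precisely if \<open>loop_count n\<close> is constant.\<close>

lemma card_connection_counts:
  assumes "odd n" "n < 9" "\<And>b. b \<in> back_arcs \<Longrightarrow> 0 < loop_count n b"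
  shows "card (connection_count n ` periodic_points 3) \<le> 2 \<longleftrightarrow>
    (\<forall>b\<in>back_arcs. \<forall>c\<in>back_arcs. loop_count n b = loop_count n c)"
proof -
  define s where "s = (\<Sum>c\<in>back_arcs. loop_count n c)"
  have n: "0 < n" using assms(1) by (cases n) auto
  have B: "back_arcs \<noteq> {}" using two_in by (auto simp: back_arcs_def)
  let ?P = "(\<lambda>b. n * s + n * loop_count n b) ` back_arcs"
  have neg: "connection_count n q = 2 * n * s" if "q \<in> neg_points 3 b" for q b
    using connection_count_neg[OF assms(1,2) that] by (simp add: s_def)
  have pos: "connection_count n q = n * s + n * loop_count n b" if "q \<in> pos_points 3 b" "b \<in> back_arcs" for q b
    using connection_count_pos[OF assms(1,2) that] by (simp add: s_def)
  have img: "connection_count n ` periodic_points 3 = insert (2 * n * s) ?P"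
  proof (intro subset_antisym subsetI)
    fix y assume "y \<in> connection_count n ` periodic_points 3"
    then obtain q where q: "q \<in> periodic_points 3" "y = connection_count n q" by blast
    from q(1) show "y \<in> insert (2 * n * s) ?P"
      by (rule periodic_points_cases) (use q(2) neg pos in auto)
  next
    fix y assume "y \<in> insert (2 * n * s) ?P"
    then show "y \<in> connection_count n ` periodic_points 3"
    proof
      assume y: "y = 2 * n * s"
      obtain b q where q: "q \<in> neg_points 3 b" using B points_3_nonempty(1) by blast
      then show ?thesis
        using y neg subsetD[OF neg_points_periodic_points q] by (intro image_eqI[of _ _ q]) auto
    next
      assume "y \<in> ?P"
      then obtain b where b: "b \<in> back_arcs" "y = n * s + n * loop_count n b" by blast
      obtain q where q: "q \<in> pos_points 3 b" using points_3_nonempty(2)[OF b(1)] by blast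
      then show ?thesis
        using b pos subsetD[OF pos_points_periodic_points q] by (intro image_eqI[of _ _ q]) auto
    qed
  qed
  \<comment> \<open>A second loop exists by \<open>two_in\<close> and its count is positive, so no
    single count reaches the sum.\<close>
  have less: "loop_count n b < s" if b: "b \<in> back_arcs" for b
  proof -
    have "\<not> back_arcs \<subseteq> {b}"
      using two_in card_mono[of "{b}" back_arcs] by (auto simp: back_arcs_def[symmetric])
    then obtain c where c: "c \<in> back_arcs" "c \<noteq> b" by blast
    have "loop_count n b + loop_count n c = (\<Sum>x\<in>{b, c}. loop_count n x)" using c by simp
    also have "\<dots> \<le> s" unfolding s_def by (rule sum_mono2) (use b c in auto)
    finally show ?thesis using assms(3)[OF c(1)] by simp
  qed
  have "2 * n * s \<notin> ?P"
  proof
    assume "2 * n * s \<in> ?P"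
    then obtain b where b: "b \<in> back_arcs" "2 * n * s = n * s + n * loop_count n b" by blast
    then have "loop_count n b = s" using n by auto
    then show False using less[OF b(1)] by simp
  qed
  then have "card (connection_count n ` periodic_points 3) = Suc (card ?P)"
    unfolding img by (simp add: card_insert_disjoint)
  moreover have "card ?P \<le> 1 \<longleftrightarrow> (\<forall>x\<in>?P. \<forall>y\<in>?P. x = y)"
    by (subst card_le_Suc0_iff_eq[symmetric]) auto
  moreover have "(\<forall>x\<in>?P. \<forall>y\<in>?P. x = y) \<longleftrightarrow>
      (\<forall>b\<in>back_arcs. \<forall>c\<in>back_arcs. loop_count n b = loop_count n c)"
    using n by simp
  ultimately show ?thesis by simp
qed

text \<open>What spherical homogeneity amounts to in depth two, with out-degrees taken in the whole
  graph; \<open>spherically_homogeneous_iff\<close> makes the translation.\<close>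

definition level_regular :: bool where
  "level_regular \<longleftrightarrow> (\<forall>u\<in>verts G. \<forall>v\<in>verts G. lv u = lv v \<longrightarrow> od u = od v)"

lemma sum_od_out:
  assumes "\<And>f. f \<in> out_arcs G v \<Longrightarrow> od (head G f) = d"
  shows "(\<Sum>f\<in>out_arcs G v. od (head G f)) = od v * d"
  using assms by simp

lemma level_two_out:
  assumes "v \<in> verts G" "lv v = 2" "f \<in> out_arcs G v"
  shows "f \<in> back_arcs"
proof -
  have f: "f \<in> arcs G" "tail G f = v" using assms(3) by auto
  then have "lv (head G f) = 0" using lv_head[OF f(1)] assms(2) by simp
  then show ?thesis using lv_zero[OF head_in_verts[OF f(1)]] f by (simp add: back_arcs_def)
qed

text \<open>The target of \<open>f\<close> has an outgoing arc, so \<open>f\<close> lies on a loop;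
  statements about all loops thus reach every arc leaving level one.\<close>

lemma level_one_out:
  assumes "v \<in> verts G" "lv v = 1" "f \<in> out_arcs G v"
  shows "\<exists>b\<in>back_arcs. arc2 b = f \<and> tail G b = head G f"
proof -
  have f: "f \<in> arcs G" "tail G f = v" using assms(3) by auto
  have l: "lv (head G f) = 2" using lv_head[OF f(1)] assms(2) f(2) by simp
  obtain b where b: "b \<in> out_arcs G (head G f)" using out_ne[OF head_in_verts[OF f(1)]] by blast
  then have "b \<in> back_arcs" using level_two_out[OF head_in_verts[OF f(1)] l] by blast
  moreover have "head G f \<noteq> r" using l lv_root by (metis zero_neq_numeral)
  then have "parc (head G f) = f" using parc_eq[OF f(1)] by blast
  ultimately show ?thesis using b by (intro bexI[of _ b]) (auto simp: arc2_def)
qed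

text \<open>Let \<open>m\<close>, \<open>k\<close>, \<open>l\<close> be the out-degrees at levels
  zero, one and two along the loop. Equal siblings turn two of the nested sums into
  \<open>k * l\<close> and \<open>l * m\<close>; adding the missing \<open>k * m\<close> completes
  the square of \<open>m + k + l\<close>. The remaining sum is the same for all loops.\<close>

lemma loop_count_7_sums:
  assumes "b \<in> back_arcs" "\<And>f. f \<in> out_arcs G (tail G (arc2 b)) \<Longrightarrow> od (head G f) = od (tail G b)"
  shows "loop_count 7 b + od (tail G (arc2 b)) * od r =
    loop_count 5 b ^ 2 + (\<Sum>f\<in>out_arcs G r. od (head G f))"
proof -
  have "tail G b \<in> verts G" using back_arc(1)[OF assms(1)] by simp
  then have "head G f = r" if "f \<in> out_arcs G (tail G b)" for f
    using level_two_out[OF _ back_arc(8)[OF assms(1)] that] by (simp add: back_arcs_def)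
  then have "(\<Sum>f\<in>out_arcs G (tail G b). od (head G f)) = od (tail G b) * od r" by (intro sum_od_out) simp
  moreover have "(\<Sum>f\<in>out_arcs G (tail G (arc2 b)). od (head G f)) = od (tail G (arc2 b)) * od (tail G b)"
    using assms(2) by (rule sum_od_out)
  ultimately show ?thesis
    unfolding loop_count_5[OF assms(1)] loop_count_7[OF assms(1)] by (simp add: power2_eq_square algebra_simps)
qed

lemma level_regular_loop_counts:
  assumes "level_regular" "b \<in> back_arcs" "c \<in> back_arcs"
  shows "loop_count 5 b = loop_count 5 c" "loop_count 7 b = loop_count 7 c"
proof -
  note B = back_arc[OF assms(2)] and C = back_arc[OF assms(3)]
  have v: "tail G b \<in> verts G" "tail G c \<in> verts G" "tail G (arc2 b) \<in> verts G" "tail G (arc2 c) \<in> verts G"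
    using B(1,3) C(1,3) by auto
  have o: "od (tail G b) = od (tail G c)" "od (tail G (arc2 b)) = od (tail G (arc2 c))"
    using assms(1)[unfolded level_regular_def, rule_format, OF v(1,2)]
      assms(1)[unfolded level_regular_def, rule_format, OF v(3,4)] B(8,9) C(8,9) by simp_all
  then show 5: "loop_count 5 b = loop_count 5 c"
    using loop_count_5 assms by simp
  have "od (head G f) = od (tail G d)" if d: "d \<in> back_arcs" and f: "f \<in> out_arcs G (tail G (arc2 d))" for d f
  proof -
    have f': "f \<in> arcs G" "tail G f = tail G (arc2 d)" using f by auto
    have "lv (head G f) = lv (tail G d)" using lv_head[OF f'(1)] back_arc(8,9)[OF d] f'(2) by simp
    then show ?thesis
      using assms(1)[unfolded level_regular_def, rule_format, of "head G f" "tail G d"] back_arc(1)[OF d] f'(1)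
      by simp
  qed
  then show "loop_count 7 b = loop_count 7 c"
    using loop_count_7_sums[OF assms(2)] loop_count_7_sums[OF assms(3)] 5 o assms(2,3) by simp
qed

text \<open>Period five makes \<open>k + l\<close> constant. Loops through the same level-one vertex
  share \<open>k\<close>, hence also \<open>l\<close>, so \<open>loop_count_7_sums\<close> applies
  to every loop; it makes \<open>k * m\<close> constant, and \<open>m\<close> is the positive
  out-degree of the common root.\<close>

lemma loop_counts_level_regular:
  assumes "\<forall>b\<in>back_arcs. \<forall>c\<in>back_arcs. loop_count 5 b = loop_count 5 c"
    "\<forall>b\<in>back_arcs. \<forall>c\<in>back_arcs. loop_count 7 b = loop_count 7 c"
  shows level_regular
proof -
  have same: "od (tail G (arc2 b)) + od (tail G b) = od (tail G (arc2 c)) + od (tail G c)"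
    if "b \<in> back_arcs" "c \<in> back_arcs" for b c
  proof -
    have "loop_count 5 b = loop_count 5 c" using assms(1) that by blast
    then show ?thesis unfolding loop_count_5[OF that(1)] loop_count_5[OF that(2)] by simp
  qed
  have child: "od (head G f) = od (tail G b)"
    if b: "b \<in> back_arcs" and f: "f \<in> out_arcs G (tail G (arc2 b))" for b f
  proof -
    have "tail G (arc2 b) \<in> verts G" using back_arc(3)[OF b] by simp
    then obtain c where c: "c \<in> back_arcs" "arc2 c = f" "tail G c = head G f"
      using level_one_out[OF _ back_arc(9)[OF b] f] by blast
    then show ?thesis using same[OF b c(1)] f by simp
  qed
  have k: "od (tail G (arc2 b)) = od (tail G (arc2 c))" if "b \<in> back_arcs" "c \<in> back_arcs" for b c
  proof -
    have "od (tail G (arc2 b)) * od r = od (tail G (arc2 c)) * od r"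
      using loop_count_7_sums[OF that(1) child[OF that(1)]] loop_count_7_sums[OF that(2) child[OF that(2)]]
        assms that by (metis add_left_cancel)
    then show ?thesis using od_pos[OF root_in] by (metis mult_cancel2 less_irrefl)
  qed
  have l: "od (tail G b) = od (tail G c)" if "b \<in> back_arcs" "c \<in> back_arcs" for b c
    using same[OF that] k[OF that] by simp
  have L1: "\<exists>b\<in>back_arcs. tail G (arc2 b) = v" if "v \<in> verts G" "lv v = 1" for v
    using level_one_out[OF that] out_ne[OF that(1)] by (metis all_not_in_conv in_out_arcs_conv)
  have L2: "\<exists>b\<in>back_arcs. tail G b = v" if "v \<in> verts G" "lv v = 2" for v
    using level_two_out[OF that] out_ne[OF that(1)] by (metis all_not_in_conv in_out_arcs_conv)
  show ?thesis
    unfolding level_regular_def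
  proof (intro ballI impI)
    fix u v assume uv: "u \<in> verts G" "v \<in> verts G" "lv u = lv v"
    consider "lv u = 0" | "lv u = 1" | "lv u = 2" using lv_le[OF uv(1)] by linarith
    then show "od u = od v"
    proof cases
      case 1
      then show ?thesis using lv_zero uv by metis
    next
      case 2
      then show ?thesis using L1[of u] L1[of v] uv k by metis
    next
      case 3
      then show ?thesis using L2[of u] L2[of v] uv l by metis
    qed
  qed
qed

lemma level_regular_iff:
  "level_regular \<longleftrightarrow> (\<forall>n\<in>{5, 7}. card (connection_count n ` periodic_points 3) \<le> 2)"
proof -
  have "level_regular \<longleftrightarrow> (\<forall>n\<in>{5, 7}. \<forall>b\<in>back_arcs. \<forall>c\<in>back_arcs. loop_count n b = loop_count n c)"
    using level_regular_loop_counts loop_counts_level_regular by blast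
  also have "\<dots> \<longleftrightarrow> (\<forall>n\<in>{5, 7}. card (connection_count n ` periodic_points 3) \<le> 2)"
    using card_connection_counts[of 5] card_connection_counts[of 7] loop_count_pos by simp
  finally show ?thesis .
qed

end

lemma conjugacy_level_regular:
  assumes "conjugacy G H h" "depth_two G r lv" "depth_two H r' lv'" "depth_two.level_regular G lv"
  shows "depth_two.level_regular H lv'"
  using assms(4) conjugacy_connection_counts[OF assms(1-3)]
    depth_two.level_regular_iff[OF assms(2)] depth_two.level_regular_iff[OF assms(3)] by simp

section \<open>Regular graphs\<close>

text \<open>Periods 2, 3, 5 and 4 of a regular graph give \<open>S\<close>, \<open>L\<close>,
  \<open>c\<close> and \<open>Q\<close> after cancelling known terms. If \<open>m\<close> and
  \<open>m'\<close> differed, elimination would leave a product identity whose sign forces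
  \<open>p < s\<close>, hence \<open>l = l' = 1\<close>; then \<open>s - p\<close> equals both
  \<open>m\<close> and \<open>m'\<close>.\<close>

lemma parameters_determined:
  fixes m k l m' k' l' :: nat
  assumes pos: "0 < m" "0 < k" "0 < l" "0 < m'" "0 < k'" "0 < l'"
    and S: "m + m * k = m' + m' * k'" and L: "m * k * l = m' * k' * l'"
    and c: "m + k + l = m' + k' + l'"
    and Q: "2 * (m * k + m * k * l + m * k * l * m) + (m * m + m * k * k + m * k * l * l) =
      2 * (m' * k' + m' * k' * l' + m' * k' * l' * m') + (m' * m' + m' * k' * k' + m' * k' * l' * l')"
  shows "m = m' \<and> k = k' \<and> l = l'"
proof (cases "m = m'")
  case True
  then have "k = k'" using S pos by simp
  then show ?thesis using True c by simp
next
  case False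
  define M where "M = int m" define M' where "M' = int m'"
  define K where "K = int k" define K' where "K' = int k'"
  define N where "N = int l" define N' where "N' = int l'"
  have pos': "0 < M" "0 < K" "0 < N" "0 < M'" "0 < K'" "0 < N'"
    using pos by (simp_all add: M_def M'_def K_def K'_def N_def N'_def)
  have ne: "M \<noteq> M'" using False by (simp add: M_def M'_def)
  define s where "s = M + M * K" define p where "p = M * K * N"
  have S1: "s = M' + M' * K'"
    unfolding s_def M_def K_def M'_def K'_def using S by (metis of_nat_add of_nat_mult)
  have L1: "p = M' * K' * N'"
    unfolding p_def M_def K_def M'_def K'_def N_def N'_def using L by (metis of_nat_mult)
  have c1: "M + K + N = M' + K' + N'"
    unfolding M_def K_def M'_def K'_def N_def N'_def using c by (metis of_nat_add)
  have "2 * (M * K + M * K * N + M * K * N * M) + (M * M + M * K * K + M * K * N * N) =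
      2 * (M' * K' + M' * K' * N' + M' * K' * N' * M') + (M' * M' + M' * K' * K' + M' * K' * N' * N')"
    using arg_cong[OF Q, of int] by (simp add: M_def K_def M'_def K'_def N_def N'_def)
  then have Q1: "2 * (M * K + p + p * M) + (M * M + M * K * K + p * N) =
      2 * (M' * K' + p + p * M') + (M' * M' + M' * K' * K' + p * N')"
    unfolding p_def[symmetric] L1[symmetric] .
  \<comment> \<open>Rearranged around \<open>s\<close>, \<open>p\<close> and
    \<open>x + y + z\<close>, which are common to both triples: these terms cancel in
    \<open>Q1\<close> and \<open>z\<close> disappears.\<close>
  have e: "2 * (x * y + p + p * x) + (x * x + x * y * y + p * z) = s + 2 * p + p * (x + y + z) + p * x - x + x * x + y * (s - p)"
    if "s = x + x * y" for x y z :: int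
    unfolding that by (simp add: algebra_simps)
  have "p * M - M + M * M + K * (s - p) = p * M' - M' + M' * M' + K' * (s - p)"
    using Q1 unfolding e[OF s_def] e[OF S1] c1 by simp
  then have 1: "(M - M') * (p - 1 + M + M') = (K' - K) * (s - p)"
    by (simp add: algebra_simps)
  \<comment> \<open>Evaluate \<open>M * s - M' * s\<close> with \<open>s\<close> expressed by the
    primed parameters in the first product and by the unprimed ones in the second; the products
    \<open>M * M'\<close> cancel.\<close>
  have 2: "M * M' * (K' - K) = s * (M - M')"
  proof -
    have "M * (M' + M' * K') - M' * (M + M * K) = M * s - M' * s"
      unfolding S1[symmetric] s_def[symmetric] by simp
    then show ?thesis by (simp add: algebra_simps)
  qed
  have "(M - M') * (M * M' * (p - 1 + M + M')) = (M * M' * (K' - K)) * (s - p)"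
    using arg_cong[OF 1, of "\<lambda>x. M * M' * x"] by (simp add: mult_ac)
  also have "\<dots> = (M - M') * (s * (s - p))" unfolding 2 by (simp add: mult_ac)
  finally have 3: "M * M' * (p - 1 + M + M') = s * (s - p)" using ne by simp
  have p: "0 < p" and s: "0 < s" using pos' by (simp_all add: p_def s_def add_pos_pos)
  have "0 < M * M' * (p - 1 + M + M')" using pos' p by simp
  then have ps: "p < s" unfolding 3 using s by (simp add: zero_less_mult_iff)
  have one: "z = 1" if "0 < x" "0 < y" "0 < z" "x * y * z < x + x * y" for x y z :: int
  proof (rule ccontr)
    assume "z \<noteq> 1"
    then have "2 \<le> z" using that by simp
    then have "x * y * 2 \<le> x * y * z" using that by (intro mult_left_mono) auto
    moreover have "x \<le> x * y" using that by simp
    ultimately show False using that(4) by linarith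
  qed
  have "N = 1" using one[of M K N] pos' ps by (simp add: p_def s_def)
  moreover have "N' = 1" using one[of M' K' N'] pos' ps by (simp add: L1 S1)
  ultimately have "s - p = M" "s - p = M'" using p_def s_def L1 S1 by simp_all
  then show ?thesis using ne by simp
qed

text \<open>Choose bijections between corresponding fibres, which have equal finite size, and glue
  them. The fibres in question will be the sets of arcs leaving a vertex.\<close>

lemma bij_betw_lift:
  assumes "finite X" "finite Y" "bij_betw g A B" "\<pi> ` X \<subseteq> A" "\<pi>' ` Y \<subseteq> B"
    and "\<And>a. a \<in> A \<Longrightarrow> card {x \<in> X. \<pi> x = a} = card {y \<in> Y. \<pi>' y = g a}"
  shows "\<exists>f. bij_betw f X Y \<and> (\<forall>x\<in>X. \<pi>' (f x) = g (\<pi> x))"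
proof -
  have "\<forall>a\<in>A. \<exists>\<phi>. bij_betw \<phi> {x \<in> X. \<pi> x = a} {y \<in> Y. \<pi>' y = g a}"
    using assms(1,2,6) by (intro ballI finite_same_card_bij) auto
  from bchoice[OF this] obtain \<phi> where
    \<phi>: "\<And>a. a \<in> A \<Longrightarrow> bij_betw (\<phi> a) {x \<in> X. \<pi> x = a} {y \<in> Y. \<pi>' y = g a}"
    by blast
  define f where "f x = \<phi> (\<pi> x) x" for x
  have f: "f x \<in> Y \<and> \<pi>' (f x) = g (\<pi> x)" if "x \<in> X" for x
    using \<phi>[of "\<pi> x"] that assms(4) by (auto simp: f_def bij_betw_def)
  have "bij_betw f X Y"
    unfolding bij_betw_def
  proof
    show "inj_on f X"
    proof (rule inj_onI)
      fix x y assume xy: "x \<in> X" "y \<in> X" "f x = f y"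
      then have "g (\<pi> x) = g (\<pi> y)" using f by metis
      then have e: "\<pi> x = \<pi> y" using assms(3,4) xy by (auto simp: bij_betw_def inj_on_def)
      then show "x = y"
        using \<phi>[of "\<pi> x"] assms(4) xy by (auto simp: f_def bij_betw_def inj_on_def)
    qed
    show "f ` X = Y"
    proof
      show "Y \<subseteq> f ` X"
      proof
        fix y assume y: "y \<in> Y"
        then have "\<pi>' y \<in> B" using assms(5) by blast
        then obtain a where a: "a \<in> A" "\<pi>' y = g a" using assms(3) by (auto simp: bij_betw_def)
        have "y \<in> \<phi> a ` {x \<in> X. \<pi> x = a}" using \<phi>[OF a(1)] a y by (simp add: bij_betw_def)
        then show "y \<in> f ` X" by (auto simp: f_def)
      qed
    qed (use f in auto)
  qed
  then show ?thesis using f by blast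
qed

section \<open>Sizes of levels and numbers of periodic points in regular graphs\<close>

context depth_two
begin

definition level_verts :: "nat \<Rightarrow> 'a set" where "level_verts i = {v \<in> verts G. lv v = i}"
definition level_arcs :: "nat \<Rightarrow> 'b set" where "level_arcs i = {e \<in> arcs G. lv (tail G e) = i}"

lemma finite_levels [simp]: "finite (level_verts i)" "finite (level_arcs i)"
  by (simp_all add: level_verts_def level_arcs_def)

lemma level_verts_0: "level_verts 0 = {r}"
  using lv_zero root_in by (auto simp: level_verts_def)

lemma level_arcs_2: "level_arcs 2 = back_arcs"
proof (intro subset_antisym subsetI)
  fix e assume "e \<in> level_arcs 2"
  then show "e \<in> back_arcs" using level_two_out[of "tail G e" e] by (simp add: level_arcs_def)
next
  fix e assume "e \<in> back_arcs"
  then show "e \<in> level_arcs 2" using back_arc(1,8) by (simp add: level_arcs_def)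
qed

text \<open>A vertex other than the root has a single incoming arc, which starts one level lower. At
  level two all heads collapse to the root, hence the bound on \<open>i\<close>.\<close>

lemma bij_head_level:
  assumes "i < 2"
  shows "bij_betw (head G) (level_arcs i) (level_verts (Suc i))"
  unfolding bij_betw_def
proof
  have lh: "lv (head G e) = Suc i" if "e \<in> level_arcs i" for e
    using that lv_head[of e] assms by (auto simp: level_arcs_def)
  show "inj_on (head G) (level_arcs i)"
  proof (rule inj_onI)
    fix e f assume ef: "e \<in> level_arcs i" "f \<in> level_arcs i" "head G e = head G f"
    have "head G e \<noteq> r" using lh[OF ef(1)] lv_root by (metis nat.distinct(1))
    then show "e = f" using unique_in ef by (simp add: level_arcs_def)
  qed
  show "head G ` level_arcs i = level_verts (Suc i)"
  proof (intro subset_antisym subsetI)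
    fix v assume v: "v \<in> level_verts (Suc i)"
    then have "v \<in> verts G" "v \<noteq> r" using lv_root by (auto simp: level_verts_def)
    then obtain e where e: "e \<in> arcs G" "head G e = v" using in_ex by blast
    have "(lv (tail G e) + 1) mod 3 = Suc i" using lv_head[OF e(1)] e v by (simp add: level_verts_def)
    then have "lv (tail G e) = i" using lv_le[OF tail_in_verts[OF e(1)]] assms by presburger
    then show "v \<in> head G ` level_arcs i" using e by (auto simp: level_arcs_def)
  qed (use lh in \<open>auto simp: level_verts_def level_arcs_def\<close>)
qed

lemma level_regular_params:
  assumes level_regular
  shows "\<exists>m k l. 0 < m \<and> 0 < k \<and> 0 < l \<and>
    (\<forall>v\<in>verts G. od v = (if lv v = 0 then m else if lv v = 1 then k else l))"
proof -
  have "back_arcs \<noteq> {}" using two_in by (auto simp: back_arcs_def)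
  then obtain b where b: "b \<in> back_arcs" by blast
  note B = back_arc[OF b]
  have v: "tail G (arc2 b) \<in> verts G" "tail G b \<in> verts G" using B by auto
  have all: "od v = (if lv v = 0 then od r else if lv v = 1 then od (tail G (arc2 b)) else od (tail G b))"
    if w: "v \<in> verts G" for v
  proof -
    note R = assms[unfolded level_regular_def, rule_format, OF w]
    have "lv v = 0 \<or> lv v = 1 \<or> lv v = 2" using lv_le[OF w] by linarith
    then show ?thesis using R[OF root_in] R[OF v(1)] R[OF v(2)] B(8,9) by auto
  qed
  show ?thesis
    by (intro exI[of _ "od r"] exI[of _ "od (tail G (arc2 b))"] exI[of _ "od (tail G b)"])
      (intro conjI ballI od_pos root_in v all)
qed

lemma card_level_arcs:
  assumes "\<And>v. v \<in> verts G \<Longrightarrow> lv v = i \<Longrightarrow> od v = d"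
  shows "card (level_arcs i) = card (level_verts i) * d"
proof -
  have "level_arcs i = (\<Union>v\<in>level_verts i. out_arcs G v)"
    by (auto simp: level_arcs_def level_verts_def)
  then have "card (level_arcs i) = (\<Sum>v\<in>level_verts i. od v)"
    by (simp only:) (rule card_UN_disjoint, auto)
  also have "\<dots> = card (level_verts i) * d" using assms by (simp add: level_verts_def)
  finally show ?thesis .
qed

lemma arcs_levels:
  "arcs G = level_arcs 0 \<union> level_arcs 1 \<union> level_arcs 2"
  "(\<Sum>e\<in>arcs G. F e) = (\<Sum>e\<in>level_arcs 0. F e) + (\<Sum>e\<in>level_arcs 1. F e) + (\<Sum>e\<in>level_arcs 2. F e)"
proof -
  show e: "arcs G = level_arcs 0 \<union> level_arcs 1 \<union> level_arcs 2"
    using lv_le[OF tail_in_verts] by (force simp: level_arcs_def)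
  show "(\<Sum>e\<in>arcs G. F e) = (\<Sum>e\<in>level_arcs 0. F e) + (\<Sum>e\<in>level_arcs 1. F e) + (\<Sum>e\<in>level_arcs 2. F e)"
    unfolding e by (subst sum.union_disjoint, simp, simp, force simp: level_arcs_def)+ simp
qed

text \<open>The levels have \<open>1\<close>, \<open>m\<close> and \<open>m * k\<close> vertices and
  there are \<open>m * k * l\<close> loops; the local counts are summed over the levels.\<close>

lemma periodic_point_counts:
  assumes d: "\<And>v. v \<in> verts G \<Longrightarrow> od v = (if lv v = 0 then m else if lv v = 1 then k else l)"
  shows "card (periodic_points 2) = 2 * (m + m * k + m * k * l)"
    "card (periodic_points 3) = 6 * (m * k * l)"
    "card (periodic_points 4) = 4 * (m * k + m * k * l + m * k * l * m) + 2 * (m * m + m * k * k + m * k * l * l)"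
    "card (periodic_points 5) = 10 * (m * k * l) * (m + k + l)"
proof -
  have A0: "card (level_arcs 0) = m" using card_level_arcs[of 0 m] d by (simp add: level_verts_0)
  have V1: "card (level_verts 1) = m" using bij_betw_same_card[OF bij_head_level[of 0]] A0 by simp
  have A1: "card (level_arcs 1) = m * k" using card_level_arcs[of 1 k] d V1 by simp
  have V2: "card (level_verts 2) = m * k"
    using bij_betw_same_card[OF bij_head_level[of 1]] A1 by (simp add: numeral_2_eq_2)
  have A2: "card (level_arcs 2) = m * k * l" using card_level_arcs[of 2 l] d V2 by simp
  have t: "od (tail G e) = (if i = 0 then m else if i = 1 then k else l)" if "e \<in> level_arcs i" for e i
    using that d[of "tail G e"] by (auto simp: level_arcs_def)
  have h: "od (head G e) = (if i = 0 then k else if i = 1 then l else m)" if "e \<in> level_arcs i" "i < 3" for e i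
  proof -
    have "i = 0 \<or> i = 1 \<or> i = 2" using that(2) by linarith
    then show ?thesis using that(1) d[of "head G e"] lv_head[of e] by (auto simp: level_arcs_def)
  qed
  have "card (arcs G) = m + m * k + m * k * l"
    using arcs_levels(2)[of "\<lambda>_. 1::nat"] A0 A1 A2 by simp
  then show "card (periodic_points 2) = 2 * (m + m * k + m * k * l)"
    by (simp add: card_periodic_points_2)
  show "card (periodic_points 4) = 4 * (m * k + m * k * l + m * k * l * m) + 2 * (m * m + m * k * k + m * k * l * l)"
    unfolding card_periodic_points_4 arcs_levels(2) using t h A0 A1 A2 by simp
  have "(\<Sum>b\<in>back_arcs. loop_count 3 b) = m * k * l"
    using loop_count_3 A2 by (simp add: level_arcs_2)
  then show "card (periodic_points 3) = 6 * (m * k * l)"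
    using card_periodic_points_odd[of 3] by simp
  have "loop_count 5 b = m + k + l" if "b \<in> back_arcs" for b
    using loop_count_5[OF that] back_arc[OF that] d[of r] d[of "tail G b"] d[of "tail G (arc2 b)"] root_in by simp
  then have "(\<Sum>b\<in>back_arcs. loop_count 5 b) = m * k * l * (m + k + l)"
    using A2 by (simp add: level_arcs_2)
  then show "card (periodic_points 5) = 10 * (m * k * l) * (m + k + l)"
    using card_periodic_points_odd[of 5] by simp
qed

end

section \<open>Building an isomorphism level by level\<close>

lemma level_lift:
  assumes G: "depth_two G r lv" and H: "depth_two H r' lv'"
    and d: "\<And>v. v \<in> verts G \<Longrightarrow> card (out_arcs G v) = D (lv v)"
    and d': "\<And>v. v \<in> verts H \<Longrightarrow> card (out_arcs H v) = D (lv' v)"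
    and g: "bij_betw g (depth_two.level_verts G lv i) (depth_two.level_verts H lv' i)"
  shows "\<exists>f. bij_betw f (depth_two.level_arcs G lv i) (depth_two.level_arcs H lv' i) \<and>
      (\<forall>e\<in>depth_two.level_arcs G lv i. tail H (f e) = g (tail G e))"
proof -
  interpret G: depth_two G r lv by fact
  interpret H: depth_two H r' lv' by fact
  have fib: "{e \<in> G.level_arcs i. tail G e = v} = out_arcs G v" if "v \<in> G.level_verts i" for v
    using that by (auto simp: G.level_arcs_def G.level_verts_def)
  have fib': "{e \<in> H.level_arcs i. tail H e = v} = out_arcs H v" if "v \<in> H.level_verts i" for v
    using that by (auto simp: H.level_arcs_def H.level_verts_def)
  have "card {e \<in> G.level_arcs i. tail G e = v} = card {e \<in> H.level_arcs i. tail H e = g v}"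
    if v: "v \<in> G.level_verts i" for v
  proof -
    have gv: "g v \<in> H.level_verts i" using g v by (auto simp: bij_betw_def)
    show ?thesis unfolding fib[OF v] fib'[OF gv]
      using d[of v] d'[of "g v"] v gv by (simp add: G.level_verts_def H.level_verts_def)
  qed
  moreover have "tail G ` G.level_arcs i \<subseteq> G.level_verts i" "tail H ` H.level_arcs i \<subseteq> H.level_verts i"
    by (auto simp: G.level_arcs_def H.level_arcs_def G.level_verts_def H.level_verts_def)
  ultimately show ?thesis
    by (intro bij_betw_lift[OF G.finite_levels(2) H.finite_levels(2) g])
qed

text \<open>In both graphs \<open>head\<close> is a bijection from the arcs of level
  \<open>i\<close> to the vertices of the next level, so \<open>f\<close> can be transported along
  it.\<close>

lemma head_lift:
  assumes G: "depth_two G r lv" and H: "depth_two H r' lv'" and i: "i < 2"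
    and f: "bij_betw f (depth_two.level_arcs G lv i) (depth_two.level_arcs H lv' i)"
  shows "\<exists>g. bij_betw g (depth_two.level_verts G lv (Suc i)) (depth_two.level_verts H lv' (Suc i)) \<and>
    (\<forall>e\<in>depth_two.level_arcs G lv i. head H (f e) = g (head G e))"
proof -
  interpret G: depth_two G r lv by fact
  interpret H: depth_two H r' lv' by fact
  let ?inv = "inv_into (G.level_arcs i) (head G)"
  note b = G.bij_head_level[OF i]
  have "bij_betw (head H \<circ> f \<circ> ?inv) (G.level_verts (Suc i)) (H.level_verts (Suc i))"
    using bij_betw_inv_into[OF b] f H.bij_head_level[OF i] by (blast intro: bij_betw_trans)
  moreover have "\<forall>e\<in>G.level_arcs i. head H (f e) = (head H \<circ> f \<circ> ?inv) (head G e)"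
    using bij_betw_inv_into_left[OF b] by simp
  ultimately show ?thesis by blast
qed

text \<open>Alternate \<open>level_lift\<close> and \<open>head_lift\<close> from the roots upwards.
  The construction closes up because all arcs leaving level two end at the root, whatever bijection
  is chosen on them.\<close>

lemma depth_two_iso:
  assumes G: "depth_two G r lv" and H: "depth_two H r' lv'"
    and d: "\<And>v. v \<in> verts G \<Longrightarrow> card (out_arcs G v) = D (lv v)"
    and d': "\<And>v. v \<in> verts H \<Longrightarrow> card (out_arcs H v) = D (lv' v)"
  shows "digraph_iso G H"
proof -
  interpret G: depth_two G r lv by fact
  interpret H: depth_two H r' lv' by fact
  define g0 where "g0 = (\<lambda>_::'a. r')"
  have g0: "bij_betw g0 (G.level_verts 0) (H.level_verts 0)"
    by (simp add: g0_def G.level_verts_0 H.level_verts_0 bij_betw_def)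
  obtain f0 where f0: "bij_betw f0 (G.level_arcs 0) (H.level_arcs 0)"
    "\<And>e. e \<in> G.level_arcs 0 \<Longrightarrow> tail H (f0 e) = g0 (tail G e)"
    using level_lift[OF G H d d' g0] by blast
  obtain g1 where g1: "bij_betw g1 (G.level_verts 1) (H.level_verts 1)"
    "\<And>e. e \<in> G.level_arcs 0 \<Longrightarrow> head H (f0 e) = g1 (head G e)"
    using head_lift[OF G H _ f0(1)] by auto
  obtain f1 where f1: "bij_betw f1 (G.level_arcs 1) (H.level_arcs 1)"
    "\<And>e. e \<in> G.level_arcs 1 \<Longrightarrow> tail H (f1 e) = g1 (tail G e)"
    using level_lift[OF G H d d' g1(1)] by blast
  obtain g2 where g2: "bij_betw g2 (G.level_verts 2) (H.level_verts 2)"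
    "\<And>e. e \<in> G.level_arcs 1 \<Longrightarrow> head H (f1 e) = g2 (head G e)"
    using head_lift[OF G H _ f1(1)] by (auto simp: numeral_2_eq_2)
  obtain f2 where f2: "bij_betw f2 (G.level_arcs 2) (H.level_arcs 2)"
    "\<And>e. e \<in> G.level_arcs 2 \<Longrightarrow> tail H (f2 e) = g2 (tail G e)"
    using level_lift[OF G H d d' g2(1)] by blast
  define \<gamma> where "\<gamma> v = (if lv v = 0 then g0 v else if lv v = 1 then g1 v else g2 v)" for v
  define \<phi> where "\<phi> e = (if lv (tail G e) = 0 then f0 e else if lv (tail G e) = 1 then f1 e else f2 e)" for e
  have V: "verts K = {v \<in> verts K. w v = 0} \<union> {v \<in> verts K. w v = 1} \<union> {v \<in> verts K. w v = 2}"
    if "\<And>v. v \<in> verts K \<Longrightarrow> w v \<le> 2" for K :: "('x, 'y) pre_digraph" and w :: "'x \<Rightarrow> nat"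
    using that by force
  have VG: "verts G = G.level_verts 0 \<union> G.level_verts 1 \<union> G.level_verts 2"
    unfolding G.level_verts_def using G.lv_le by (rule V)
  have VH: "verts H = H.level_verts 0 \<union> H.level_verts 1 \<union> H.level_verts 2"
    unfolding H.level_verts_def using H.lv_le by (rule V)
  have "bij_betw \<gamma> (G.level_verts 0) (H.level_verts 0)"
    by (rule bij_betw_cong[THEN iffD1, OF _ g0]) (simp add: \<gamma>_def G.level_verts_def)
  moreover have "bij_betw \<gamma> (G.level_verts 1) (H.level_verts 1)"
    by (rule bij_betw_cong[THEN iffD1, OF _ g1(1)]) (simp add: \<gamma>_def G.level_verts_def)
  moreover have "bij_betw \<gamma> (G.level_verts 2) (H.level_verts 2)"
    by (rule bij_betw_cong[THEN iffD1, OF _ g2(1)]) (simp add: \<gamma>_def G.level_verts_def)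
  ultimately have \<gamma>: "bij_betw \<gamma> (verts G) (verts H)"
    unfolding VG VH
    by (intro bij_betw_combine) (auto simp: H.level_verts_def)
  have "bij_betw \<phi> (G.level_arcs 0) (H.level_arcs 0)"
    by (rule bij_betw_cong[THEN iffD1, OF _ f0(1)]) (simp add: \<phi>_def G.level_arcs_def)
  moreover have "bij_betw \<phi> (G.level_arcs 1) (H.level_arcs 1)"
    by (rule bij_betw_cong[THEN iffD1, OF _ f1(1)]) (simp add: \<phi>_def G.level_arcs_def)
  moreover have "bij_betw \<phi> (G.level_arcs 2) (H.level_arcs 2)"
    by (rule bij_betw_cong[THEN iffD1, OF _ f2(1)]) (simp add: \<phi>_def G.level_arcs_def)
  ultimately have \<phi>: "bij_betw \<phi> (arcs G) (arcs H)"
    unfolding G.arcs_levels(1) H.arcs_levels(1)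
    by (intro bij_betw_combine) (auto simp: H.level_arcs_def)
  have inc: "\<gamma> (tail G e) = tail H (\<phi> e) \<and> \<gamma> (head G e) = head H (\<phi> e)" if e: "e \<in> arcs G" for e
  proof -
    consider "e \<in> G.level_arcs 0" | "e \<in> G.level_arcs 1" | "e \<in> G.level_arcs 2"
      using e G.arcs_levels(1) by blast
    then show ?thesis
    proof cases
      case 1
      then show ?thesis using f0(2)[OF 1] g1(2)[OF 1] G.lv_head[OF e]
        by (auto simp: \<gamma>_def \<phi>_def G.level_arcs_def)
    next
      case 2
      then show ?thesis using f1(2)[OF 2] g2(2)[OF 2] G.lv_head[OF e]
        by (auto simp: \<gamma>_def \<phi>_def G.level_arcs_def)
    next
      case 3
      have "f2 e \<in> H.level_arcs 2" using f2(1) 3 by (auto simp: bij_betw_def)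
      then have "head H (f2 e) = r'" using H.level_arcs_2 by (simp add: H.back_arcs_def)
      then show ?thesis using f2(2)[OF 3] G.lv_head[OF e] 3
        by (auto simp: \<gamma>_def \<phi>_def G.level_arcs_def g0_def)
    qed
  qed
  \<comment> \<open>With \<open>head H\<close> and \<open>tail H\<close> as the new incidence maps,
    the image of \<open>G\<close> is literally \<open>H\<close>.\<close>
  let ?iso = "\<lparr>iso_verts = \<gamma>, iso_arcs = \<phi>, iso_head = head H, iso_tail = tail H\<rparr>"
  have "G.digraph_isomorphism ?iso"
    using inc \<gamma> \<phi> G.wf_digraph_axioms by (simp add: G.digraph_isomorphism_def bij_betw_def)
  moreover have "H = app_iso ?iso G"
    using \<gamma> \<phi> by (simp add: app_iso_def bij_betw_def)
  ultimately show ?thesis unfolding digraph_iso_def by blast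
qed

section \<open>The incoming subtree\<close>

text \<open>Walks in both directions compose to a closed walk, which must be the empty one.\<close>

lemma tree_root_unique:
  assumes "wf_digraph T" "is_tree_root T r" "is_tree_root T r'"
  shows "r = r'"
proof -
  interpret wf_digraph T by fact
  obtain p q where p: "awalk r p r'" and q: "awalk r' q r"
    using assms(2,3) unfolding is_tree_root_def by blast
  have "awalk r (p @ q) r" using p q by (rule awalk_appendI)
  moreover have "awalk r [] r" using p by (auto simp: awalk_Nil_iff)
  ultimately have "p @ q = []" using assms(2) unfolding is_tree_root_def by blast
  then show ?thesis using p by (simp add: awalk_Nil_iff)
qed

lemma tree_root_eq:
  assumes "wf_digraph T" "is_tree_root T r"
  shows "tree_root T = r"
  unfolding tree_root_def using assms tree_root_unique[OF assms(1)] by (intro the_equality) auto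

text \<open>The walk from the root is unique, so the minimum ranges over a single length.\<close>

lemma tree_level_eq:
  assumes "wf_digraph T" "is_tree_root T r" "pre_digraph.awalk T r p v"
  shows "tree_level T v = length p"
proof -
  interpret wf_digraph T by fact
  have "v \<in> verts T" using assms(3) by blast
  then have "q = p" if "awalk r q v" for q
    using that assms(2,3) unfolding is_tree_root_def by blast
  then have "(\<exists>q. awalk r q v \<and> length q = n) \<longleftrightarrow> n = length p" for n
    using assms(3) by blast
  then show ?thesis
    unfolding tree_level_def tree_root_eq[OF assms(1,2)] by (simp add: Least_equality)
qed

section \<open>The subtree of only incoming arcs as an instance of \<open>depth_two\<close>\<close>

locale incoming_tree = fin_digraph G for G :: "('a, 'b) pre_digraph" +
  assumes strong: "strongly_connected G" and uniform: "uniform_depth_two G"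
begin

abbreviation T where "T \<equiv> incoming_subgraph G"
abbreviation r where "r \<equiv> tree_root T"
abbreviation lv where "lv \<equiv> tree_level T"

lemma T_simps [simp]:
  "verts T = verts G" "arcs T = only_incoming_arcs G" "tail T = tail G" "head T = head G"
  by (simp_all add: incoming_subgraph_def)

lemma only_incoming_sub: "e \<in> only_incoming_arcs G \<Longrightarrow> e \<in> arcs G"
  by (simp add: only_incoming_arcs_def)

lemma wf_T: "wf_digraph T"
  using uniform by (simp add: uniform_depth_two_def directed_tree_def)

sublocale T: wf_digraph T by (rule wf_T)

lemma root: "is_tree_root T r"
proof -
  obtain r0 where r0: "is_tree_root T r0"
    using uniform by (auto simp: uniform_depth_two_def directed_tree_def)
  show ?thesis using tree_root_eq[OF wf_T r0] r0 by simp
qed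

lemma walk_exists: "v \<in> verts G \<Longrightarrow> \<exists>p. T.awalk r p v \<and> lv v = length p"
  using root tree_level_eq[OF wf_T root] unfolding is_tree_root_def by (metis T_simps(1))

lemma root_in_verts: "r \<in> verts G"
  using root by (simp add: is_tree_root_def)

lemma root_walk: "T.awalk r p r \<Longrightarrow> p = []"
  using root T.awalk_Nil_iff root_in_verts unfolding is_tree_root_def by (metis T_simps(1))

lemma level_zero:
  assumes "v \<in> verts G"
  shows "lv v = 0 \<longleftrightarrow> v = r"
proof
  assume "lv v = 0"
  then show "v = r" using walk_exists[OF assms] by (auto simp: T.awalk_Nil_iff)
next
  have "T.awalk r [] r" using root_in_verts by (simp add: T.awalk_Nil_iff)
  from tree_level_eq[OF wf_T root this] show "lv v = 0" if "v = r" using that by simp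
qed

lemma tree_arc:
  assumes "e \<in> only_incoming_arcs G"
  shows "lv (head G e) = Suc (lv (tail G e))" "head G e \<noteq> r"
proof -
  have "tail G e \<in> verts G" using only_incoming_sub[OF assms] by simp
  then obtain p where p: "T.awalk r p (tail G e)" "lv (tail G e) = length p" using walk_exists by blast
  have "T.awalk (tail G e) [e] (head G e)"
    using T.arc_implies_awalk[of e] assms by simp
  with p(1) have w: "T.awalk r (p @ [e]) (head G e)" by (rule T.awalk_appendI)
  show "lv (head G e) = Suc (lv (tail G e))"
    using tree_level_eq[OF wf_T root w] p(2) by simp
  show "head G e \<noteq> r"
  proof
    assume "head G e = r"
    with w have "T.awalk r (p @ [e]) r" by (simp only:)
    from root_walk[OF this] show False by simp
  qed
qed

lemma tree_arc_into:
  assumes "v \<in> verts G" "v \<noteq> r"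
  shows "\<exists>e. e \<in> only_incoming_arcs G \<and> in_arcs G v = {e}"
proof -
  obtain p where p: "T.awalk r p v" using walk_exists[OF assms(1)] by blast
  then have "p \<noteq> []" using assms(2) by (auto simp: T.awalk_Nil_iff)
  then obtain q e where q: "p = q @ [e]" by (cases p rule: rev_cases) auto
  then have "e \<in> only_incoming_arcs G" "head G e = v"
    using p by (auto simp: T.awalk_append_iff T.awalk_Cons_iff T.awalk_Nil_iff)
  then show ?thesis by (auto simp: only_incoming_arcs_def)
qed

lemma other_arc:
  assumes "e \<in> arcs G" "e \<notin> only_incoming_arcs G"
  shows "head G e = r" "lv (tail G e) = 2"
proof -
  show "head G e = r"
  proof (rule ccontr)
    assume "head G e \<noteq> r"
    then obtain f where f: "f \<in> only_incoming_arcs G" "in_arcs G (head G e) = {f}"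
      using tree_arc_into[of "head G e"] assms(1) by auto
    have "e \<in> in_arcs G (head G e)" using assms(1) by simp
    then show False using f assms(2) by auto
  qed
  show "lv (tail G e) = 2" using uniform assms by (simp add: uniform_depth_two_def)
qed

lemma out_degree_zero_iff: "out_degree T v = 0 \<longleftrightarrow> out_arcs T v = {}"
proof -
  have "finite (out_arcs T v)"
    by (rule finite_subset[OF _ finite_arcs]) (auto dest: only_incoming_sub)
  then show ?thesis by (simp add: out_degree_def)
qed

lemma leaf_level: "v \<in> verts G \<Longrightarrow> out_arcs T v = {} \<Longrightarrow> lv v = 2"
  using uniform out_degree_zero_iff[of v] by (simp add: uniform_depth_two_def tree_leaves_def)

text \<open>A vertex of maximal level has no outgoing tree arc, so it is a leaf and its level is
  two.\<close>

lemma level_le: "v \<in> verts G \<Longrightarrow> lv v \<le> 2"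
proof -
  assume v: "v \<in> verts G"
  define M where "M = Max (lv ` verts G)"
  have "M \<in> lv ` verts G" unfolding M_def using root_in_verts by (intro Max_in) auto
  then obtain w where w: "w \<in> verts G" "lv w = M" by auto
  have max: "lv u \<le> M" if "u \<in> verts G" for u unfolding M_def using that by (intro Max_ge) auto
  have "out_arcs T w = {}"
  proof (rule ccontr)
    assume "out_arcs T w \<noteq> {}"
    then obtain f where "f \<in> out_arcs T w" by blast
    then have f: "f \<in> only_incoming_arcs G" "tail G f = w" by simp_all
    have "lv (head G f) \<le> M" using max only_incoming_sub[OF f(1)] by simp
    then show False using tree_arc(1)[OF f(1)] f(2) w(2) by simp
  qed
  then show "lv v \<le> 2" using leaf_level[OF w(1)] w(2) max[OF v] by simp
qed

lemma tree_arc_tail_level: "e \<in> only_incoming_arcs G \<Longrightarrow> lv (tail G e) < 2"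
  using tree_arc(1)[of e] level_le[of "head G e"] only_incoming_sub[of e] by simp

lemma leaves_eq: "tree_leaves T = {v \<in> verts G. lv v = 2}"
proof -
  have "out_arcs T v = {}" if "lv v = 2" for v
    using that tree_arc_tail_level by fastforce
  then show ?thesis using leaf_level by (auto simp: tree_leaves_def out_degree_zero_iff)
qed

lemma out_arcs_tree: "lv v < 2 \<Longrightarrow> out_arcs T v = out_arcs G v"
  using other_arc(2) only_incoming_sub by fastforce

text \<open>Below level two a vertex is no leaf of the tree; at level two strong connectivity gives
  a walk back to the root, and it is not empty.\<close>

lemma out_nonempty:
  assumes v: "v \<in> verts G"
  shows "out_arcs G v \<noteq> {}"
proof (cases "lv v = 2")
  case False
  then have "out_arcs T v \<noteq> {}" using leaf_level[OF v] by blast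
  then obtain f where "f \<in> out_arcs T v" by blast
  then have "f \<in> out_arcs G v" using only_incoming_sub by simp
  then show ?thesis by blast
next
  case True
  then have "v \<noteq> r" using level_zero[OF v] by simp
  have "v \<rightarrow>\<^sup>*\<^bsub>G\<^esub> r" using strong v root_in_verts by (simp add: strongly_connected_def)
  then obtain p where p: "awalk v p r" using reachable_awalk by blast
  then have "p \<noteq> []" using \<open>v \<noteq> r\<close> by (auto simp: awalk_Nil_iff)
  then obtain e q where "p = e # q" by (cases p) auto
  then have "e \<in> out_arcs G v" using p by (auto simp: awalk_Cons_iff)
  then show ?thesis by blast
qed

text \<open>An arc leaving level two is not a tree arc and so ends at the root. Were it the only arc
  into the root, it would belong to \<open>only_incoming_arcs\<close>, a contradiction.\<close>

lemma two_incoming: "2 \<le> card (in_arcs G r)"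
proof -
  have fin: "finite (in_arcs G r)" by (rule finite_subset[OF _ finite_arcs]) auto
  have "\<exists>w\<in>verts G. lv w = 2"
  proof (rule ccontr)
    assume no: "\<not> (\<exists>w\<in>verts G. lv w = 2)"
    have "\<exists>w\<in>verts G. lv w = k" if "k \<le> 2" for k
      using that
    proof (induction k)
      case 0
      then show ?case using level_zero root_in_verts by blast
    next
      case (Suc k)
      then obtain w where w: "w \<in> verts G" "lv w = k" by auto
      then obtain f where "f \<in> out_arcs T w" using leaf_level no by blast
      then have f: "f \<in> only_incoming_arcs G" "tail G f = w" by simp_all
      then show ?case using tree_arc(1)[OF f(1)] w only_incoming_sub[OF f(1)] by (metis head_in_verts)
    qed
    then show False using no by blast
  qed
  then obtain w where w: "w \<in> verts G" "lv w = 2" by blast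
  obtain e where "e \<in> out_arcs G w" using out_nonempty[OF w(1)] by blast
  then have e: "e \<in> arcs G" "tail G e = w" by simp_all
  have "e \<notin> only_incoming_arcs G" using tree_arc_tail_level[of e] e(2) w(2) by auto
  then have "head G e = r" using other_arc e by blast
  then have "e \<in> in_arcs G r" using e by simp
  moreover have "in_arcs G r \<noteq> {e}"
  proof
    assume "in_arcs G r = {e}"
    then have "e \<in> only_incoming_arcs G"
      using e(1) \<open>head G e = r\<close> by (simp add: only_incoming_arcs_def)
    then show False using \<open>e \<notin> only_incoming_arcs G\<close> by blast
  qed
  ultimately obtain f where "f \<in> in_arcs G r" "f \<noteq> e" by blast
  then have "card {e, f} \<le> card (in_arcs G r)"
    using \<open>e \<in> in_arcs G r\<close> fin by (intro card_mono) auto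
  then show ?thesis using \<open>f \<noteq> e\<close> by simp
qed

sublocale depth_two G r lv
proof
  show "r \<in> verts G" by (rule root_in_verts)
  show "lv v = 0 \<longleftrightarrow> v = r" if "v \<in> verts G" for v by (rule level_zero[OF that])
  show "lv (head G e) = (lv (tail G e) + 1) mod 3" if e: "e \<in> arcs G" for e
  proof (cases "e \<in> only_incoming_arcs G")
    case True
    then show ?thesis using tree_arc(1)[OF True] tree_arc_tail_level[OF True] by simp
  next
    case False
    then show ?thesis using other_arc[OF e False] level_zero[OF root_in_verts] by simp
  qed
  show "e = f" if ef: "e \<in> arcs G" "f \<in> arcs G" "head G e = head G f" "head G e \<noteq> r" for e f
  proof -
    obtain g where "in_arcs G (head G e) = {g}"
      using tree_arc_into[of "head G e"] ef by auto
    moreover have "e \<in> in_arcs G (head G e)" "f \<in> in_arcs G (head G e)" using ef by simp_all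
    ultimately show ?thesis by (metis singletonD)
  qed
  show "\<exists>e\<in>arcs G. head G e = v" if "v \<in> verts G" "v \<noteq> r" for v
    using tree_arc_into[OF that] only_incoming_sub by fastforce
  show "out_arcs G v \<noteq> {}" if "v \<in> verts G" for v by (rule out_nonempty[OF that])
  show "2 \<le> card (in_arcs G r)" by (rule two_incoming)
qed

text \<open>The leaves are exactly the vertices of level two. Below that level out-degrees in the
  tree and in \<open>G\<close> agree; at level two the tree contributes zero, and the condition on
  leaves speaks about \<open>G\<close>.\<close>

lemma spherically_homogeneous_iff: "spherically_homogeneous G \<longleftrightarrow> level_regular"
proof
  assume sh: "spherically_homogeneous G"
  show level_regular
    unfolding level_regular_def
  proof (intro ballI impI)
    fix u v assume uv: "u \<in> verts G" "v \<in> verts G" "lv u = lv v"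
    show "od u = od v"
    proof (cases "lv u = 2")
      case True
      then have "u \<in> tree_leaves T" "v \<in> tree_leaves T" using uv by (simp_all add: leaves_eq)
      then have "out_degree G u = out_degree G v"
        using sh unfolding spherically_homogeneous_def Let_def by blast
      then show ?thesis by (simp only: out_degree_def)
    next
      case False
      then have "lv u < 2" "lv v < 2" using level_le[OF uv(1)] uv(3) by auto
      moreover have "out_degree T u = out_degree T v"
        using sh uv unfolding spherically_homogeneous_def Let_def T_simps by blast
      ultimately show ?thesis by (simp add: out_degree_def out_arcs_tree)
    qed
  qed
next
  assume reg: level_regular
  have "out_degree T u = out_degree T v" if uv: "u \<in> verts T" "v \<in> verts T" "lv u = lv v" for u v
  proof (cases "lv u = 2")
    case True
    then have "u \<in> tree_leaves T" "v \<in> tree_leaves T" using uv by (simp_all add: leaves_eq)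
    then show ?thesis by (simp add: tree_leaves_def)
  next
    case False
    have uv': "u \<in> verts G" "v \<in> verts G" using uv by simp_all
    then have "lv u < 2" "lv v < 2" using False level_le[of u] uv(3) by auto
    then show ?thesis
      using reg[unfolded level_regular_def, rule_format, OF uv' uv(3)] by (simp add: out_degree_def out_arcs_tree)
  qed
  moreover have "out_degree G u = out_degree G v" if "u \<in> tree_leaves T" "v \<in> tree_leaves T" for u v
    using reg[unfolded level_regular_def, rule_format, of u v] that by (simp add: leaves_eq out_degree_def)
  moreover have "lv u = lv v" if "u \<in> tree_leaves T" "v \<in> tree_leaves T" for u v
    using that by (simp add: leaves_eq)
  moreover have "tail G e \<in> tree_leaves T" if "e \<in> arcs G - only_incoming_arcs G" for e
    using other_arc(2)[of e] that by (simp add: leaves_eq)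
  moreover have "directed_tree T" using uniform by (simp add: uniform_depth_two_def)
  ultimately show "spherically_homogeneous G"
    unfolding spherically_homogeneous_def Let_def by blast
qed

end

theorem corollary5p13:
  fixes G :: "('v, 'e) pre_digraph" and G' :: "('w, 'f) pre_digraph"
  assumes "fin_digraph G" and "fin_digraph G'"
    and "strongly_connected G" and "strongly_connected G'"
    and "\<not> is_cycle_graph G" and "\<not> is_cycle_graph G'"
    and "uniform_depth_two G" and "uniform_depth_two G'"
    and "markov_dyck_conjugate G G'"
  shows "(spherically_homogeneous G \<longrightarrow> spherically_homogeneous G') \<and>
    (spherically_homogeneous G \<and> spherically_homogeneous G' \<longrightarrow> digraph_iso G G')"
proof -
  interpret A: incoming_tree G
    using assms(1,3,7) by (simp add: incoming_tree_def incoming_tree_axioms_def)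
  interpret B: incoming_tree G'
    using assms(2,4,8) by (simp add: incoming_tree_def incoming_tree_axioms_def)
  note DA = A.depth_two_axioms and DB = B.depth_two_axioms
  obtain h where h: "conjugacy G G' h"
    using assms(9) by (auto simp: markov_dyck_conjugate_def conjugacy_def)
  have "digraph_iso G G'" if reg: "A.level_regular" "B.level_regular"
  proof -
    have per: "card (A.periodic_points n) = card (B.periodic_points n)" for n
      using bij_betw_same_card[OF conjugacy_periodic_points[OF h A.wf_digraph_axioms B.wf_digraph_axioms]] .
    obtain m k l where mkl: "0 < m" "0 < k" "0 < l"
      and dA: "\<And>v. v \<in> verts G \<Longrightarrow> A.od v = (if A.lv v = 0 then m else if A.lv v = 1 then k else l)"
      using A.level_regular_params[OF reg(1)] by blast
    obtain m' k' l' where mkl': "0 < m'" "0 < k'" "0 < l'"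
      and dB: "\<And>v. v \<in> verts G' \<Longrightarrow> B.od v = (if B.lv v = 0 then m' else if B.lv v = 1 then k' else l')"
      using B.level_regular_params[OF reg(2)] by blast
    note cA = A.periodic_point_counts[OF dA] and cB = B.periodic_point_counts[OF dB]
    \<comment> \<open>Period three gives the number of loops. Removing it from the number of arcs,
      known from period two, leaves \<open>S\<close>; dividing it out of period five leaves
      \<open>c\<close>.\<close>
    have L: "m * k * l = m' * k' * l'" using per[of 3] cA(2) cB(2) by simp
    have S: "m + m * k = m' + m' * k'" using per[of 2] cA(1) cB(1) L by simp
    have "10 * (m * k * l) * (m + k + l) = 10 * (m * k * l) * (m' + k' + l')"
      using per[of 5] cA(4) cB(4) L by simp
    then have c: "m + k + l = m' + k' + l'" using mkl by simp
    have "m = m' \<and> k = k' \<and> l = l'"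
      using mkl mkl' S L c by (rule parameters_determined) (use per[of 4] cA(3) cB(3) in simp)
    then show ?thesis
      using dA dB by (intro depth_two_iso[OF DA DB, of "\<lambda>i. if i = 0 then m else if i = 1 then k else l"]) simp_all
  qed
  then show ?thesis
    using conjugacy_level_regular[OF h DA DB]
      A.spherically_homogeneous_iff B.spherically_homogeneous_iff by blast
qed

end
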